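(* Let $V$ be a complex vector space of finite dimension $n\ge1$. The map $\mathbb{P}\varphi:\mathbb{P}M_H\to\mathrm{Hinge}^*(V)$ is continuous.
   Context: Fix a Hermitian inner product on $V$. Overlines denote classes in projective spaces, which carry the classical topology. $M$ is the set of all finite sequences $\mathcal{A}=(A_0,\ldots,A_m)$, $m\ge0$, such that $V_0=V$, each $A_i\in\mathrm{Hom}(V_i,V)$ is nonzero, $V_{i+1}=\mathrm{Ker}(A_i)$ for $0\le i\le m$, and $V_{m+1}=0$. Write $V(\mathcal{A})_i:=V_i$, $\mathbb{P}\mathcal{A}:=(\overline{A_0},\ldots,\overline{A_m})$, $\mathbb{P}M:=\{\mathbb{P}\mathcal{A}\mid\mathcal{A}\in M\}$. Topology on $\mathbb{P}M$: for $\mathcal{A}\in M$ and open neighborhoods $U_i$ of $\overline{A_i}$ in $\mathbb{P}\mathrm{Hom}(V(\mathcal{A})_i,V)$ $(0\le i\le m)$, let $U_{\mathbb{P}\mathcal{A}}(U_0,\ldots,U_m)$ be the set of $\mathbb{P}\mathcal{B}\in\mathbb{P}M$ such that for every $i$ there exists $j$ with $V(\mathcal{B})_j\supseteq V(\mathcal{A})_i$, $B_j|_{V(\mathcal{A})_i}\neq0$ and $\overline{B_j|_{V(\mathcal{A})_i}}\in U_i$. These sets form a base of neighborhoods of $\mathbb{P}\mathcal{A}$ and define the topology. $M_H:=\{\mathcal{A}\in M\mid\bigoplus_{i=0}^m\mathrm{Im}(A_i)=V\}$, and $\mathbb{P}M_H\subseteq\mathbb{P}M$ is its image, with the subspace topology.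 Hinges. A linear relation $P:V\rightrightarrows V$ is a linear subspace of $V\oplus V$; with $p_1,p_2$ the two projections, $\mathrm{Dom}(P)=p_1(P)$, $\mathrm{Im}(P)=p_2(P)$, $\mathrm{Ker}(P)=p_1(P\cap(V\oplus0))$, $\mathrm{Indef}(P)=p_2(P\cap(0\oplus V))$. A hinge is a sequence $(P_0,\ldots,P_m)$ of linear relations $V\rightrightarrows V$ of dimension $n$ with $\mathrm{Ker}(P_j)=\mathrm{Dom}(P_{j+1})$ and $\mathrm{Im}(P_j)=\mathrm{Indef}(P_{j+1})$ for $0\le j\le m-1$, $\mathrm{Dom}(P_0)=V$, $\mathrm{Im}(P_m)=V$, and $P_j\ne\mathrm{Ker}(P_j)\oplus\mathrm{Indef}(P_j)$ for all $j$. $\mathrm{Hinge}(V)$ is the set of hinges and $\mathrm{Hinge}^*(V)$ is its quotient by $(P_0,\ldots,P_m)\sim(c_0P_0,\ldots,c_mP_m)$, $c_i\in\mathbb{C}^\times$, where $cP=\{(x,cy)\mid(x,y)\in P\}$. The map $\varphi:M_H\to\mathrm{Hinge}(V)$ sends $\mathcal{A}=(A_0,\ldots,A_m)$ to $(P_0,\ldots,P_m)$ with $P_i=\{(x,A_ix)\mid x\in V(\mathcal{A})_i\}+\big(0\oplus\sum_{k=0}^{i-1}\mathrm{Im}(A_k)\big)$; it induces a surjection $\mathbb{P}\varphi:\mathbb{P}M_H\to\mathrm{Hinge}^*(V)$. Topology on $\mathrm{Hinge}^*(V)$ (Neretin's). For $\mathcal{A}\in M_H$ let $V(\mathcal{A})'_i$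 be the orthogonal complement of $V(\mathcal{A})_{i+1}$ in $V(\mathcal{A})_i$, and $r_i=\dim V(\mathcal{A})'_i$. For $1\le k\le n$ with $r_0+\cdots+r_{j-1}<k\le r_0+\cdots+r_j$, let $\bigwedge^k\mathcal{A}\in\mathrm{End}(\bigwedge^kV)$ agree with $\bigwedge^k(\bigoplus_iA_i|_{V(\mathcal{A})'_i})$ on the summand $\bigwedge^{r_0}V(\mathcal{A})'_0\otimes\cdots\otimes\bigwedge^{k-(r_0+\cdots+r_{j-1})}V(\mathcal{A})'_j$ of $\bigwedge^kV$, and be zero on the other summands of the decomposition of $\bigwedge^kV$ induced by $V=\bigoplus_iV(\mathcal{A})'_i$. Put $\overline\lambda(\mathbb{P}\mathcal{A}):=(\overline{\bigwedge^1\mathcal{A}},\ldots,\overline{\bigwedge^{n-1}\mathcal{A}})\in\prod_{k=1}^{n-1}\mathbb{P}\mathrm{End}(\bigwedge^kV)$. There is an injective map $\lambda^\circ:\mathrm{Hinge}^*(V)\to\prod_{k=1}^{n-1}\mathbb{P}\mathrm{End}(\bigwedge^kV)$ with $\lambda^\circ\circ\mathbb{P}\varphi=\overline\lambda$; by a theorem of Neretin it is a closed embedding, i.e. the topology of $\mathrm{Hinge}^*(V)$ is the one for which $\lambda^\circ$ is a homeomorphism onto its (closed) image. *)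

theory Defs
  imports
    "HOL-Analysis.Analysis"
    "HOL-Combinatorics.Permutations"
    "HOL-Library.Function_Algebras"
    "HOL-Library.Set_Algebras"
begin

section \<open>Complex vector spaces and Hermitian inner products\<close>

class scaleC =
  fixes scaleC :: "complex \<Rightarrow> 'a \<Rightarrow> 'a"  (infixr \<open>*\<^sub>C\<close> 75)

class complex_vector = scaleC + ab_group_add +
  assumes scaleC_add_right: "a *\<^sub>C (x + y) = a *\<^sub>C x + a *\<^sub>C y"
    and scaleC_add_left: "(a + b) *\<^sub>C x = a *\<^sub>C x + b *\<^sub>C x"
    and scaleC_scaleC: "a *\<^sub>C (b *\<^sub>C x) = (a * b) *\<^sub>C x"
    and scaleC_one: "1 *\<^sub>C x = x"

global_interpretation complex_vector:
  vector_space "scaleC :: complex \<Rightarrow> 'a \<Rightarrow> 'a::complex_vector"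
  defines csubspace = complex_vector.subspace
    and cspan = complex_vector.span
    and cdim = complex_vector.dim
  by unfold_locales (simp_all add: scaleC_add_right scaleC_add_left scaleC_scaleC scaleC_one)

instantiation complex :: complex_vector
begin
definition scaleC_complex :: "complex \<Rightarrow> complex \<Rightarrow> complex"
  where "scaleC_complex a x = a * x"
instance by standard (simp_all add: scaleC_complex_def algebra_simps)
end

instantiation prod :: (complex_vector, complex_vector) complex_vector
begin
definition scaleC_prod :: "complex \<Rightarrow> 'a \<times> 'b \<Rightarrow> 'a \<times> 'b"
  where "scaleC_prod a p = (a *\<^sub>C fst p, a *\<^sub>C snd p)"
instance by standard
    (simp_all add: scaleC_prod_def prod_eq_iff scaleC_add_right scaleC_add_left
      scaleC_scaleC scaleC_one)
end

instantiation "fun" :: (type, complex_vector) complex_vector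
begin
definition scaleC_fun :: "complex \<Rightarrow> ('a \<Rightarrow> 'b) \<Rightarrow> 'a \<Rightarrow> 'b"
  where "scaleC_fun a f = (\<lambda>x. a *\<^sub>C f x)"
instance by standard
    (simp_all add: scaleC_fun_def fun_eq_iff scaleC_add_right scaleC_add_left
      scaleC_scaleC scaleC_one)
end

instantiation vec :: (complex_vector, finite) complex_vector
begin
definition scaleC_vec :: "complex \<Rightarrow> ('a, 'b) vec \<Rightarrow> ('a, 'b) vec"
  where "scaleC_vec a x = (\<chi> i. a *\<^sub>C (x $ i))"
instance by standard
    (simp_all add: scaleC_vec_def vec_eq_iff scaleC_add_right scaleC_add_left
      scaleC_scaleC scaleC_one)
end

text \<open>A complex vector space with a fixed Hermitian inner product, antilinear in the first
  argument. The underlying real inner product space (hence the norm and the topology) is given by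
  the real part of the Hermitian product; positive definiteness is inherited from
  \<^class>\<open>real_inner\<close>. Finite-dimensionality is not part of the class.\<close>

class hermitian_space = complex_vector + real_inner +
  fixes cinner :: "'a \<Rightarrow> 'a \<Rightarrow> complex"
  assumes scaleR_eq_scaleC: "r *\<^sub>R x = complex_of_real r *\<^sub>C x"
    and cinner_commute: "cinner x y = cnj (cinner y x)"
    and cinner_add_right: "cinner x (y + z) = cinner x y + cinner x z"
    and cinner_scaleC_right: "cinner x (c *\<^sub>C y) = c * cinner x y"
    and inner_eq_Re_cinner: "inner x y = Re (cinner x y)"

instantiation complex :: hermitian_space
begin
definition cinner_complex :: "complex \<Rightarrow> complex \<Rightarrow> complex"
  where "cinner_complex x y = cnj x * y"
instance by standard
    (simp_all add: cinner_complex_def scaleC_complex_def inner_complex_def algebra_simps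
      scaleR_conv_of_real)
end

instantiation vec :: (hermitian_space, finite) hermitian_space
begin
definition cinner_vec :: "('a, 'b) vec \<Rightarrow> ('a, 'b) vec \<Rightarrow> complex"
  where "cinner_vec x y = (\<Sum>i\<in>UNIV. cinner (x $ i) (y $ i))"
instance
proof
  fix x y :: "('a, 'b) vec"
  have "cinner (x $ i) (y $ i) = cnj (cinner (y $ i) (x $ i))" for i
    by (rule cinner_commute)
  then show "cinner x y = cnj (cinner y x)"
    unfolding cinner_vec_def cnj_sum by (intro sum.cong refl)
qed (simp_all add: cinner_vec_def scaleC_vec_def vec_eq_iff scaleR_eq_scaleC cinner_add_right
      cinner_scaleC_right sum.distrib sum_distrib_left inner_vec_def inner_eq_Re_cinner)
end


section \<open>Spaces of linear maps and projective spaces\<close>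

text \<open>A linear map on a subspace \<open>U\<close> is represented by a function on the whole type that
  vanishes outside \<open>U\<close>, so that \<open>Hom(U, W)\<close> is a complex vector space under pointwise operations.\<close>

definition hom_space ::
    "'a::complex_vector set \<Rightarrow> 'b::complex_vector set \<Rightarrow> ('a \<Rightarrow> 'b) set"
  where "hom_space U W = {f. (\<forall>x\<in>U. f x \<in> W)
    \<and> (\<forall>x\<in>U. \<forall>y\<in>U. f (x + y) = f x + f y)
    \<and> (\<forall>c. \<forall>x\<in>U. f (c *\<^sub>C x) = c *\<^sub>C f x)
    \<and> (\<forall>x. x \<notin> U \<longrightarrow> f x = 0)}"

definition restr :: "('a \<Rightarrow> 'b::zero) \<Rightarrow> 'a set \<Rightarrow> 'a \<Rightarrow> 'b"
  where "restr f U = (\<lambda>x. if x \<in> U then f x else 0)"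

definition proj_class :: "'w::complex_vector \<Rightarrow> 'w set"
  where "proj_class w = {c *\<^sub>C w | c. c \<noteq> 0}"

definition proj_space :: "'w::complex_vector set \<Rightarrow> 'w set set"
  where "proj_space W = proj_class ` (W - {0})"

text \<open>The quotient topology of the subspace topology on \<open>W - {0}\<close>. In all uses below \<open>W\<close> is a
  finite-dimensional space of functions, and the subspace topology is the one of pointwise
  convergence; by finite-dimensionality this is the classical topology of \<open>W\<close>.\<close>

definition proj_topology ::
    "'w::{complex_vector, topological_space} set \<Rightarrow> 'w set topology"
  where "proj_topology W = topology (\<lambda>S. S \<subseteq> proj_space W \<and>
    openin (top_of_set (W - {0})) {w \<in> W - {0}. proj_class w \<in> S})"

lemma istopology_proj_topology:
  "istopology (\<lambda>S. S \<subseteq> proj_space W \<and>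
    openin (top_of_set (W - {0})) {w \<in> W - {0}. proj_class w \<in> S})"
proof -
  have 1: "{w \<in> W - {0}. proj_class w \<in> S \<inter> T} =
      {w \<in> W - {0}. proj_class w \<in> S} \<inter> {w \<in> W - {0}. proj_class w \<in> T}" for S T
    by blast
  have 2: "{w \<in> W - {0}. proj_class w \<in> \<Union>K} =
      (\<Union>S\<in>K. {w \<in> W - {0}. proj_class w \<in> S})" for K
    by blast
  show ?thesis
    unfolding istopology_def 1 2 by blast
qed


section \<open>The space \<open>\<P>M\<close>\<close>

text \<open>\<open>dom_seq A i\<close> is \<open>V(A)\<^sub>i\<close>; it is meaningful for \<open>i \<le> length A = m + 1\<close>.\<close>

primrec dom_seq :: "('v::complex_vector \<Rightarrow> 'v) list \<Rightarrow> nat \<Rightarrow> 'v set" where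
  "dom_seq A 0 = UNIV"
| "dom_seq A (Suc i) = {x \<in> dom_seq A i. (A ! i) x = 0}"

definition im_seq :: "('v::complex_vector \<Rightarrow> 'v) list \<Rightarrow> nat \<Rightarrow> 'v set"
  where "im_seq A i = (A ! i) ` dom_seq A i"

definition M_set :: "('v::complex_vector \<Rightarrow> 'v) list set"
  where "M_set = {A. A \<noteq> []
    \<and> (\<forall>i<length A. A ! i \<in> hom_space (dom_seq A i) UNIV \<and> A ! i \<noteq> 0)
    \<and> dom_seq A (length A) = {0}}"

definition proj_seq :: "('v::complex_vector \<Rightarrow> 'v) list \<Rightarrow> ('v \<Rightarrow> 'v) set list"
  where "proj_seq A = map proj_class A"

definition PM :: "('v::complex_vector \<Rightarrow> 'v) set list set"
  where "PM = proj_seq ` M_set"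

definition PM_nbhd ::
    "('v::complex_vector \<Rightarrow> 'v) list \<Rightarrow> (nat \<Rightarrow> ('v \<Rightarrow> 'v) set set) \<Rightarrow> ('v \<Rightarrow> 'v) set list set"
  where "PM_nbhd A U = {proj_seq B | B. B \<in> M_set \<and>
    (\<forall>i<length A. \<exists>j<length B. dom_seq A i \<subseteq> dom_seq B j
      \<and> restr (B ! j) (dom_seq A i) \<noteq> 0
      \<and> proj_class (restr (B ! j) (dom_seq A i)) \<in> U i)}"

definition PM_topology ::
    "('v::{complex_vector, topological_space} \<Rightarrow> 'v) set list topology"
  where "PM_topology = topology (\<lambda>S. S \<subseteq> PM \<and>
    (\<forall>A\<in>M_set. proj_seq A \<in> S \<longrightarrow>
      (\<exists>U. (\<forall>i<length A. openin (proj_topology (hom_space (dom_seq A i) UNIV)) (U i)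
              \<and> proj_class (A ! i) \<in> U i)
         \<and> PM_nbhd A U \<subseteq> S)))"

lemma PM_nbhd_mono: "(\<And>i. i < length A \<Longrightarrow> U i \<subseteq> U' i) \<Longrightarrow> PM_nbhd A U \<subseteq> PM_nbhd A U'"
  unfolding PM_nbhd_def by blast

lemma istopology_PM_topology:
  "istopology (\<lambda>S. S \<subseteq> PM \<and>
    (\<forall>A\<in>M_set. proj_seq A \<in> S \<longrightarrow>
      (\<exists>U. (\<forall>i<length A. openin (proj_topology (hom_space (dom_seq A i) UNIV)) (U i)
              \<and> proj_class (A ! i) \<in> U i)
         \<and> PM_nbhd A U \<subseteq> S)))"
  (is "istopology (\<lambda>S. S \<subseteq> PM \<and> (\<forall>A\<in>M_set. proj_seq A \<in> S \<longrightarrow> ?P A S))")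
proof -
  have inter: "?P A (S \<inter> T)" if S: "?P A S" and T: "?P A T" for A :: "('a \<Rightarrow> 'a) list" and S T
  proof -
    from S obtain U where U: "\<forall>i<length A.
        openin (proj_topology (hom_space (dom_seq A i) UNIV)) (U i) \<and> proj_class (A ! i) \<in> U i"
      "PM_nbhd A U \<subseteq> S" by blast
    from T obtain U' where U': "\<forall>i<length A.
        openin (proj_topology (hom_space (dom_seq A i) UNIV)) (U' i) \<and> proj_class (A ! i) \<in> U' i"
      "PM_nbhd A U' \<subseteq> T" by blast
    have "PM_nbhd A (\<lambda>i. U i \<inter> U' i) \<subseteq> PM_nbhd A U"
      "PM_nbhd A (\<lambda>i. U i \<inter> U' i) \<subseteq> PM_nbhd A U'"
      by (auto intro!: PM_nbhd_mono)
    with U U' show ?thesis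
      by (intro exI[of _ "\<lambda>i. U i \<inter> U' i"]) (auto intro: openin_Int)
  qed
  have mono: "?P A T" if "?P A S" "S \<subseteq> T" for A :: "('a \<Rightarrow> 'a) list" and S T
    using that by (meson order_trans)
  show ?thesis
    unfolding istopology_def
  proof (intro conjI allI impI)
    fix S T :: "('a \<Rightarrow> 'a) set list set"
    assume S: "S \<subseteq> PM \<and> (\<forall>A\<in>M_set. proj_seq A \<in> S \<longrightarrow> ?P A S)"
      and T: "T \<subseteq> PM \<and> (\<forall>A\<in>M_set. proj_seq A \<in> T \<longrightarrow> ?P A T)"
    then show "S \<inter> T \<subseteq> PM" by blast
    show "\<forall>A\<in>M_set. proj_seq A \<in> S \<inter> T \<longrightarrow> ?P A (S \<inter> T)"
      using S T by (intro ballI impI inter) auto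
  next
    fix K :: "('a \<Rightarrow> 'a) set list set set"
    assume K: "\<forall>S\<in>K. S \<subseteq> PM \<and> (\<forall>A\<in>M_set. proj_seq A \<in> S \<longrightarrow> ?P A S)"
    then show "\<Union>K \<subseteq> PM" by blast
    show "\<forall>A\<in>M_set. proj_seq A \<in> \<Union>K \<longrightarrow> ?P A (\<Union>K)"
    proof (intro ballI impI)
      fix A :: "('a \<Rightarrow> 'a) list"
      assume A: "A \<in> M_set" "proj_seq A \<in> \<Union>K"
      then obtain S where S: "S \<in> K" "proj_seq A \<in> S" by blast
      with K A(1) have "?P A S" by blast
      then show "?P A (\<Union>K)" by (rule mono) (use S in blast)
    qed
  qed
qed

definition is_direct_sum :: "'i set \<Rightarrow> ('i \<Rightarrow> 'v::comm_monoid_add set) \<Rightarrow> 'v set \<Rightarrow> bool"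
  where "is_direct_sum I F W \<longleftrightarrow>
    (\<forall>x \<in> Pi\<^sub>E I F. sum x I \<in> W) \<and> (\<forall>w\<in>W. \<exists>!x. x \<in> Pi\<^sub>E I F \<and> sum x I = w)"

definition MH_set :: "('v::complex_vector \<Rightarrow> 'v) list set"
  where "MH_set = {A \<in> M_set. is_direct_sum {..<length A} (im_seq A) UNIV}"

definition PMH :: "('v::complex_vector \<Rightarrow> 'v) set list set"
  where "PMH = proj_seq ` MH_set"

definition PMH_topology ::
    "('v::{complex_vector, topological_space} \<Rightarrow> 'v) set list topology"
  where "PMH_topology = subtopology PM_topology PMH"


section \<open>Hinges\<close>

text \<open>Linear relations are complex subspaces of \<open>V \<times> V\<close>; their domain and image are
  \<^const>\<open>Domain\<close> and \<^const>\<open>Range\<close>.\<close>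

definition Ker_rel :: "('v::complex_vector) rel \<Rightarrow> 'v set"
  where "Ker_rel P = {x. (x, 0) \<in> P}"

definition Indef_rel :: "('v::complex_vector) rel \<Rightarrow> 'v set"
  where "Indef_rel P = {y. (0, y) \<in> P}"

definition Hinge :: "('v::complex_vector) rel list set"
  where "Hinge = {P. P \<noteq> []
    \<and> (\<forall>j<length P. csubspace (P ! j) \<and> cdim (P ! j) = cdim (UNIV :: 'v set))
    \<and> (\<forall>j. Suc j < length P \<longrightarrow> Ker_rel (P ! j) = Domain (P ! Suc j)
                                \<and> Range (P ! j) = Indef_rel (P ! Suc j))
    \<and> Domain (hd P) = UNIV
    \<and> Range (last P) = UNIV
    \<and> (\<forall>j<length P. P ! j \<noteq> Ker_rel (P ! j) \<times> Indef_rel (P ! j))}"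

definition scale_rel :: "complex \<Rightarrow> ('v::complex_vector) rel \<Rightarrow> 'v rel"
  where "scale_rel c P = {(x, c *\<^sub>C y) | x y. (x, y) \<in> P}"

definition hinge_equiv :: "(('v::complex_vector) rel list \<times> 'v rel list) set"
  where "hinge_equiv = {(P, Q). P \<in> Hinge \<and> Q \<in> Hinge \<and> length Q = length P
    \<and> (\<exists>c. \<forall>i<length P. c i \<noteq> 0 \<and> Q ! i = scale_rel (c i) (P ! i))}"

definition Hinge_star :: "('v::complex_vector) rel list set set"
  where "Hinge_star = Hinge // hinge_equiv"

text \<open>The sums below are those of \<^theory>\<open>HOL-Library.Set_Algebras\<close>; the empty sum is \<open>{0}\<close>.\<close>

definition phi :: "('v::complex_vector \<Rightarrow> 'v) list \<Rightarrow> 'v rel list"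
  where "phi A = map (\<lambda>i. {(x, (A ! i) x) | x. x \<in> dom_seq A i}
                           + ({0} \<times> (\<Sum>k<i. im_seq A k))) [0..<length A]"

definition Pphi :: "('v::complex_vector \<Rightarrow> 'v) set list \<Rightarrow> 'v rel list set"
  where "Pphi p = (THE h. \<exists>A\<in>MH_set. proj_seq A = p \<and> h = hinge_equiv `` {phi A})"


section \<open>Exterior powers\<close>

text \<open>The exterior power \<open>\<Lambda>\<^sup>k V\<close> is realised inside the space of functions of \<open>k\<close> vectors, an element
  \<open>\<omega>\<close> being identified with \<open>(u\<^sub>0, \<dots>, u\<^sub>k\<^sub>-\<^sub>1) \<mapsto> \<langle>u\<^sub>0 \<and> \<dots> \<and> u\<^sub>k\<^sub>-\<^sub>1, \<omega>\<rangle>\<close> for the induced Hermitian inner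
  product, i.e. \<open>v\<^sub>0 \<and> \<dots> \<and> v\<^sub>k\<^sub>-\<^sub>1\<close> with \<open>u \<mapsto> det (\<langle>u\<^sub>i, v\<^sub>j\<rangle>)\<close>. Only the entries with index \<open>< k\<close> of a
  sequence matter.\<close>

definition wedge :: "nat \<Rightarrow> (nat \<Rightarrow> 'v::hermitian_space) \<Rightarrow> (nat \<Rightarrow> 'v) \<Rightarrow> complex"
  where "wedge k v = (\<lambda>u. \<Sum>p | p permutes {..<k}.
    of_int (sign p) * (\<Prod>i<k. cinner (u i) (v (p i))))"

definition ext_power :: "nat \<Rightarrow> ((nat \<Rightarrow> 'v::hermitian_space) \<Rightarrow> complex) set"
  where "ext_power k = cspan (range (wedge k))"

type_synonym 'v ext_end = "((nat \<Rightarrow> 'v) \<Rightarrow> complex) \<Rightarrow> ((nat \<Rightarrow> 'v) \<Rightarrow> complex)"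

definition End_ext :: "nat \<Rightarrow> 'v::hermitian_space ext_end set"
  where "End_ext k = hom_space (ext_power k) (ext_power k)"

definition ext_map :: "nat \<Rightarrow> ('v::hermitian_space \<Rightarrow> 'v) \<Rightarrow> 'v ext_end"
  where "ext_map k g = (THE T. T \<in> End_ext k \<and> (\<forall>v. T (wedge k v) = wedge k (g \<circ> v)))"

definition orth_dom :: "('v::hermitian_space \<Rightarrow> 'v) list \<Rightarrow> nat \<Rightarrow> 'v set"
  where "orth_dom A i = {x \<in> dom_seq A i. \<forall>y\<in>dom_seq A (Suc i). cinner x y = 0}"

definition rk :: "('v::hermitian_space \<Rightarrow> 'v) list \<Rightarrow> nat \<Rightarrow> nat"
  where "rk A i = cdim (orth_dom A i)"

text \<open>The map \<open>\<Oplus>\<^sub>i A\<^sub>i|V(A)'\<^sub>i\<close> on \<open>V = \<Oplus>\<^sub>i V(A)'\<^sub>i\<close>.\<close>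

definition block_sum :: "('v::hermitian_space \<Rightarrow> 'v) list \<Rightarrow> 'v \<Rightarrow> 'v"
  where "block_sum A = (THE g. g \<in> hom_space UNIV UNIV \<and>
    (\<forall>i<length A. \<forall>x\<in>orth_dom A i. g x = (A ! i) x))"

text \<open>\<open>ext_summand A k a\<close> is the summand \<open>\<Otimes>\<^sub>i \<Lambda>\<^bsup>a i\<^esup> V(A)'\<^sub>i\<close> of \<open>\<Lambda>\<^sup>k V\<close>: it is spanned by the wedges of
  vectors \<open>v l \<in> V(A)'\<^bsub>t l\<^esub>\<close> with exactly \<open>a i\<close> factors taken from \<open>V(A)'\<^sub>i\<close>. It is zero unless \<open>a\<close>
  vanishes at all \<open>i \<ge> length A\<close> and has sum \<open>k\<close>.\<close>

definition ext_summand ::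
    "('v::hermitian_space \<Rightarrow> 'v) list \<Rightarrow> nat \<Rightarrow> (nat \<Rightarrow> nat) \<Rightarrow> ((nat \<Rightarrow> 'v) \<Rightarrow> complex) set"
  where "ext_summand A k a = cspan {wedge k v | v. \<exists>t.
    (\<forall>l<k. t l < length A \<and> v l \<in> orth_dom A (t l)) \<and> (\<forall>i. card {l. l < k \<and> t l = i} = a i)}"

text \<open>The multidegree \<open>(r\<^sub>0, \<dots>, r\<^bsub>j-1\<^esub>, k - (r\<^sub>0 + \<dots> + r\<^bsub>j-1\<^esub>), 0, \<dots>)\<close>, where \<open>j\<close> is the index with
  \<open>r\<^sub>0 + \<dots> + r\<^bsub>j-1\<^esub> < k \<le> r\<^sub>0 + \<dots> + r\<^sub>j\<close>.\<close>

definition top_degree :: "('v::hermitian_space \<Rightarrow> 'v) list \<Rightarrow> nat \<Rightarrow> nat \<Rightarrow> nat"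
  where "top_degree A k = (let j = (LEAST j. k \<le> (\<Sum>i\<le>j. rk A i)) in
    (\<lambda>i. if i < j then rk A i else if i = j then k - (\<Sum>i<j. rk A i) else 0))"

definition ext_seq :: "nat \<Rightarrow> ('v::hermitian_space \<Rightarrow> 'v) list \<Rightarrow> 'v ext_end"
  where "ext_seq k A = (THE T. T \<in> End_ext k
    \<and> (\<forall>w\<in>ext_summand A k (top_degree A k). T w = ext_map k (block_sum A) w)
    \<and> (\<forall>a. a \<noteq> top_degree A k \<longrightarrow> (\<forall>w\<in>ext_summand A k a. T w = 0)))"


section \<open>The topology of the space of hinges\<close>

definition proj_End_prod_topology :: "(nat \<Rightarrow> 'v::hermitian_space ext_end set) topology"
  where "proj_End_prod_topology =
    product_topology (\<lambda>k. proj_topology (End_ext k)) {1..<cdim (UNIV :: 'v set)}"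

definition lambda_bar ::
    "('v::hermitian_space \<Rightarrow> 'v) set list \<Rightarrow> nat \<Rightarrow> 'v ext_end set"
  where "lambda_bar p = (THE l. \<exists>A\<in>MH_set. proj_seq A = p \<and>
    l = (\<lambda>k\<in>{1..<cdim (UNIV :: 'v set)}. proj_class (ext_seq k A)))"

text \<open>The map determined by \<open>lambda_circ (Pphi p) = lambda_bar p\<close>.\<close>

definition lambda_circ ::
    "('v::hermitian_space) rel list set \<Rightarrow> nat \<Rightarrow> 'v ext_end set"
  where "lambda_circ h = (THE l. \<exists>p\<in>PMH. Pphi p = h \<and> l = lambda_bar p)"

text \<open>By a theorem of Neretin \<^const>\<open>lambda_circ\<close> is an injective map on \<open>Hinge_star\<close> with closed image; the pullback topology is the one for which it is a
  homeomorphism onto its image.\<close>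

definition Hinge_star_topology :: "('v::hermitian_space) rel list set topology"
  where "Hinge_star_topology =
    pullback_topology Hinge_star lambda_circ proj_End_prod_topology"

end

theory Submission
  imports Defs
begin

text \<open>An element \<open>A\<close> of \<open>M\<close> has an orthonormal basis \<open>e\<close> of \<open>V\<close> adapted to its flag: \<open>V(A)\<^sub>i\<close> is spanned
  by the \<open>e l\<close> with \<open>t l \<ge> i\<close>, where \<open>t\<close> is nondecreasing. With \<open>h l = A\<^bsub>t l\<^esub> (e l)\<close>, the operator
  \<open>\<Lambda>\<^sup>kA\<close> sends \<open>e\<^bsub>L 0\<^esub> \<and> \<dots> \<and> e\<^bsub>L (k-1)\<^esub>\<close> to \<open>h\<^bsub>L 0\<^esub> \<and> \<dots> \<and> h\<^bsub>L (k-1)\<^esub>\<close> if the types of the \<open>L a\<close> are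
  those of \<open>0, \<dots>, k - 1\<close>, and to zero otherwise. Its class depends only on the hinge of \<open>A\<close>: passing to
  equivalent hinges rescales the \<open>h l\<close> and adds to each of them a combination of \<open>h\<close>'s of smaller
  type, all of which occur in the wedge.

  If \<open>A \<in> M\<^sub>H\<close> and \<open>B\<close> is close to \<open>A\<close>, then \<open>B\<^bsub>j(i)\<^esub>\<close> is close to \<open>c\<^sub>i A\<^sub>i\<close> on \<open>V(A)\<^sub>i\<close> for some scalar \<open>c\<^sub>i\<close>. As the
  \<open>h l\<close> are independent, so are the nearby vectors \<open>B\<^bsub>j(t l)\<^esub> (e l) / c\<^bsub>t l\<^esub>\<close>, which forces \<open>e\<close> to be
  adapted to the flag of \<open>B\<close> as well, with types \<open>j(t l)\<close>. When \<open>i < i'\<close> and \<open>j(i) = j(i')\<close>, the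
  scalar \<open>c\<^bsub>i'\<^esub>\<close> is small compared to \<open>c\<^sub>i\<close>. Dividing \<open>\<Lambda>\<^sup>kB\<close> by the product of the \<open>c\<^bsub>t a\<^esub>\<close> with
  \<open>a < k\<close> therefore leaves the wedges of top degree for \<open>A\<close> almost unchanged and makes all others
  small, so the result is close to \<open>\<Lambda>\<^sup>kA\<close>.\<close>

section \<open>Linear maps on subspaces\<close>

text \<open>The scalar \<open>c i'\<close> is small compared to \<open>c i\<close> for the following
  reason. On \<open>V(A)_i\<close> the map \<open>B_(j(i)) / c i\<close> is close to
  \<open>A_i\<close>, which kills every basis vector \<open>e l\<close> of type
  \<open>i' > i\<close>. If \<open>j(i) = j(i')\<close>, the same map \<open>B_(j(i))\<close> sends
  \<open>e l\<close> to about \<open>c i' * h l\<close>, and the norms of the \<open>h l\<close> are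
  bounded below. No single scalar is controlled, only these ratios; so the proof compares products
  of scalars over multi-indices that have the same degree for the flag of \<open>B\<close>. The
  basis \<open>e\<close> comes from \<open>A\<close> alone and serves all nearby \<open>B\<close>.
  This makes the two operators comparable coefficient by coefficient, although the flag of
  \<open>B\<close> varies and may be shorter. A further obstacle is that \<open>ext_map\<close>,
  \<open>block_sum\<close>, \<open>ext_seq\<close>, \<open>Pphi\<close>, \<open>lambda_bar\<close>
  and \<open>lambda_circ\<close> are definite descriptions. The adapted basis gives explicit
  formulas for the first three; the last three are settled by showing that the choice of a
  representative does not matter.\<close>

lemma hom_spaceD:
  assumes "f \<in> hom_space U W"
  shows "x \<in> U \<Longrightarrow> f x \<in> W"
    and "x \<in> U \<Longrightarrow> y \<in> U \<Longrightarrow> f (x + y) = f x + f y"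
    and "x \<in> U \<Longrightarrow> f (c *\<^sub>C x) = c *\<^sub>C f x"
    and "x \<notin> U \<Longrightarrow> f x = 0"
  using assms by (auto simp: hom_space_def)

lemma hom_space_zero:
  assumes "f \<in> hom_space U W" "csubspace U"
  shows "f 0 = 0"
  using hom_spaceD(3)[OF assms(1), of 0 0] complex_vector.subspace_0[OF assms(2)] by simp

lemma hom_space_sum:
  assumes "f \<in> hom_space U W" "csubspace U" "\<And>i. i \<in> I \<Longrightarrow> x i \<in> U"
  shows "f (\<Sum>i\<in>I. c i *\<^sub>C x i) = (\<Sum>i\<in>I. c i *\<^sub>C f (x i))"
  using assms(3)
proof (induction I rule: infinite_finite_induct)
  case (insert i I)
  have "c i *\<^sub>C x i \<in> U" "(\<Sum>i\<in>I. c i *\<^sub>C x i) \<in> U"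
    using insert assms(2)
    by (auto intro!: complex_vector.subspace_scale complex_vector.subspace_sum)
  with insert show ?case
    by (simp add: hom_spaceD(2,3)[OF assms(1)])
qed (simp_all add: hom_space_zero[OF assms(1,2)])

lemma hom_space_eq_on_span:
  assumes f: "f \<in> hom_space U W" and g: "g \<in> hom_space U W" and U: "csubspace U"
    and S: "S \<subseteq> U" and eq: "\<And>x. x \<in> S \<Longrightarrow> f x = g x" and x: "x \<in> cspan S"
  shows "f x = g x"
proof -
  from x obtain T c where T: "finite T" "T \<subseteq> S" "x = (\<Sum>a\<in>T. c a *\<^sub>C a)"
    unfolding complex_vector.span_explicit by auto
  have "\<And>a. a \<in> T \<Longrightarrow> a \<in> U" using T S by blast
  then show ?thesis
    using T(2) eq hom_space_sum[OF f U, of T "\<lambda>a. a" c] hom_space_sum[OF g U, of T "\<lambda>a. a" c]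
    unfolding T(3) by (simp add: subset_iff)
qed

text \<open>Elements of \<open>hom_space U W\<close> vanish off \<open>U\<close> by convention, so
  agreement on generators of \<open>U\<close> already gives equality as functions on the whole
  type.\<close>

lemma hom_space_eqI:
  assumes f: "f \<in> hom_space U W" and g: "g \<in> hom_space U W" and U: "csubspace U"
    and S: "U \<subseteq> cspan S" "S \<subseteq> U" and eq: "\<And>x. x \<in> S \<Longrightarrow> f x = g x"
  shows "f = g"
proof
  fix x
  show "f x = g x"
    using hom_space_eq_on_span[OF f g U S(2) eq] S(1) hom_spaceD(4)[OF f] hom_spaceD(4)[OF g]
    by (cases "x \<in> U") auto
qed

lemma hom_space_scale:
  assumes "f \<in> hom_space U W" "csubspace W"
  shows "c *\<^sub>C f \<in> hom_space U W"
  using assms complex_vector.subspace_scale[OF assms(2)]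
  by (simp add: hom_space_def scaleC_fun_def scaleC_add_right scaleC_scaleC mult.commute)

section \<open>Hermitian inner products\<close>

lemma cinner_add_left: "cinner (x + y) z = cinner x z + cinner y (z::'v::hermitian_space)"
  by (metis cinner_commute cinner_add_right complex_cnj_add)

lemma cinner_scaleC_left: "cinner (c *\<^sub>C x) y = cnj c * cinner x (y::'v::hermitian_space)"
  by (metis cinner_commute cinner_scaleC_right complex_cnj_mult)

lemma cinner_zero_right [simp]: "cinner x (0::'v::hermitian_space) = 0"
  using cinner_add_right[of x 0 0] by simp

lemma cinner_zero_left [simp]: "cinner (0::'v::hermitian_space) x = 0"
  using cinner_add_left[of 0 0 x] by simp

lemma cinner_sum_right: "cinner x (sum f I) = (\<Sum>i\<in>I. cinner x (f i))"
  for x :: "'v::hermitian_space"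
  by (induction I rule: infinite_finite_induct) (simp_all add: cinner_add_right)

lemma cinner_sum_left: "cinner (sum f I) x = (\<Sum>i\<in>I. cinner (f i) x)"
  for x :: "'v::hermitian_space"
  by (induction I rule: infinite_finite_induct) (simp_all add: cinner_add_left)

lemma cinner_diff_right: "cinner x (y - z) = cinner x y - cinner x (z::'v::hermitian_space)"
  by (metis add_diff_cancel_right' cinner_add_right diff_add_cancel)

lemma cinner_self: "cinner x x = complex_of_real ((norm (x::'v::hermitian_space))\<^sup>2)"
proof -
  have "cinner x x \<in> \<real>"
    using cinner_commute[of x x] by (simp add: Reals_cnj_iff)
  then have "cinner x x = complex_of_real (Re (cinner x x))"
    by simp
  then show ?thesis
    by (metis inner_eq_Re_cinner power2_norm_eq_inner)
qed

lemma cinner_self_eq_0 [simp]: "cinner x x = 0 \<longleftrightarrow> x = (0::'v::hermitian_space)"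
  by (simp add: cinner_self)

text \<open>Antilinearity in the first argument turns \<open>\<i>\<close> into \<open>-\<i>\<close>,
  and the real part of \<open>-\<i> * z\<close> is the imaginary part of \<open>z\<close>. This
  transfers continuity and Cauchy-Schwarz from the real inner product.\<close>

lemma cinner_eq_inner:
  "cinner u x = Complex (inner u x) (inner (\<i> *\<^sub>C u) (x::'v::hermitian_space))"
  by (simp add: complex_eq_iff inner_eq_Re_cinner cinner_scaleC_left)

lemma norm_scaleC: "norm (c *\<^sub>C (x::'v::hermitian_space)) = cmod c * norm x"
proof -
  have "complex_of_real ((norm (c *\<^sub>C x))\<^sup>2) = complex_of_real ((cmod c * norm x)\<^sup>2)"
    unfolding cinner_self[symmetric] cinner_scaleC_left cinner_scaleC_right
    by (simp add: cinner_self power_mult_distrib complex_norm_square[symmetric] mult.assoc[symmetric]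
        mult.commute[of "cnj c"] flip: of_real_power)
  then show ?thesis
    unfolding of_real_eq_iff by (rule power2_eq_imp_eq) auto
qed

lemma tendsto_scaleC [tendsto_intros]:
  fixes f :: "'b \<Rightarrow> 'v::hermitian_space"
  assumes "(f \<longlongrightarrow> l) F"
  shows "((\<lambda>x. c *\<^sub>C f x) \<longlongrightarrow> c *\<^sub>C l) F"
proof -
  have "((\<lambda>x. norm (f x - l)) \<longlongrightarrow> 0) F"
    using assms LIM_zero tendsto_norm_zero by blast
  then have "((\<lambda>x. cmod c * norm (f x - l)) \<longlongrightarrow> 0) F"
    by (rule tendsto_mult_right_zero)
  moreover have "cmod c * norm (f x - l) = norm (c *\<^sub>C f x - c *\<^sub>C l)" for x
    by (simp add: norm_scaleC[symmetric] complex_vector.scale_right_diff_distrib)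
  ultimately show ?thesis
    by (simp only: tendsto_norm_zero_iff LIM_zero_iff)
qed

lemma continuous_on_scaleC [continuous_intros]:
  "continuous_on S f \<Longrightarrow> continuous_on S (\<lambda>x. c *\<^sub>C (f x :: 'v::hermitian_space))"
  unfolding continuous_on_def by (intro ballI tendsto_scaleC) auto

text \<open>The real and the imaginary part are each bounded by the real Cauchy-Schwarz inequality,
  whence the factor 2.\<close>

lemma cmod_cinner_le: "cmod (cinner u x) \<le> 2 * norm u * norm (x::'v::hermitian_space)"
proof -
  have "cmod (cinner u x) \<le> \<bar>Re (cinner u x)\<bar> + \<bar>Im (cinner u x)\<bar>"
    by (rule cmod_le)
  also have "\<dots> \<le> norm u * norm x + norm (\<i> *\<^sub>C u) * norm x"
    unfolding cinner_eq_inner complex.sel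
    by (intro add_mono Cauchy_Schwarz_ineq2)
  finally show ?thesis
    by (simp add: norm_scaleC)
qed


section \<open>Exterior powers\<close>

lemma sum_fun_apply: "sum f I x = (\<Sum>i\<in>I. f i x)" for f :: "'i \<Rightarrow> 'a \<Rightarrow> 'b::comm_monoid_add"
  by (induction I rule: infinite_finite_induct) simp_all

text \<open>A determinant equals that of its transpose: reindexing by \<open>inv p\<close>, which
  has the same sign, moves the permutation from \<open>v\<close> to \<open>u\<close>. In this form
  each factor contains one fixed \<open>v i\<close>, so multilinearity in \<open>v\<close> is
  visible factor by factor.\<close>

lemma wedge_transposed:
  "wedge k v u = (\<Sum>p | p permutes {..<k}. of_int (sign p) * (\<Prod>i<k. cinner (u (p i)) (v i)))"
proof -
  have "of_int (sign p) * (\<Prod>i<k. cinner (u i) (v (p i)))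
      = of_int (sign (inv p)) * (\<Prod>i<k. cinner (u (inv p i)) (v i))" if "p permutes {..<k}" for p
  proof -
    have "(\<Prod>i<k. cinner (u i) (v (p i))) = (\<Prod>i<k. cinner (u (inv p i)) (v i))"
      using that by (intro prod.reindex_bij_witness[of _ "inv p" p])
        (use permutes_inv[OF that] in \<open>auto simp: permutes_inverses permutes_in_image
          simp del: lessThan_iff\<close>)
    moreover have "sign (inv p) = sign p"
      using that by (metis finite_lessThan permutation_permutes sign_inverse)
    ultimately show ?thesis
      by simp
  qed
  then show ?thesis
    unfolding wedge_def
    by (subst sum_permutations_inverse) (auto intro!: sum.cong simp: permutes_inv_inv)
qed

lemma wedge_cong: "(\<And>i. i < k \<Longrightarrow> v i = w i) \<Longrightarrow> wedge k v = wedge k w"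
  unfolding wedge_transposed[abs_def] fun_eq_iff by (intro allI sum.cong refl) auto

lemma wedge_permute:
  assumes q: "q permutes {..<k}"
  shows "wedge k (v \<circ> q) u = of_int (sign q) * wedge k v u"
proof -
  have "wedge k v u = (\<Sum>p | p permutes {..<k}.
      of_int (sign (q \<circ> p)) * (\<Prod>i<k. cinner (u i) (v (q (p i)))))"
    unfolding wedge_def by (subst setum_permutations_compose_left[OF q]) (simp add: o_def)
  also have "\<dots> = (\<Sum>p | p permutes {..<k}.
      of_int (sign q) * (of_int (sign p) * (\<Prod>i<k. cinner (u i) (v (q (p i))))))"
  proof (intro sum.cong refl)
    fix p assume "p \<in> {p. p permutes {..<k}}"
    then have "sign (q \<circ> p) = sign q * sign p"
      using q by (intro sign_compose) (auto simp: permutation_permutes)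
    then show "of_int (sign (q \<circ> p)) * (\<Prod>i<k. cinner (u i) (v (q (p i))))
        = of_int (sign q) * (of_int (sign p) * (\<Prod>i<k. cinner (u i) (v (q (p i)))))"
      by simp
  qed
  also have "\<dots> = of_int (sign q) * wedge k (v \<circ> q) u"
    unfolding wedge_def sum_distrib_left by simp
  finally have "of_int (sign q) * wedge k v u
      = (of_int (sign q * sign q)) * wedge k (v \<circ> q) u"
    by (simp only: of_int_mult mult.assoc)
  then show ?thesis by (simp only: sign_idempotent of_int_1 mult_1)
qed

lemma wedge_repeat:
  assumes "i < k" "j < k" "i \<noteq> j" "v i = v j"
  shows "wedge k v = 0"
proof
  fix u :: "nat \<Rightarrow> 'a"
  have "v \<circ> Transposition.transpose i j = v"
    using assms(4) by (auto simp: fun_eq_iff Transposition.transpose_def)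
  moreover have "Transposition.transpose i j permutes {..<k}"
    using assms by (intro permutes_swap_id) auto
  ultimately have "wedge k v u = - wedge k v u"
    using wedge_permute[of "Transposition.transpose i j" k v u] assms(3) by (simp add: sign_swap_id)
  then show "wedge k v u = 0 u" by simp
qed

text \<open>Multilinearity in all entries at once. The sum runs over all maps \<open>L\<close>,
  repetitions included, so the coefficients stay plain products and no index tuple has to be
  sorted.\<close>

lemma wedge_expand:
  fixes n :: nat
  assumes "\<And>i. i < k \<Longrightarrow> v i = (\<Sum>l<n. a i l *\<^sub>C x l)"
  shows "wedge k v u
    = (\<Sum>L\<in>PiE {..<k} (\<lambda>_. {..<n}). (\<Prod>i<k. a i (L i)) * wedge k (x \<circ> L) u)"
proof -
  have "wedge k v u = (\<Sum>p | p permutes {..<k}. of_int (sign p) *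
      (\<Prod>i<k. \<Sum>l<n. a i l * cinner (u (p i)) (x l)))"
    unfolding wedge_transposed using assms
    by (intro sum.cong refl arg_cong2[where f = "(*)"] prod.cong)
       (simp_all add: cinner_sum_right cinner_scaleC_right)
  also have "\<dots> = (\<Sum>p | p permutes {..<k}. \<Sum>L\<in>PiE {..<k} (\<lambda>_. {..<n}).
      (\<Prod>i<k. a i (L i)) * (of_int (sign p) * (\<Prod>i<k. cinner (u (p i)) (x (L i)))))"
    by (subst prod_sum_PiE) (auto simp: sum_distrib_left prod.distrib mult_ac)
  also have "\<dots> = (\<Sum>L\<in>PiE {..<k} (\<lambda>_. {..<n}). (\<Prod>i<k. a i (L i)) * wedge k (x \<circ> L) u)"
    unfolding wedge_transposed sum_distrib_left by (subst sum.swap) simp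
  finally show ?thesis .
qed

lemma wedge_scale:
  assumes "\<And>i. i < k \<Longrightarrow> v i = c i *\<^sub>C w i"
  shows "wedge k v = (\<Prod>i<k. c i) *\<^sub>C wedge k w"
proof
  fix u :: "nat \<Rightarrow> 'a"
  have "(\<Prod>i<k. cinner (u (p i)) (v i)) = (\<Prod>i<k. c i) * (\<Prod>i<k. cinner (u (p i)) (w i))" for p
    using assms by (simp add: cinner_scaleC_right prod.distrib)
  then show "wedge k v u = ((\<Prod>i<k. c i) *\<^sub>C wedge k w) u"
    unfolding wedge_transposed scaleC_fun_def scaleC_complex_def sum_distrib_left
    by (simp add: mult.left_commute)
qed

lemma wedge_upd_linear:
  assumes "j < k"
  shows "wedge k (v(j := x + y)) = wedge k (v(j := x)) + wedge k (v(j := y))"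
    and "wedge k (v(j := c *\<^sub>C x)) = c *\<^sub>C wedge k (v(j := x))"
proof -
  have split: "(\<Prod>i<k. cinner (u (p i)) ((v(j := z)) i))
      = cinner (u (p j)) z * (\<Prod>i\<in>{..<k} - {j}. cinner (u (p i)) (v i))"
    for u :: "nat \<Rightarrow> 'a" and p z
    using assms by (subst prod.remove[of _ j]) auto
  show "wedge k (v(j := x + y)) = wedge k (v(j := x)) + wedge k (v(j := y))"
  proof
    fix u :: "nat \<Rightarrow> 'a"
    show "wedge k (v(j := x + y)) u = (wedge k (v(j := x)) + wedge k (v(j := y))) u"
      unfolding wedge_transposed plus_fun_def
      by (simp only: split cinner_add_right ring_distribs sum.distrib)
  qed
  show "wedge k (v(j := c *\<^sub>C x)) = c *\<^sub>C wedge k (v(j := x))"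
    using assms wedge_scale[of k "v(j := c *\<^sub>C x)" "\<lambda>i. if i = j then c else 1" "v(j := x)"]
    by (simp add: prod.delta scaleC_one)
qed

text \<open>By linearity in the entry \<open>j\<close> it suffices to insert one of the other
  entries there, and then an entry is repeated.\<close>

lemma wedge_upd_add_span:
  assumes "j < k" and "w \<in> cspan (v ` ({..<k} - {j}))"
  shows "wedge k (v(j := v j + w)) = wedge k v"
proof -
  have "wedge k (v(j := w)) = 0"
    using assms(2)
  proof (induction rule: complex_vector.span_induct_alt)
    case base
    show ?case
      using wedge_upd_linear(2)[OF assms(1), of v 0 0] by (simp only: complex_vector.scale_zero_left)
  next
    case (step c x y)
    then obtain i where "i < k" "i \<noteq> j" "x = v i" by auto
    then have "wedge k (v(j := x)) = 0"
      using assms(1) by (intro wedge_repeat[of i k j]) auto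
    with step show ?case
      by (simp only: wedge_upd_linear[OF assms(1)]) simp
  qed
  then show ?thesis
    by (simp add: wedge_upd_linear(1)[OF assms(1)])
qed

text \<open>Processing the changed entries in order of decreasing \<open>r\<close>, each step adds to one entry a
  combination of entries that are still unchanged.\<close>

lemma wedge_triangular:
  fixes r :: "nat \<Rightarrow> nat"
  assumes "\<And>a. a < k \<Longrightarrow> v' a - v a \<in> cspan (v ` {b. b < k \<and> r b < r a})"
  shows "wedge k v' = wedge k v"
  using assms
proof (induction "card {a. a < k \<and> v' a \<noteq> v a}" arbitrary: v)
  case 0
  then have "{a. a < k \<and> v' a \<noteq> v a} = {}" by simp
  then show ?case by (intro wedge_cong) auto
next
  case (Suc N)
  define D where "D = {a. a < k \<and> v' a \<noteq> v a}"
  have "card D = Suc N" using Suc(2) by (simp add: D_def)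
  then have "finite D" "D \<noteq> {}"
    using card_ge_0_finite[of D] by auto
  then obtain a where a: "a \<in> D" and amax: "\<And>b. b \<in> D \<Longrightarrow> r b \<le> r a"
    using finite_has_maximal[of "r ` D"] by (smt (verit) finite_imageI image_iff image_is_empty
        linorder_le_cases)
  define v'' where "v'' = v(a := v' a)"
  have ak: "a < k" using a by (simp add: D_def)
  have "cspan (v ` {b. b < k \<and> r b < r a}) \<subseteq> cspan (v ` ({..<k} - {a}))"
    by (intro complex_vector.span_mono) auto
  with Suc(3)[OF ak] have "v' a - v a \<in> cspan (v ` ({..<k} - {a}))" by blast
  from wedge_upd_add_span[OF ak this] have "wedge k v'' = wedge k v"
    by (simp add: v''_def)
  moreover have "wedge k v' = wedge k v''"
  proof (rule Suc(1))
    have "{b. b < k \<and> v' b \<noteq> v'' b} = D - {a}"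
      by (auto simp: D_def v''_def)
    then show "N = card {b. b < k \<and> v' b \<noteq> v'' b}"
      using a Suc(2) by (simp add: D_def[symmetric] \<open>finite D\<close>)
  next
    fix b assume b: "b < k"
    show "v' b - v'' b \<in> cspan (v'' ` {c. c < k \<and> r c < r b})"
    proof (cases "b \<in> D - {a}")
      case True
      then have "v'' ` {c. c < k \<and> r c < r b} = v ` {c. c < k \<and> r c < r b}"
        using amax[of b] by (intro image_cong) (auto simp: v''_def)
      moreover have "v'' b = v b" using True by (auto simp: v''_def)
      ultimately show ?thesis using Suc(3)[OF b] by simp
    next
      case False
      then have "v' b - v'' b = 0"
        using b by (auto simp: D_def v''_def)
      then show ?thesis by (simp add: complex_vector.span_zero)
    qed
  qed
  ultimately show ?case by simp
qed

lemma wedge_in_ext_power [simp]: "wedge k v \<in> ext_power k"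
  unfolding ext_power_def by (intro complex_vector.span_base) simp

lemma csubspace_ext_power: "csubspace (ext_power k)"
  unfolding ext_power_def by (rule complex_vector.subspace_span)

lemma permuted_PiE:
  assumes "L \<in> PiE {..<k} (\<lambda>_. N)" "p permutes {..<k}"
  shows "L \<circ> p \<in> PiE {..<k} (\<lambda>_. N)"
proof
  fix i assume "i \<in> {..<k}"
  then have "p i \<in> {..<k}" using assms(2) by (simp add: permutes_in_image del: lessThan_iff)
  then show "(L \<circ> p) i \<in> N" using assms(1) by (auto simp: PiE_def)
next
  fix i assume "i \<notin> {..<k}"
  moreover from this have "p i = i" using assms(2) by (simp add: permutes_not_in)
  ultimately show "(L \<circ> p) i = undefined"
    using assms(1) PiE_arb[of L "{..<k}" "\<lambda>_. N" i] by auto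
qed

text \<open>Expanding the determinant gives one sum over \<open>L\<close> for each permutation
  \<open>p\<close>. Replacing \<open>L\<close> by \<open>L \<circ> inv p\<close> moves
  \<open>p\<close> into \<open>W\<close>, whose sign cancels the sign of \<open>p\<close>; so all
  \<open>k!\<close> sums coincide.\<close>

lemma sum_wedge_antisym:
  fixes W :: "(nat \<Rightarrow> nat) \<Rightarrow> complex"
  assumes "\<And>L p. L \<in> PiE {..<k} (\<lambda>_. {..<n}) \<Longrightarrow> p permutes {..<k}
    \<Longrightarrow> W (L \<circ> p) = of_int (sign p) * W L"
  shows "(\<Sum>L\<in>PiE {..<k} (\<lambda>_. {..<n}). wedge k v (e \<circ> L) * W L)
    = fact k * (\<Sum>L\<in>PiE {..<k} (\<lambda>_. {..<n}). (\<Prod>i<k. cinner (e (L i)) (v i)) * W L)"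
proof -
  let ?P = "PiE {..<k} (\<lambda>_. {..<n})"
  have "(\<Sum>L\<in>?P. of_int (sign p) * (\<Prod>i<k. cinner (e (L (p i))) (v i)) * W L)
      = (\<Sum>L\<in>?P. (\<Prod>i<k. cinner (e (L i)) (v i)) * W L)" if p: "p permutes {..<k}" for p
  proof (rule sum.reindex_bij_witness[of _ "\<lambda>L. L \<circ> inv p" "\<lambda>L. L \<circ> p"])
    fix L assume L: "L \<in> ?P"
    show "L \<circ> p \<circ> inv p = L" "L \<circ> inv p \<circ> p = L"
      by (simp_all only: o_assoc[symmetric] permutes_inv_o[OF p] o_id)
    show "L \<circ> p \<in> ?P" "L \<circ> inv p \<in> ?P"
      using permuted_PiE[OF L] p permutes_inv by auto
    show "(\<Prod>i<k. cinner (e ((L \<circ> p) i)) (v i)) * W (L \<circ> p)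
      = of_int (sign p) * (\<Prod>i<k. cinner (e (L (p i))) (v i)) * W L"
      unfolding assms[OF L p] o_apply by (simp only: mult_ac)
  qed
  note perm = this
  have "(\<Sum>L\<in>?P. wedge k v (e \<circ> L) * W L) = (\<Sum>L\<in>?P. \<Sum>p | p permutes {..<k}.
      of_int (sign p) * (\<Prod>i<k. cinner (e (L (p i))) (v i)) * W L)"
    by (simp add: wedge_transposed sum_distrib_right)
  also have "\<dots> = (\<Sum>p | p permutes {..<k}. \<Sum>L\<in>?P.
      of_int (sign p) * (\<Prod>i<k. cinner (e (L (p i))) (v i)) * W L)"
    by (rule sum.swap)
  also have "\<dots> = (\<Sum>p | p permutes {..<k}. \<Sum>L\<in>?P. (\<Prod>i<k. cinner (e (L i)) (v i)) * W L)"
    by (rule sum.cong[OF refl]) (use perm in simp)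
  also have "\<dots> = fact k * (\<Sum>L\<in>?P. (\<Prod>i<k. cinner (e (L i)) (v i)) * W L)"
    by (simp add: card_permutations)
  finally show ?thesis .
qed

text \<open>The value of \<open>w \<in> \<Lambda>\<^sup>k V\<close> at \<open>e \<circ> L\<close> is its coordinate along \<open>wedge k (e \<circ> L)\<close>. The factor
  \<open>1 / k!\<close> compensates for the sum running over all multi-indices and not only the increasing ones.\<close>

definition oper :: "nat \<Rightarrow> (nat \<Rightarrow> 'v) \<Rightarrow> nat \<Rightarrow> ((nat \<Rightarrow> nat) \<Rightarrow> (nat \<Rightarrow> 'v) \<Rightarrow> complex)
    \<Rightarrow> 'v::hermitian_space ext_end"
  where "oper k e n W = (\<lambda>w. if w \<in> ext_power k then
    (1 / fact k) *\<^sub>C (\<Sum>L\<in>PiE {..<k} (\<lambda>_. {..<n}). w (e \<circ> L) *\<^sub>C W L) else 0)"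

lemma oper_apply:
  "w \<in> ext_power k \<Longrightarrow> oper k e n W w u
    = (1 / fact k) * (\<Sum>L\<in>PiE {..<k} (\<lambda>_. {..<n}). w (e \<circ> L) * W L u)"
  by (simp add: oper_def scaleC_fun_def sum_fun_apply scaleC_complex_def)

lemma oper_in_End_ext:
  assumes "\<And>L. L \<in> PiE {..<k} (\<lambda>_. {..<n}) \<Longrightarrow> W L \<in> ext_power k"
  shows "oper k e n W \<in> End_ext k"
proof -
  note sub = csubspace_ext_power[of k]
  show ?thesis
    unfolding End_ext_def hom_space_def mem_Collect_eq
  proof (intro conjI ballI allI impI)
    fix w :: "(nat \<Rightarrow> 'a) \<Rightarrow> complex" assume "w \<in> ext_power k"
    then show "oper k e n W w \<in> ext_power k"
      unfolding oper_def using assms sub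
      by (auto intro!: complex_vector.subspace_scale complex_vector.subspace_sum)
  next
    fix w w' :: "(nat \<Rightarrow> 'a) \<Rightarrow> complex" assume w: "w \<in> ext_power k" "w' \<in> ext_power k"
    then have "w + w' \<in> ext_power k"
      using sub complex_vector.subspace_add by blast
    with w show "oper k e n W (w + w') = oper k e n W w + oper k e n W w'"
      by (intro ext) (simp add: oper_apply ring_distribs sum.distrib)
  next
    fix c and w :: "(nat \<Rightarrow> 'a) \<Rightarrow> complex" assume w: "w \<in> ext_power k"
    then have "c *\<^sub>C w \<in> ext_power k"
      using sub complex_vector.subspace_scale by blast
    with w show "oper k e n W (c *\<^sub>C w) = c *\<^sub>C oper k e n W w"
      by (intro ext) (simp add: oper_apply scaleC_fun_def scaleC_complex_def sum_distrib_left mult_ac)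
  qed (simp add: oper_def)
qed

text \<open>For an alternating family \<open>W\<close> the \<open>k!\<close> from
  \<open>sum_wedge_antisym\<close> cancels the normalising factor of \<open>oper\<close>. What
  remains has the shape of the expansion of a wedge in a basis, as in
  \<open>wedge_expand\<close>.\<close>

lemma oper_wedge:
  assumes "\<And>L p u. L \<in> PiE {..<k} (\<lambda>_. {..<n}) \<Longrightarrow> p permutes {..<k}
    \<Longrightarrow> W (L \<circ> p) u = of_int (sign p) * W L u"
  shows "oper k e n W (wedge k v) u
    = (\<Sum>L\<in>PiE {..<k} (\<lambda>_. {..<n}). (\<Prod>i<k. cinner (e (L i)) (v i)) * W L u)"
proof -
  have "(\<Sum>L\<in>PiE {..<k} (\<lambda>_. {..<n}). wedge k v (e \<circ> L) * W L u)
    = fact k * (\<Sum>L\<in>PiE {..<k} (\<lambda>_. {..<n}). (\<Prod>i<k. cinner (e (L i)) (v i)) * W L u)"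
    by (rule sum_wedge_antisym) (rule assms)
  then show ?thesis
    unfolding oper_apply[OF wedge_in_ext_power] by simp
qed

lemma End_ext_eqI:
  assumes "T \<in> End_ext k" and "T' \<in> End_ext k"
    and "ext_power k \<subseteq> cspan S" "S \<subseteq> ext_power k" and "\<And>w. w \<in> S \<Longrightarrow> T w = T' w"
  shows "T = T'"
  using hom_space_eqI[OF assms(1,2)[unfolded End_ext_def] csubspace_ext_power assms(3-5)] by simp

section \<open>Orthonormal bases adapted to a flag\<close>

text \<open>Independence of an indexed family: a repeated vector counts as a dependence, which
  independence of the set of values would not detect.\<close>

definition lin_indep :: "nat \<Rightarrow> (nat \<Rightarrow> 'w::complex_vector) \<Rightarrow> bool"
  where "lin_indep n h \<longleftrightarrow> (\<forall>c. (\<Sum>l<n. c l *\<^sub>C h l) = 0 \<longrightarrow> (\<forall>l<n. c l = 0))"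

lemma lin_indepD: "lin_indep n h \<Longrightarrow> (\<Sum>l<n. c l *\<^sub>C h l) = 0 \<Longrightarrow> l < n \<Longrightarrow> c l = 0"
  unfolding lin_indep_def by blast

lemma lin_indep_inj:
  assumes "lin_indep n h"
  shows "inj_on h {..<n}"
proof (rule inj_onI, rule ccontr)
  fix i j assume ij: "i \<in> {..<n}" "j \<in> {..<n}" "h i = h j" "i \<noteq> j"
  define c :: "nat \<Rightarrow> complex" where "c l = (if l = i then 1 else 0) - (if l = j then 1 else 0)" for l
  have "(\<Sum>l<n. c l *\<^sub>C h l) = (\<Sum>l<n. if l = i then h i else 0) - (\<Sum>l<n. if l = j then h j else 0)"
    unfolding sum_subtractf[symmetric] c_def
    by (intro sum.cong) (auto simp: scaleC_one complex_vector.scale_left_diff_distrib)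
  also have "\<dots> = 0" using ij by simp
  finally have "c i = 0" using lin_indepD[OF assms] ij by blast
  then show False using ij by (simp add: c_def)
qed

lemma lin_indep_independent:
  assumes "lin_indep n h"
  shows "\<not> complex_vector.dependent (h ` {..<n})"
proof (rule complex_vector.independent_if_scalars_zero)
  fix f x assume *: "(\<Sum>x\<in>h ` {..<n}. f x *\<^sub>C x) = 0" "x \<in> h ` {..<n}"
  then have "(\<Sum>l<n. f (h l) *\<^sub>C h l) = 0"
    by (simp add: sum.reindex[OF lin_indep_inj[OF assms]])
  then have "f (h l) = 0" if "l < n" for l
    using lin_indepD[OF assms, of "\<lambda>l. f (h l)"] that by simp
  then show "f x = 0" using * by auto
qed simp

lemma cdim_span_lin_indep:
  assumes "lin_indep n h"
  shows "cdim (cspan (h ` {..<n})) = n"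
  using complex_vector.dim_span_eq_card_independent[OF lin_indep_independent[OF assms]]
    card_image[OF lin_indep_inj[OF assms]] by simp

definition orthonormal :: "'v::hermitian_space set \<Rightarrow> bool"
  where "orthonormal F \<longleftrightarrow> finite F \<and> (\<forall>x\<in>F. \<forall>y\<in>F. cinner x y = (if x = y then 1 else 0))"

lemma orthonormal_coord:
  assumes "orthonormal F" "x \<in> F"
  shows "cinner x (\<Sum>y\<in>F. c y *\<^sub>C y) = c x"
proof -
  have "cinner x (\<Sum>y\<in>F. c y *\<^sub>C y) = (\<Sum>y\<in>F. if x = y then c y else 0)"
    using assms unfolding cinner_sum_right cinner_scaleC_right
    by (intro sum.cong) (auto simp: orthonormal_def)
  then show ?thesis using assms by (simp add: orthonormal_def)
qed

lemma orthonormal_span: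
  assumes "orthonormal F"
  shows "x \<in> cspan F \<longleftrightarrow> x = (\<Sum>y\<in>F. cinner y x *\<^sub>C y)"
proof
  assume "x \<in> cspan F"
  then obtain c where x: "x = (\<Sum>y\<in>F. c y *\<^sub>C y)"
    using complex_vector.span_finite[of F] assms by (auto simp: orthonormal_def)
  show "x = (\<Sum>y\<in>F. cinner y x *\<^sub>C y)"
    using orthonormal_coord[OF assms, of _ c] by (simp add: x)
next
  assume "x = (\<Sum>y\<in>F. cinner y x *\<^sub>C y)"
  moreover have "(\<Sum>y\<in>F. cinner y x *\<^sub>C y) \<in> cspan F"
    by (intro complex_vector.span_sum complex_vector.span_scale complex_vector.span_base)
  ultimately show "x \<in> cspan F" by simp
qed

lemma orthonormal_independent:
  assumes "orthonormal F"
  shows "\<not> complex_vector.dependent F"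
proof (rule complex_vector.independent_if_scalars_zero)
  show "finite F" using assms by (simp add: orthonormal_def)
  fix f x assume "(\<Sum>x\<in>F. f x *\<^sub>C x) = 0" "x \<in> F"
  then show "f x = 0"
    using orthonormal_coord[OF assms, of x f] by simp
qed

text \<open>One Gram-Schmidt step: remove from \<open>x\<close> its projection to the span of
  \<open>F\<close> and normalise the rest.\<close>

lemma orthonormal_insert:
  assumes F: "orthonormal F" "cspan F \<subseteq> U" and U: "csubspace U" and x: "x \<in> U" "x \<notin> cspan F"
  obtains z where "z \<in> U" "z \<notin> F" "orthonormal (insert z F)"
proof -
  define y where "y = x - (\<Sum>f\<in>F. cinner f x *\<^sub>C f)"
  have fin: "finite F" using F by (simp add: orthonormal_def)
  have "(\<Sum>f\<in>F. cinner f x *\<^sub>C f) \<in> cspan F"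
    by (intro complex_vector.span_sum complex_vector.span_scale complex_vector.span_base)
  then have y: "y \<in> U" "y \<noteq> 0"
    using x F U by (auto simp: y_def intro!: complex_vector.subspace_diff)
  have orth: "cinner f y = 0" if "f \<in> F" for f
    using orthonormal_coord[OF F(1) that, of "\<lambda>f. cinner f x"] by (simp add: y_def cinner_diff_right)
  define z where "z = complex_of_real (1 / norm y) *\<^sub>C y"
  have z: "cinner f z = 0" "cinner z f = 0" if "f \<in> F" for f
    using orth[OF that] cinner_commute[of y f] by (simp_all add: z_def cinner_scaleC_right cinner_scaleC_left)
  have zz: "cinner z z = 1"
    using y(2) by (simp add: cinner_self z_def norm_scaleC norm_divide)
  show thesis
  proof
    show "z \<in> U" unfolding z_def using y U by (intro complex_vector.subspace_scale)
    show "z \<notin> F" using z zz by force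
    show "orthonormal (insert z F)"
      using F(1) z zz by (auto simp: orthonormal_def)
  qed
qed

text \<open>Among the orthonormal sets between \<open>F\<close> and \<open>U\<close>, whose sizes
  are bounded by that of the finite spanning set \<open>B\<close>, one of greatest size must span
  \<open>U\<close>, since otherwise a Gram-Schmidt step would enlarge it.\<close>

lemma orthonormal_extend:
  fixes B F U :: "'v::hermitian_space set"
  assumes F: "orthonormal F" "cspan F \<subseteq> U" and U: "csubspace U" and B: "finite B" "cspan B = UNIV"
  obtains G :: "'v set" where "orthonormal G" "F \<subseteq> G" "cspan G = U"
proof -
  define P where "P G \<longleftrightarrow> orthonormal G \<and> F \<subseteq> G \<and> cspan G \<subseteq> U" for G :: "'v set"
  have "card G \<le> card B" if "P G" for G
    using complex_vector.independent_span_bound[OF B(1) orthonormal_independent, of G] that B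
    by (simp add: P_def)
  moreover have "P F" using F by (simp add: P_def)
  ultimately have "\<exists>G. P G \<and> (\<forall>G'. P G' \<longrightarrow> card G' \<le> card G)"
    by (intro ex_has_greatest_nat[where b = "Suc (card B)"]) (auto simp: less_Suc_eq_le)
  then obtain G where G: "P G" and max: "\<And>G'. P G' \<Longrightarrow> card G' \<le> card G"
    by blast
  have "U \<subseteq> cspan G"
  proof (rule ccontr)
    assume "\<not> U \<subseteq> cspan G"
    then obtain x where "x \<in> U" "x \<notin> cspan G" by blast
    with G U obtain z where z: "z \<in> U" "z \<notin> G" "orthonormal (insert z G)"
      using orthonormal_insert[of G U x] by (auto simp: P_def)
    have "cspan (insert z G) \<subseteq> U"
      using z G U complex_vector.span_superset[of G] unfolding P_def
      by (intro complex_vector.span_minimal) auto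
    with z G have "P (insert z G)" by (auto simp: P_def)
    then have "card (insert z G) \<le> card G" by (rule max)
    moreover have "finite G" using G by (simp add: P_def orthonormal_def)
    ultimately show False using z by simp
  qed
  with G show thesis by (intro that[of G]) (auto simp: P_def)
qed

lemma csubspace_dom_seq:
  assumes "A \<in> M_set" "i \<le> length A"
  shows "csubspace (dom_seq A i)"
  using assms(2)
proof (induction i)
  case (Suc i)
  then have hom: "A ! i \<in> hom_space (dom_seq A i) UNIV" and sub: "csubspace (dom_seq A i)"
    using assms(1) by (auto simp: M_set_def)
  show ?case
    unfolding complex_vector.subspace_def
    using hom_space_zero[OF hom sub] sub hom_spaceD(2,3)[OF hom]
    by (simp add: complex_vector.subspace_def)
qed (simp add: complex_vector.subspace_UNIV)

lemma dom_seq_antimono: "i \<le> j \<Longrightarrow> dom_seq A j \<subseteq> dom_seq A i"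
  by (induction rule: dec_induct) auto

locale onb =
  fixes e :: "nat \<Rightarrow> 'v::hermitian_space" and n :: nat
  assumes orth: "i < n \<Longrightarrow> j < n \<Longrightarrow> cinner (e i) (e j) = (if i = j then 1 else 0)"
    and complete: "(\<Sum>l<n. cinner (e l) x *\<^sub>C e l) = x"

text \<open>The type \<open>t l\<close> of a basis vector records the summand \<open>V(A)'\<^bsub>t l\<^esub>\<close> that contains it.\<close>

locale adapted = onb e n for e :: "nat \<Rightarrow> 'v::hermitian_space" and n +
  fixes A :: "('v \<Rightarrow> 'v) list" and t :: "nat \<Rightarrow> nat"
  assumes t_mono: "i \<le> j \<Longrightarrow> j < n \<Longrightarrow> t i \<le> t j"
    and t_less: "l < n \<Longrightarrow> t l < length A"
    and hom: "i < length A \<Longrightarrow> A ! i \<in> hom_space (dom_seq A i) UNIV"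
    and dom: "i \<le> length A \<Longrightarrow> x \<in> dom_seq A i \<longleftrightarrow> (\<forall>l<n. t l < i \<longrightarrow> cinner (e l) x = 0)"

text \<open>Orthonormal bases of the kernels are extended step by step from the last kernel, which
  is zero, up to the whole space. The construction therefore counts from the end of the flag, and
  \<open>G i\<close> turns the numbering back, so that \<open>G i\<close> is a basis of
  \<open>V(A)_i\<close> and the sets decrease in \<open>i\<close>.\<close>

lemma ex_adapted:
  fixes A :: "('v::hermitian_space \<Rightarrow> 'v) list"
  assumes A: "A \<in> M_set" and B: "finite B" "cspan B = (UNIV :: 'v set)"
  obtains e n t where "adapted e n A t"
proof -
  let ?m = "length A"
  have sub: "csubspace (dom_seq A (?m - j))" for j
    using csubspace_dom_seq[OF A] by simp
  have "\<exists>f. \<forall>j. (orthonormal (f j) \<and> cspan (f j) = dom_seq A (?m - j)) \<and> f j \<subseteq> f (Suc j)"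
  proof (rule dependent_nat_choice)
    show "\<exists>F. orthonormal F \<and> cspan F = dom_seq A (?m - 0)"
      using A by (intro exI[of _ "{}"]) (auto simp: M_set_def orthonormal_def)
  next
    fix F j assume F: "orthonormal F \<and> cspan F = dom_seq A (?m - j)"
    have "dom_seq A (?m - j) \<subseteq> dom_seq A (?m - Suc j)"
      by (intro dom_seq_antimono) simp
    with F obtain G where "orthonormal G" "F \<subseteq> G" "cspan G = dom_seq A (?m - Suc j)"
      using orthonormal_extend[OF _ _ sub B, of F "Suc j"] by metis
    then show "\<exists>G. (orthonormal G \<and> cspan G = dom_seq A (?m - Suc j)) \<and> F \<subseteq> G" by blast
  qed
  then obtain f where f: "\<And>j. orthonormal (f j)" "\<And>j. cspan (f j) = dom_seq A (?m - j)"
      "\<And>j. f j \<subseteq> f (Suc j)" by blast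
  define G where "G i = f (?m - i)" for i
  have G: "orthonormal (G i)" for i by (simp add: G_def f)
  have span: "cspan (G i) = dom_seq A i" if "i \<le> ?m" for i using that by (simp add: G_def f)
  have mono: "i \<le> j \<Longrightarrow> G j \<subseteq> G i" for i j
    unfolding G_def using lift_Suc_mono_le[of f, OF f(3)] by (simp add: diff_le_mono2)
  \<comment> \<open>For \<open>x\<close> in \<open>G 0\<close> this is the last \<open>i\<close>
    with \<open>x\<close> in \<open>G i\<close>; it exists because the sets decrease and
    \<open>G ?m\<close> is empty.\<close>
  define t' where "t' x = (LEAST i. x \<notin> G (Suc i))" for x
  have m0: "0 < ?m" using A by (auto simp: M_set_def)
  have notin: "x \<notin> G ?m" for x
  proof
    assume "x \<in> G ?m"
    then have "x \<in> dom_seq A ?m" using span[of ?m] complex_vector.span_base by blast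
    then have "x = 0" using A by (simp add: M_set_def)
    with \<open>x \<in> G ?m\<close> G[of ?m] show False by (force simp: orthonormal_def)
  qed
  have t'_le: "t' x \<le> ?m - 1" for x
    unfolding t'_def using Least_le[of "\<lambda>i. x \<notin> G (Suc i)" "?m - 1"] notin m0 by simp
  have t'_notin: "x \<notin> G (Suc (t' x))" for x
    unfolding t'_def using LeastI[of "\<lambda>i. x \<notin> G (Suc i)" "?m - 1"] notin m0 by simp
  have G_iff: "x \<in> G i \<longleftrightarrow> i \<le> t' x" if "x \<in> G 0" for x i
  proof
    assume "x \<in> G i"
    show "i \<le> t' x"
    proof (rule ccontr)
      assume "\<not> i \<le> t' x"
      then have "G i \<subseteq> G (Suc (t' x))" by (intro mono) simp
      with \<open>x \<in> G i\<close> t'_notin show False by blast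
    qed
  next
    assume i: "i \<le> t' x"
    show "x \<in> G i"
    proof (cases i)
      case (Suc j)
      with i have "j < (LEAST i. x \<notin> G (Suc i))" by (simp add: t'_def)
      from not_less_Least[OF this] show ?thesis using Suc by simp
    qed (use that in simp)
  qed
  have fin: "finite (G 0)" using G by (simp add: orthonormal_def)
  then obtain ys where ys: "set ys = G 0" "distinct ys"
    using finite_distinct_list by blast
  \<comment> \<open>Sorting by type makes \<open>t\<close> nondecreasing along the basis, so that
    the first \<open>k\<close> basis vectors have the top degree.\<close>
  define xs where "xs = sort_key t' ys"
  define n where "n = length xs"
  define e where "e l = xs ! l" for l
  have dist: "distinct xs" and set: "set xs = G 0" and sorted: "sorted (map t' xs)"
    using ys by (simp_all add: xs_def)
  have eG: "e l \<in> G 0" if "l < n" for l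
    using that by (simp add: e_def n_def flip: set)
  have bij: "bij_betw e {..<n} (G 0)"
    using bij_betw_nth[OF dist refl, of "G 0"] set by (simp add: e_def[abs_def] n_def bij_betw_def)
  have expand: "(\<Sum>l<n. g (e l)) = (\<Sum>x\<in>G 0. g x)" for g :: "'v \<Rightarrow> 'v"
    using sum.reindex_bij_betw[OF bij] .
  have "adapted e n A (\<lambda>l. t' (e l))"
  proof
    fix i j assume "i < n" "j < n"
    then show "cinner (e i) (e j) = (if i = j then 1 else 0)"
      using G[of 0] eG[of i] eG[of j] bij by (auto simp: orthonormal_def bij_betw_def inj_on_def)
  next
    fix x
    show "(\<Sum>l<n. cinner (e l) x *\<^sub>C e l) = x"
      unfolding expand[of "\<lambda>y. cinner y x *\<^sub>C y"]
      using orthonormal_span[OF G, of x 0] span[of 0] by simp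
  next
    fix i j assume "i \<le> j" "j < n"
    then show "t' (e i) \<le> t' (e j)"
      using sorted by (auto simp: sorted_iff_nth_mono n_def e_def)
  next
    fix l show "t' (e l) < ?m" using t'_le[of "e l"] m0 by linarith
  next
    fix i assume "i < ?m"
    then show "A ! i \<in> hom_space (dom_seq A i) UNIV" using A by (simp add: M_set_def)
  next
    fix i x assume i: "i \<le> ?m"
    have G0: "x = (\<Sum>y\<in>G 0. cinner y x *\<^sub>C y)"
      using orthonormal_span[OF G, of x 0] span[of 0] by simp
    have "x \<in> dom_seq A i \<longleftrightarrow> (\<forall>y\<in>G 0. y \<notin> G i \<longrightarrow> cinner y x = 0)"
    proof
      assume "x \<in> dom_seq A i"
      then have x: "x = (\<Sum>y\<in>G i. cinner y x *\<^sub>C y)"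
        using orthonormal_span[OF G, of x i] span[OF i] by simp
      show "\<forall>y\<in>G 0. y \<notin> G i \<longrightarrow> cinner y x = 0"
      proof (intro ballI impI)
        fix y assume y: "y \<in> G 0" "y \<notin> G i"
        have "cinner y x = (\<Sum>z\<in>G i. cinner z x * cinner y z)"
          by (subst x) (simp add: cinner_sum_right cinner_scaleC_right)
        also have "\<dots> = 0"
        proof (rule sum.neutral, rule ballI)
          fix z assume "z \<in> G i"
          then have "z \<in> G 0" "z \<noteq> y" using y mono[of 0 i] by auto
          then show "cinner z x * cinner y z = 0" using y G[of 0] by (simp add: orthonormal_def)
        qed
        finally show "cinner y x = 0" .
      qed
    next
      assume *: "\<forall>y\<in>G 0. y \<notin> G i \<longrightarrow> cinner y x = 0"
      have "(\<Sum>y\<in>G 0. cinner y x *\<^sub>C y) = (\<Sum>y\<in>G i. cinner y x *\<^sub>C y)"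
        using * mono[of 0 i] fin by (intro sum.mono_neutral_right) auto
      with G0 have "x = (\<Sum>y\<in>G i. cinner y x *\<^sub>C y)" by simp
      then have "x \<in> cspan (G i)" using orthonormal_span[OF G] by blast
      then show "x \<in> dom_seq A i" using span[OF i] by simp
    qed
    also have "\<dots> \<longleftrightarrow> (\<forall>y\<in>G 0. t' y < i \<longrightarrow> cinner y x = 0)"
      using G_iff by (metis not_le)
    also have "\<dots> \<longleftrightarrow> (\<forall>l<n. t' (e l) < i \<longrightarrow> cinner (e l) x = 0)"
      unfolding bij_betw_imp_surj_on[OF bij, symmetric] by auto
    finally show "x \<in> dom_seq A i \<longleftrightarrow> (\<forall>l<n. t' (e l) < i \<longrightarrow> cinner (e l) x = 0)" .
  qed
  then show thesis by (rule that)
qed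

context onb
begin

lemma coord_sum: "l < n \<Longrightarrow> cinner (e l) (\<Sum>j<n. c j *\<^sub>C e j) = c l"
proof -
  assume l: "l < n"
  have "cinner (e l) (\<Sum>j<n. c j *\<^sub>C e j) = (\<Sum>j<n. if l = j then c j else 0)"
    unfolding cinner_sum_right cinner_scaleC_right using l by (intro sum.cong) (auto simp: orth)
  then show ?thesis using l by simp
qed

lemma coord_eqI: "(\<And>l. l < n \<Longrightarrow> cinner (e l) x = cinner (e l) y) \<Longrightarrow> x = y"
proof -
  assume "\<And>l. l < n \<Longrightarrow> cinner (e l) x = cinner (e l) y"
  then have "(\<Sum>l<n. cinner (e l) x *\<^sub>C e l) = (\<Sum>l<n. cinner (e l) y *\<^sub>C e l)"
    by (intro sum.cong) auto
  then show ?thesis by (simp only: complete)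
qed

lemma inj_on_e: "inj_on e {..<n}"
proof (rule inj_onI)
  fix i j assume "i \<in> {..<n}" "j \<in> {..<n}" "e i = e j"
  then show "i = j" using orth[of i i] orth[of i j] by (auto split: if_splits)
qed

lemma parseval: "cinner x y = (\<Sum>l<n. cinner x (e l) * cinner (e l) y)"
proof -
  have "cinner x y = cinner x (\<Sum>l<n. cinner (e l) y *\<^sub>C e l)" by (simp only: complete)
  then show ?thesis by (simp add: cinner_sum_right cinner_scaleC_right mult.commute)
qed

lemma hom_coords:
  "g \<in> hom_space UNIV UNIV \<Longrightarrow> g x = (\<Sum>l<n. cinner (e l) x *\<^sub>C g (e l))"
  using hom_space_sum[of g UNIV UNIV "{..<n}" e "\<lambda>l. cinner (e l) x"]
  by (simp add: complete complex_vector.subspace_UNIV)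

lemma wedge_coords:
  "wedge k v u = (\<Sum>L\<in>PiE {..<k} (\<lambda>_. {..<n}). (\<Prod>i<k. cinner (e (L i)) (v i)) * wedge k (e \<circ> L) u)"
  by (rule wedge_expand[where a = "\<lambda>i l. cinner (e l) (v i)" and x = e]) (simp only: complete)

lemma wedge_comp_coords:
  assumes "g \<in> hom_space UNIV UNIV"
  shows "wedge k (g \<circ> v) u
    = (\<Sum>L\<in>PiE {..<k} (\<lambda>_. {..<n}). (\<Prod>i<k. cinner (e (L i)) (v i)) * wedge k (g \<circ> e \<circ> L) u)"
  by (rule wedge_expand[where a = "\<lambda>i l. cinner (e l) (v i)" and x = "g \<circ> e"])
     (unfold o_apply, rule hom_coords[OF assms])

lemma ext_power_subset_span:
  "ext_power k \<subseteq> cspan {wedge k (e \<circ> L) | L. L \<in> PiE {..<k} (\<lambda>_. {..<n})}"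
  (is "_ \<subseteq> cspan ?S")
proof -
  have eq: "wedge k v = (\<Sum>L\<in>PiE {..<k} (\<lambda>_. {..<n}).
      (\<Prod>i<k. cinner (e (L i)) (v i)) *\<^sub>C wedge k (e \<circ> L))" for v
  proof
    fix u
    show "wedge k v u = (\<Sum>L\<in>PiE {..<k} (\<lambda>_. {..<n}).
        (\<Prod>i<k. cinner (e (L i)) (v i)) *\<^sub>C wedge k (e \<circ> L)) u"
      unfolding sum_fun_apply scaleC_fun_def scaleC_complex_def by (rule wedge_coords)
  qed
  have "(\<Sum>L\<in>PiE {..<k} (\<lambda>_. {..<n}).
      (\<Prod>i<k. cinner (e (L i)) (v i)) *\<^sub>C wedge k (e \<circ> L)) \<in> cspan ?S" for v
    by (intro complex_vector.span_sum complex_vector.span_scale complex_vector.span_base) blast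
  then have "wedge k v \<in> cspan ?S" for v by (simp only: eq[of v])
  then have "range (wedge k) \<subseteq> cspan ?S" by blast
  then show ?thesis
    unfolding ext_power_def by (intro complex_vector.span_minimal) auto
qed

text \<open>Existence is the explicit operator in the basis \<open>e\<close>, whose values on wedges
  follow from multilinearity; uniqueness holds because wedges span the exterior power.\<close>

lemma ext_map_eq:
  assumes g: "g \<in> hom_space UNIV UNIV"
  shows "ext_map k g = oper k e n (\<lambda>L. wedge k (g \<circ> e \<circ> L))"
    and "ext_map k g (wedge k v) = wedge k (g \<circ> v)"
proof -
  let ?T = "oper k e n (\<lambda>L. wedge k (g \<circ> e \<circ> L))"
  have End: "?T \<in> End_ext k" by (rule oper_in_End_ext) simp
  have wedge: "?T (wedge k v) = wedge k (g \<circ> v)" for v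
  proof
    fix u
    have "?T (wedge k v) u
      = (\<Sum>L\<in>PiE {..<k} (\<lambda>_. {..<n}). (\<Prod>i<k. cinner (e (L i)) (v i)) * wedge k (g \<circ> e \<circ> L) u)"
      by (rule oper_wedge) (simp only: o_assoc wedge_permute)
    then show "?T (wedge k v) u = wedge k (g \<circ> v) u"
      by (simp only: wedge_comp_coords[OF g])
  qed
  show eq: "ext_map k g = ?T"
    unfolding ext_map_def
  proof (rule the_equality)
    show "?T \<in> End_ext k \<and> (\<forall>v. ?T (wedge k v) = wedge k (g \<circ> v))"
      using End wedge by blast
  next
    fix T assume "T \<in> End_ext k \<and> (\<forall>v. T (wedge k v) = wedge k (g \<circ> v))"
    then show "T = ?T"
      using End wedge by (intro End_ext_eqI[of T k ?T "range (wedge k)"]) 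
        (auto simp: ext_power_def intro: complex_vector.span_base)
  qed
  show "ext_map k g (wedge k v) = wedge k (g \<circ> v)"
    using wedge by (simp only: eq)
qed

text \<open>The functional that is 1 at \<open>h i\<close> and 0 at the other \<open>h j\<close>
  extends linearly to the whole space, and the orthonormal basis represents it by a vector.\<close>

lemma lin_indep_dual:
  fixes h :: "nat \<Rightarrow> 'v"
  assumes "lin_indep n h"
  obtains u where "\<And>i j. i < n \<Longrightarrow> j < n \<Longrightarrow> cinner (u i) (h j) = (if i = j then 1 else 0)"
proof -
  interpret vp: vector_space_pair "scaleC :: complex \<Rightarrow> 'v \<Rightarrow> 'v" "scaleC :: complex \<Rightarrow> complex \<Rightarrow> complex"
    ..
  have "\<exists>u. \<forall>j<n. cinner u (h j) = (if i = j then 1 else 0)" if i: "i < n" for i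
  proof -
    obtain f :: "'v \<Rightarrow> complex" where f: "Vector_Spaces.linear scaleC scaleC f" "\<forall>x\<in>h ` {..<n}. f x = (if x = h i then 1 else 0)"
      using vp.linear_independent_extend[OF lin_indep_independent[OF assms],
          of "\<lambda>x. if x = h i then 1 else 0"] by blast
    interpret f: Vector_Spaces.linear "scaleC :: complex \<Rightarrow> 'v \<Rightarrow> 'v" "scaleC :: complex \<Rightarrow> complex \<Rightarrow> complex" f
      by (rule f(1))
    \<comment> \<open>The conjugates compensate for the antilinearity of \<open>cinner\<close> in
      its first argument.\<close>
    define u where "u = (\<Sum>l<n. cnj (f (e l)) *\<^sub>C e l)"
    have "cinner u x = f x" for x
    proof -
      have "f x = f (\<Sum>l<n. cinner (e l) x *\<^sub>C e l)" by (simp only: complete)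
      also have "\<dots> = cinner u x"
        unfolding f.sum f.scale u_def cinner_sum_left cinner_scaleC_left
        by (simp add: scaleC_complex_def mult.commute)
      finally show ?thesis by simp
    qed
    moreover have "f (h j) = (if i = j then 1 else 0)" if "j < n" for j
      using f(2) lin_indep_inj[OF assms] i that by (auto simp: inj_on_def)
    ultimately show ?thesis by (intro exI[of _ u]) simp
  qed
  then have "\<forall>i. \<exists>u. i < n \<longrightarrow> (\<forall>j<n. cinner u (h j) = (if i = j then 1 else 0))" by blast
  from choice[OF this] show thesis using that by blast
qed

text \<open>At a dual system of vectors the wedge takes the determinant of an identity matrix as its
  value.\<close>

lemma wedge_nonzero:
  fixes h :: "nat \<Rightarrow> 'v"
  assumes "lin_indep n h" "k \<le> n"
  shows "wedge k h \<noteq> 0"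
proof -
  obtain u where u: "\<And>i j. i < n \<Longrightarrow> j < n \<Longrightarrow> cinner (u i) (h j) = (if i = j then 1 else 0)"
    using lin_indep_dual[OF assms(1)] by blast
  have "wedge k h u = (\<Sum>p | p permutes {..<k}. if p = id then 1 else 0)"
    unfolding wedge_def
  proof (rule sum.cong[OF refl])
    fix p assume "p \<in> {p. p permutes {..<k}}"
    then have p: "p permutes {..<k}" by simp
    have less: "p i < k" if "i < k" for i
      using permutes_in_image[OF p, of i] that by simp
    show "of_int (sign p) * (\<Prod>i<k. cinner (u i) (h (p i))) = (if p = id then 1 else (0::complex))"
    proof (cases "p = id")
      case True
      then show ?thesis using u assms(2) by simp
    next
      case False
      then obtain i where "p i \<noteq> i" by (auto simp: fun_eq_iff)
      with p have i: "i < k" using permutes_not_in[OF p, of i] by force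
      have "cinner (u i) (h (p i)) = 0"
        using i less[OF i] assms(2) u[of i "p i"] \<open>p i \<noteq> i\<close> by auto
      then have "(\<Prod>i<k. cinner (u i) (h (p i))) = 0"
        using i by (intro prod_zero) auto
      then show ?thesis using False by simp
    qed
  qed
  also have "\<dots> = 1"
    by (simp add: sum.delta finite_permutations permutes_id)
  finally show ?thesis by auto
qed

end

section \<open>Multidegrees and the explicit form of \<open>ext_seq\<close>\<close>

definition degree_of :: "(nat \<Rightarrow> nat) \<Rightarrow> nat \<Rightarrow> nat \<Rightarrow> nat"
  where "degree_of s k i = card {l. l < k \<and> s l = i}"

lemma degree_of_permute:
  assumes p: "p permutes {..<k}"
  shows "degree_of (s \<circ> p) k = degree_of s k"
proof
  fix i
  have "bij_betw p {l. l < k \<and> (s \<circ> p) l = i} {l. l < k \<and> s l = i}"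
  proof (rule bij_betw_byWitness[where f' = "inv p"])
    show "p ` {l. l < k \<and> (s \<circ> p) l = i} \<subseteq> {l. l < k \<and> s l = i}"
      using permutes_in_image[OF p] by auto
    show "inv p ` {l. l < k \<and> s l = i} \<subseteq> {l. l < k \<and> (s \<circ> p) l = i}"
      using permutes_in_image[OF permutes_inv[OF p]] permutes_inverses[OF p] by auto
  qed (use permutes_inverses[OF p] in auto)
  then show "degree_of (s \<circ> p) k i = degree_of s k i"
    unfolding degree_of_def by (rule bij_betw_same_card)
qed

lemma degree_of_cong: "(\<And>l. l < k \<Longrightarrow> s l = s' l) \<Longrightarrow> degree_of s k = degree_of s' k"
  unfolding degree_of_def by (intro ext arg_cong[where f = card]) auto

context adapted
begin

definition h :: "nat \<Rightarrow> 'v" where "h l = (A ! t l) (e l)"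

lemma csubspace_dom: "i \<le> length A \<Longrightarrow> csubspace (dom_seq A i)"
  unfolding complex_vector.subspace_def by (simp add: dom cinner_add_right cinner_scaleC_right)

lemma e_in_dom: "l < n \<Longrightarrow> i \<le> t l \<Longrightarrow> e l \<in> dom_seq A i"
  using t_less[of l] by (subst dom) (auto simp: orth)

text \<open>Coordinates of type below \<open>i\<close> vanish on \<open>V(A)_i\<close>, and basis
  vectors of type above \<open>i\<close> lie in the kernel of \<open>A ! i\<close>; only type
  \<open>i\<close> survives.\<close>

lemma A_coords:
  assumes i: "i < length A" and x: "x \<in> dom_seq A i"
  shows "(A ! i) x = (\<Sum>l | l < n \<and> t l = i. cinner (e l) x *\<^sub>C h l)"
proof -
  have c: "cinner (e l) x = 0" if "l < n" "t l < i" for l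
    using dom[of i x] i x that by simp
  have "x = (\<Sum>l<n. cinner (e l) x *\<^sub>C e l)" by (simp add: complete)
  also have "\<dots> = (\<Sum>l | l < n \<and> i \<le> t l. cinner (e l) x *\<^sub>C e l)"
    by (intro sum.mono_neutral_right) (auto simp: c not_le)
  finally have "(A ! i) x = (A ! i) (\<Sum>l | l < n \<and> i \<le> t l. cinner (e l) x *\<^sub>C e l)" by simp
  also have "\<dots> = (\<Sum>l | l < n \<and> i \<le> t l. cinner (e l) x *\<^sub>C (A ! i) (e l))"
    using i by (intro hom_space_sum[OF hom[OF i] csubspace_dom]) (auto simp: e_in_dom)
  also have "\<dots> = (\<Sum>l | l < n \<and> t l = i. cinner (e l) x *\<^sub>C (A ! i) (e l))"
  proof (intro sum.mono_neutral_right)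
    show "\<forall>l\<in>{l. l < n \<and> i \<le> t l} - {l. l < n \<and> t l = i}. cinner (e l) x *\<^sub>C (A ! i) (e l) = 0"
    proof
      fix l assume "l \<in> {l. l < n \<and> i \<le> t l} - {l. l < n \<and> t l = i}"
      then have "e l \<in> dom_seq A (Suc i)" by (intro e_in_dom) auto
      then show "cinner (e l) x *\<^sub>C (A ! i) (e l) = 0" by simp
    qed
  qed auto
  also have "\<dots> = (\<Sum>l | l < n \<and> t l = i. cinner (e l) x *\<^sub>C h l)"
    by (intro sum.cong) (auto simp: h_def)
  finally show ?thesis .
qed

text \<open>Membership in \<open>V(A)_i\<close> excludes the types below \<open>i\<close>,
  orthogonality to \<open>V(A)_(i+1)\<close> those above. Conversely, the Parseval sum of such an
  \<open>x\<close> with an element of \<open>V(A)_(i+1)\<close> has no nonzero term.\<close>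

lemma orth_dom_iff:
  assumes i: "i < length A"
  shows "x \<in> orth_dom A i \<longleftrightarrow> (\<forall>l<n. t l \<noteq> i \<longrightarrow> cinner (e l) x = 0)"
proof
  assume x: "x \<in> orth_dom A i"
  show "\<forall>l<n. t l \<noteq> i \<longrightarrow> cinner (e l) x = 0"
  proof (intro allI impI)
    fix l assume l: "l < n" "t l \<noteq> i"
    show "cinner (e l) x = 0"
    proof (cases "t l < i")
      case True
      then show ?thesis using x l i dom[of i x] by (simp add: orth_dom_def)
    next
      case False
      with l have "e l \<in> dom_seq A (Suc i)" by (intro e_in_dom) auto
      with x have "cinner x (e l) = 0" by (simp add: orth_dom_def)
      then show ?thesis using cinner_commute[of "e l" x] by simp
    qed
  qed
next
  assume *: "\<forall>l<n. t l \<noteq> i \<longrightarrow> cinner (e l) x = 0"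
  show "x \<in> orth_dom A i"
    unfolding orth_dom_def mem_Collect_eq
  proof (intro conjI ballI)
    show "x \<in> dom_seq A i" using * i dom[of i x] by auto
    fix y assume y: "y \<in> dom_seq A (Suc i)"
    then have y0: "cinner (e l) y = 0" if "l < n" "t l = i" for l
      using dom[of "Suc i" y] i that by auto
    have "cinner x (e l) * cinner (e l) y = 0" if "l < n" for l
      using * y0[OF that] that cinner_commute[of x "e l"] by (cases "t l = i") auto
    then show "cinner x y = 0" unfolding parseval[of x y] by (intro sum.neutral) blast
  qed
qed

lemma e_in_orth_dom: "l < n \<Longrightarrow> e l \<in> orth_dom A (t l)"
  using t_less[of l] by (subst orth_dom_iff) (auto simp: orth)

lemma rk_eq:
  assumes i: "i < length A"
  shows "rk A i = card {l. l < n \<and> t l = i}"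
proof -
  let ?I = "{l. l < n \<and> t l = i}"
  have inj: "inj_on e ?I"
    by (rule inj_on_subset[OF inj_on_e]) auto
  have on: "orthonormal (e ` ?I)"
    using inj_onD[OF inj_on_e] by (auto simp: orthonormal_def orth)
  have "orth_dom A i = cspan (e ` ?I)"
  proof
    show "cspan (e ` ?I) \<subseteq> orth_dom A i"
    proof (rule complex_vector.span_minimal)
      show "e ` ?I \<subseteq> orth_dom A i" using e_in_orth_dom by auto
      show "csubspace (orth_dom A i)"
        unfolding complex_vector.subspace_def
        by (auto simp: orth_dom_iff[OF i] cinner_add_right cinner_scaleC_right)
    qed
    show "orth_dom A i \<subseteq> cspan (e ` ?I)"
    proof
      fix x assume "x \<in> orth_dom A i"
      then have "(\<Sum>l<n. cinner (e l) x *\<^sub>C e l) = (\<Sum>l\<in>?I. cinner (e l) x *\<^sub>C e l)"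
        unfolding orth_dom_iff[OF i] by (intro sum.mono_neutral_right) auto
      then have "x = (\<Sum>l\<in>?I. cinner (e l) x *\<^sub>C e l)" by (simp add: complete)
      moreover have "(\<Sum>l\<in>?I. cinner (e l) x *\<^sub>C e l) \<in> cspan (e ` ?I)"
        by (intro complex_vector.span_sum complex_vector.span_scale complex_vector.span_base) auto
      ultimately show "x \<in> cspan (e ` ?I)" by simp
    qed
  qed
  then show ?thesis
    unfolding rk_def
    using complex_vector.dim_span_eq_card_independent[OF orthonormal_independent[OF on]]
      card_image[OF inj] by simp
qed

definition g :: "'v \<Rightarrow> 'v" where "g x = (\<Sum>l<n. cinner (e l) x *\<^sub>C h l)"

lemma g_hom: "g \<in> hom_space UNIV UNIV"
  unfolding hom_space_def g_def
  by (simp add: cinner_add_right cinner_scaleC_right scaleC_add_left sum.distrib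
      complex_vector.scale_sum_right scaleC_scaleC)

lemma g_e: "l < n \<Longrightarrow> g (e l) = h l"
proof -
  assume l: "l < n"
  have "g (e l) = (\<Sum>j<n. if j = l then h j else 0)"
    unfolding g_def using l by (intro sum.cong) (auto simp: orth scaleC_one)
  then show ?thesis using l by simp
qed

lemma g_orth_dom: "i < length A \<Longrightarrow> x \<in> orth_dom A i \<Longrightarrow> g x = (A ! i) x"
proof -
  assume i: "i < length A" and x: "x \<in> orth_dom A i"
  then have xd: "x \<in> dom_seq A i" by (simp add: orth_dom_def)
  show ?thesis
    unfolding g_def A_coords[OF i xd] using x unfolding orth_dom_iff[OF i]
    by (intro sum.mono_neutral_right) auto
qed

lemma block_sum_eq: "block_sum A = g"
  unfolding block_sum_def
proof (rule the_equality)
  show "g \<in> hom_space UNIV UNIV \<and> (\<forall>i<length A. \<forall>x\<in>orth_dom A i. g x = (A ! i) x)"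
    using g_hom g_orth_dom by blast
next
  fix f assume f: "f \<in> hom_space UNIV UNIV \<and> (\<forall>i<length A. \<forall>x\<in>orth_dom A i. f x = (A ! i) x)"
  have fe: "f (e l) = h l" if "l < n" for l
    using f t_less[OF that] e_in_orth_dom[OF that] by (simp add: h_def)
  show "f = g"
  proof
    fix x
    have "f x = (\<Sum>l<n. cinner (e l) x *\<^sub>C f (e l))"
      using f by (intro hom_coords) blast
    then show "f x = g x" by (simp add: g_def fe)
  qed
qed

text \<open>As the types are nondecreasing, the first \<open>k\<close> basis vectors use up all
  types below that of the last one, which has index \<open>k - 1\<close>, and fill the remaining
  places with its type. So \<open>t (k - 1)\<close> is the index \<open>j\<close> in the definition
  of \<open>top_degree\<close>.\<close>

lemma top_degree_eq:
  assumes k: "1 \<le> k" "k \<le> n"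
  shows "top_degree A k = degree_of t k"
proof -
  let ?j = "t (k - 1)"
  have j: "?j < length A" using k by (intro t_less) simp
  have le_j: "t l \<le> ?j" if "l < k" for l using that k by (intro t_mono) auto
  have ge_j: "?j \<le> t l" if "k \<le> l" "l < n" for l using that by (intro t_mono) auto
  have disj: "card {l. l < n \<and> t l \<in> S} = (\<Sum>i\<in>S. rk A i)" if "S \<subseteq> {..<length A}" for S
  proof -
    have "{l. l < n \<and> t l \<in> S} = (\<Union>i\<in>S. {l. l < n \<and> t l = i})" by auto
    then have "card {l. l < n \<and> t l \<in> S} = (\<Sum>i\<in>S. card {l. l < n \<and> t l = i})"
      using finite_subset[OF that] by (subst card_UN_disjoint[symmetric]) auto
    also have "\<dots> = (\<Sum>i\<in>S. rk A i)"
      using that by (intro sum.cong refl) (auto simp: rk_eq)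
    finally show ?thesis .
  qed
  have Least: "(LEAST j. k \<le> (\<Sum>i\<le>j. rk A i)) = ?j"
  proof (rule Least_equality)
    have "{..<k} \<subseteq> {l. l < n \<and> t l \<in> {..?j}}" using le_j k by auto
    then have "card {..<k} \<le> card {l. l < n \<and> t l \<in> {..?j}}" by (intro card_mono) auto
    moreover have sub: "{..?j} \<subseteq> {..<length A}" using j by auto
    ultimately show "k \<le> (\<Sum>i\<le>?j. rk A i)" by (simp only: disj[OF sub] card_lessThan)
  next
    fix j assume le: "k \<le> (\<Sum>i\<le>j. rk A i)"
    show "?j \<le> j"
    proof (rule ccontr)
      assume "\<not> ?j \<le> j"
      then have jj: "j < ?j" by simp
      have "{l. l < n \<and> t l \<in> {..j}} \<subseteq> {..<k - 1}"
      proof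
        fix l assume l: "l \<in> {l. l < n \<and> t l \<in> {..j}}"
        show "l \<in> {..<k - 1}"
        proof (rule ccontr)
          assume "l \<notin> {..<k - 1}"
          then have "?j \<le> t l" using l by (intro t_mono) auto
          with l jj show False by auto
        qed
      qed
      then have "card {l. l < n \<and> t l \<in> {..j}} \<le> card {..<k - 1}" by (intro card_mono) auto
      moreover have sub: "{..j} \<subseteq> {..<length A}" using j jj by auto
      ultimately show False using le k by (simp only: disj[OF sub] card_lessThan)
    qed
  qed
  have lower: "{l. l < n \<and> t l = i} = {l. l < k \<and> t l = i}" if "i < ?j" for i
    using ge_j k that by (auto simp: not_less) (metis leD not_less)
  show ?thesis
  proof
    fix i
    consider "i < ?j" | "i = ?j" | "?j < i" by linarith
    then show "top_degree A k i = degree_of t k i"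
    proof cases
      case 1
      then show ?thesis
        using j lower[OF 1] by (simp add: top_degree_def Let_def Least degree_of_def rk_eq)
    next
      case 2
      have "{..<?j} \<subseteq> {..<length A}" using j by auto
      then have "(\<Sum>i<?j. rk A i) = card {l. l < n \<and> t l \<in> {..<?j}}"
        by (simp only: disj)
      also have "{l. l < n \<and> t l \<in> {..<?j}} = {l. l < k \<and> t l < ?j}"
        using ge_j k by (auto simp: not_less) (metis leD not_less)
      finally have *: "(\<Sum>i<?j. rk A i) = card {l. l < k \<and> t l < ?j}" .
      have un: "{..<k} = {l. l < k \<and> t l < ?j} \<union> {l. l < k \<and> t l = ?j}"
        using le_j by (auto simp: le_less)
      have "card {..<k} = card {l. l < k \<and> t l < ?j} + card {l. l < k \<and> t l = ?j}"
        by (subst un, rule card_Un_disjoint) auto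
      then have "k - card {l. l < k \<and> t l < ?j} = card {l. l < k \<and> t l = ?j}"
        unfolding card_lessThan by linarith
      moreover have "top_degree A k i = k - (\<Sum>i<?j. rk A i)"
        using 2 by (simp add: top_degree_def Let_def Least)
      ultimately show ?thesis
        unfolding * degree_of_def 2 by (rule trans[rotated])
    next
      case 3
      then have "{l. l < k \<and> t l = i} = {}" using le_j by fastforce
      then show ?thesis using 3 by (simp add: top_degree_def Let_def Least degree_of_def)
    qed
  qed
qed

definition ext_op :: "nat \<Rightarrow> 'v ext_end"
  where "ext_op k = oper k e n
    (\<lambda>L. if degree_of (t \<circ> L) k = degree_of t k then wedge k (h \<circ> L) else 0)"

lemma ext_op_End: "ext_op k \<in> End_ext k"
  unfolding ext_op_def
  by (rule oper_in_End_ext) (auto simp: complex_vector.subspace_0[OF csubspace_ext_power])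

lemma wedge_h: "L \<in> PiE {..<k} (\<lambda>_. {..<n}) \<Longrightarrow> wedge k (h \<circ> L) = wedge k (g \<circ> e \<circ> L)"
  by (rule wedge_cong) (auto simp: PiE_def Pi_def g_e)

text \<open>If \<open>v l\<close> lies in the summand of type \<open>s l\<close>, the coefficient of
  a multi-index \<open>L\<close> vanishes unless \<open>t \<circ> L\<close> agrees with
  \<open>s\<close> entry by entry. All contributing \<open>L\<close> thus have the degree of
  \<open>s\<close>, and the case distinction in \<open>ext_op\<close> comes out of the sum.\<close>

lemma ext_op_wedge:
  assumes s: "\<And>l. l < k \<Longrightarrow> s l < length A" "\<And>l. l < k \<Longrightarrow> v l \<in> orth_dom A (s l)"
  shows "ext_op k (wedge k v) = (if degree_of s k = degree_of t k then wedge k (g \<circ> v) else 0)"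
proof
  fix u
  let ?P = "PiE {..<k} (\<lambda>_. {..<n})" and ?c = "\<lambda>L. \<Prod>i<k. cinner (e (L i)) (v i)"
  have zero: "?c L = 0" if L: "L \<in> ?P" "degree_of (t \<circ> L) k \<noteq> degree_of s k" for L
  proof -
    obtain i where i: "i < k" "t (L i) \<noteq> s i"
      using L(2) degree_of_cong[of k "t \<circ> L" s] by auto
    moreover have "L i < n" using L i by auto
    ultimately have "cinner (e (L i)) (v i) = 0"
      using s[of i] orth_dom_iff[of "s i" "v i"] by auto
    with i show ?thesis by (intro prod_zero) auto
  qed
  have "ext_op k (wedge k v) u = (\<Sum>L\<in>?P. ?c L *
      (if degree_of (t \<circ> L) k = degree_of t k then wedge k (h \<circ> L) else 0) u)"
    unfolding ext_op_def
  proof (rule oper_wedge)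
    fix L p u assume p: "p permutes {..<k}"
    have "degree_of (t \<circ> (L \<circ> p)) k = degree_of (t \<circ> L) k"
      using degree_of_permute[OF p, of "t \<circ> L"] by (simp only: o_assoc)
    moreover have "wedge k (h \<circ> (L \<circ> p)) u = of_int (sign p) * wedge k (h \<circ> L) u"
      using wedge_permute[OF p, of "h \<circ> L" u] by (simp only: o_assoc)
    ultimately show "(if degree_of (t \<circ> (L \<circ> p)) k = degree_of t k then wedge k (h \<circ> (L \<circ> p)) else 0) u
      = of_int (sign p) * (if degree_of (t \<circ> L) k = degree_of t k then wedge k (h \<circ> L) else 0) u"
      by (simp only: if_distrib[where f = "\<lambda>f. f u"] zero_fun_apply split: if_split) simp
  qed
  also have "\<dots> = (\<Sum>L\<in>?P. if degree_of s k = degree_of t k then ?c L * wedge k (g \<circ> e \<circ> L) u else 0)"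
    using zero by (intro sum.cong[OF refl]) (auto simp: wedge_h)
  also have "\<dots> = (if degree_of s k = degree_of t k then wedge k (g \<circ> v) else 0) u"
    by (simp add: wedge_comp_coords[OF g_hom])
  finally show "ext_op k (wedge k v) u
    = (if degree_of s k = degree_of t k then wedge k (g \<circ> v) else 0) u" .
qed

text \<open>The previous lemma shows that \<open>ext_op\<close> has the prescribed values on each
  summand. It is the only such operator, because every wedge of basis vectors lies in one of the
  summands and these wedges span.\<close>

lemma ext_seq_eq:
  assumes k: "1 \<le> k" "k \<le> n"
  shows "ext_seq k A = ext_op k"
  unfolding ext_seq_def
proof (rule the_equality)
  let ?S = "\<lambda>a. {wedge k v | v. \<exists>t. (\<forall>l<k. t l < length A \<and> v l \<in> orth_dom A (t l))
    \<and> (\<forall>i. card {l. l < k \<and> t l = i} = a i)}"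
  have sub: "?S a \<subseteq> ext_power k" for a by auto
  have zero: "0 \<in> (ext_power k :: ((nat \<Rightarrow> 'v) \<Rightarrow> complex) set)"
    using complex_vector.subspace_0[OF csubspace_ext_power] .
  have homs: "ext_op k \<in> hom_space (ext_power k) (ext_power k)"
      "ext_map k g \<in> hom_space (ext_power k) (ext_power k)"
      "((\<lambda>_. 0) :: 'v ext_end) \<in> hom_space (ext_power k) (ext_power k)"
    using ext_op_End[of k] oper_in_End_ext[of k n "\<lambda>L. wedge k (g \<circ> e \<circ> L)" e]
      zero
    by (simp_all add: ext_map_eq(1)[OF g_hom] End_ext_def hom_space_def)
  have S: "ext_op k w = (if a = degree_of t k then ext_map k g w else 0)" if "w \<in> ?S a" for w a
  proof -
    from that obtain v s where w: "w = wedge k v"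
      and s: "\<forall>l<k. s l < length A \<and> v l \<in> orth_dom A (s l)"
      and card: "\<forall>i. card {l. l < k \<and> s l = i} = a i" by blast
    have "degree_of s k = a" using card by (auto simp: degree_of_def)
    with s show ?thesis
      by (simp add: w ext_op_wedge[of k s v] ext_map_eq(2)[OF g_hom])
  qed
  show "ext_op k \<in> End_ext k
    \<and> (\<forall>w\<in>ext_summand A k (top_degree A k). ext_op k w = ext_map k (block_sum A) w)
    \<and> (\<forall>a. a \<noteq> top_degree A k \<longrightarrow> (\<forall>w\<in>ext_summand A k a. ext_op k w = 0))"
    unfolding block_sum_eq top_degree_eq[OF k] ext_summand_def
  proof (intro conjI ballI allI impI)
    fix w assume "w \<in> cspan (?S (degree_of t k))"
    from hom_space_eq_on_span[OF homs(1,2) csubspace_ext_power sub _ this]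
    show "ext_op k w = ext_map k g w" using S by simp
  next
    fix a w assume "a \<noteq> degree_of t k" "w \<in> cspan (?S a)"
    with hom_space_eq_on_span[OF homs(1,3) csubspace_ext_power sub _ this(2)]
    show "ext_op k w = 0" using S by simp
  qed (rule ext_op_End)
  fix T assume T: "T \<in> End_ext k
    \<and> (\<forall>w\<in>ext_summand A k (top_degree A k). T w = ext_map k (block_sum A) w)
    \<and> (\<forall>a. a \<noteq> top_degree A k \<longrightarrow> (\<forall>w\<in>ext_summand A k a. T w = 0))"
  show "T = ext_op k"
  proof (rule End_ext_eqI[OF _ ext_op_End ext_power_subset_span])
    fix w assume "w \<in> {wedge k (e \<circ> L) | L. L \<in> PiE {..<k} (\<lambda>_. {..<n})}"
    then obtain L where L: "L \<in> PiE {..<k} (\<lambda>_. {..<n})" "w = wedge k (e \<circ> L)" by blast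
    then have "\<forall>l<k. (t \<circ> L) l < length A \<and> (e \<circ> L) l \<in> orth_dom A ((t \<circ> L) l)"
      using t_less e_in_orth_dom by auto
    then have w: "w \<in> ?S (degree_of (t \<circ> L) k)"
      unfolding L(2) degree_of_def by blast
    then have "w \<in> ext_summand A k (degree_of (t \<circ> L) k)"
      unfolding ext_summand_def by (rule complex_vector.span_base)
    with T show "T w = ext_op k w"
      unfolding block_sum_eq top_degree_eq[OF k] S[OF w] by auto
  qed (use T in auto)
qed

text \<open>The wedge of the first \<open>k\<close> basis vectors has top degree, so its image is
  the wedge of the first \<open>k\<close> vectors \<open>h l\<close>.\<close>

lemma ext_op_nonzero:
  assumes "lin_indep n h" "k \<le> n"
  shows "ext_op k \<noteq> 0"
proof -
  have "ext_op k (wedge k e) = wedge k (g \<circ> e)"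
    using assms(2) t_less e_in_orth_dom by (subst ext_op_wedge[of k t]) auto
  also have "\<dots> = wedge k h"
    using assms(2) by (intro wedge_cong) (simp add: g_e)
  finally show ?thesis
    using wedge_nonzero[OF assms] by auto
qed

end

section \<open>Hinges\<close>

lemma phi_nth_iff:
  "i < length A \<Longrightarrow> (x, y) \<in> phi A ! i
    \<longleftrightarrow> (\<exists>w. x \<in> dom_seq A i \<and> w \<in> (\<Sum>k<i. im_seq A k) \<and> y = (A ! i) x + w)"
  by (auto simp: phi_def set_plus_def)

text \<open>For \<open>A\<close> in \<open>M\<^sub>H\<close> the vectors \<open>h l\<close> form a basis; \<open>u\<close> is its dual basis with respect to
  the Hermitian product. In these coordinates all linear relations of the hinge of \<open>A\<close> are
  coordinate subspaces or graphs of coordinate projections.\<close>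

locale adapted_MH = adapted e n A t
  for e :: "nat \<Rightarrow> 'v::hermitian_space" and n A t +
  fixes u :: "nat \<Rightarrow> 'v"
  assumes dual: "i < n \<Longrightarrow> j < n \<Longrightarrow> cinner (u i) (h j) = (if i = j then 1 else 0)"
    and h_complete: "(\<Sum>l<n. cinner (u l) y *\<^sub>C h l) = y"

context adapted
begin

lemma e_comb_coord:
  "l < n \<Longrightarrow> cinner (e l) (\<Sum>j | j < n \<and> P j. c j *\<^sub>C e j) = (if P l then c l else 0)"
proof -
  assume l: "l < n"
  have "(\<Sum>j | j < n \<and> P j. c j *\<^sub>C e j) = (\<Sum>j<n. (if P j then c j else 0) *\<^sub>C e j)"
    by (intro sum.mono_neutral_cong_left) auto
  then show ?thesis using coord_sum[OF l] by simp
qed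

lemma A_comb:
  assumes i: "i < length A"
  shows "(\<Sum>j | j < n \<and> t j = i. c j *\<^sub>C e j) \<in> dom_seq A i"
    and "(A ! i) (\<Sum>j | j < n \<and> t j = i. c j *\<^sub>C e j) = (\<Sum>j | j < n \<and> t j = i. c j *\<^sub>C h j)"
proof -
  show d: "(\<Sum>j | j < n \<and> t j = i. c j *\<^sub>C e j) \<in> dom_seq A i"
    using i by (simp add: dom e_comb_coord)
  show "(A ! i) (\<Sum>j | j < n \<and> t j = i. c j *\<^sub>C e j) = (\<Sum>j | j < n \<and> t j = i. c j *\<^sub>C h j)"
    unfolding A_coords[OF i d] by (intro sum.cong) (auto simp: e_comb_coord)
qed

lemma im_seq_iff:
  assumes i: "i < length A"
  shows "y \<in> im_seq A i \<longleftrightarrow> (\<exists>c. y = (\<Sum>j | j < n \<and> t j = i. c j *\<^sub>C h j))"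
proof
  assume "y \<in> im_seq A i"
  then obtain x where x: "x \<in> dom_seq A i" "y = (A ! i) x" by (auto simp: im_seq_def)
  show "\<exists>c. y = (\<Sum>j | j < n \<and> t j = i. c j *\<^sub>C h j)"
    using A_coords[OF i x(1)] x(2) by (intro exI[of _ "\<lambda>l. cinner (e l) x"]) simp
next
  assume "\<exists>c. y = (\<Sum>j | j < n \<and> t j = i. c j *\<^sub>C h j)"
  then obtain c where "y = (\<Sum>j | j < n \<and> t j = i. c j *\<^sub>C h j)" by blast
  then have "y = (A ! i) (\<Sum>j | j < n \<and> t j = i. c j *\<^sub>C e j)" by (simp only: A_comb(2)[OF i])
  then show "y \<in> im_seq A i" unfolding im_seq_def using A_comb(1)[OF i] by (rule image_eqI)
qed

lemma sum_by_type: "(\<Sum>i<length A. \<Sum>l | l < n \<and> t l = i. f l) = (\<Sum>l<n. f l)"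
  for f :: "nat \<Rightarrow> 'b::comm_monoid_add"
proof -
  have "t ` {..<n} \<subseteq> {..<length A}" using t_less by auto
  from sum.group[OF _ _ this, of f] show ?thesis by simp
qed

text \<open>Grouped by type, a linear relation becomes a sum of elements of the images of the
  \<open>A_i\<close>, so each group vanishes. Then \<open>A_i\<close> kills the corresponding
  combination of basis vectors of type \<open>i\<close>, which puts it into
  \<open>V(A)_(i+1)\<close>, where coordinates of type \<open>i\<close> are zero.\<close>

lemma h_indep:
  assumes ds: "is_direct_sum {..<length A} (im_seq A) UNIV"
  shows "lin_indep n h"
  unfolding lin_indep_def
proof (intro allI impI)
  fix c l assume 0: "(\<Sum>l<n. c l *\<^sub>C h l) = 0" and l: "l < n"
  define y where "y = restrict (\<lambda>i. \<Sum>j | j < n \<and> t j = i. c j *\<^sub>C h j) {..<length A}"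
  define z where "z = restrict (\<lambda>i. 0 :: 'v) {..<length A}"
  have "y \<in> Pi\<^sub>E {..<length A} (im_seq A)"
    unfolding y_def
  proof (rule restrict_PiE_iff[THEN iffD2], rule ballI)
    fix i assume "i \<in> {..<length A}"
    then have i: "i < length A" by simp
    show "(\<Sum>j | j < n \<and> t j = i. c j *\<^sub>C h j) \<in> im_seq A i"
      unfolding im_seq_iff[OF i] by (rule exI[of _ c]) (rule refl)
  qed
  moreover have "z \<in> Pi\<^sub>E {..<length A} (im_seq A)"
    unfolding z_def
  proof (rule restrict_PiE_iff[THEN iffD2], rule ballI)
    fix i assume "i \<in> {..<length A}"
    then have i: "i < length A" by simp
    show "0 \<in> im_seq A i"
      unfolding im_seq_iff[OF i] by (rule exI[of _ "\<lambda>_. 0"]) simp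
  qed
  moreover have "sum y {..<length A} = 0"
    using 0 sum_by_type[of "\<lambda>l. c l *\<^sub>C h l"] by (simp add: y_def)
  moreover have "sum z {..<length A} = 0" by (simp add: z_def)
  ultimately have "y = z" using ds unfolding is_direct_sum_def by (metis UNIV_I)
  then have "y (t l) = 0" using t_less[OF l] by (simp add: z_def)
  then have "(\<Sum>j | j < n \<and> t j = t l. c j *\<^sub>C e j) \<in> dom_seq A (Suc (t l))"
    using A_comb[OF t_less[OF l], of c] t_less[OF l] by (simp add: y_def)
  then have "cinner (e l) (\<Sum>j | j < n \<and> t j = t l. c j *\<^sub>C e j) = 0"
    using dom[of "Suc (t l)"] t_less[OF l] l by (simp add: Suc_leI del: dom_seq.simps)
  then show "c l = 0" using l by (simp add: e_comb_coord)
qed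

text \<open>The uniqueness half of the direct sum gives independence and hence the dual vectors; the
  existence half shows that the \<open>h l\<close> span.\<close>

lemma ex_dual:
  assumes ds: "is_direct_sum {..<length A} (im_seq A) UNIV"
  obtains u where "adapted_MH e n A t u"
proof -
  obtain u where u: "\<And>i j. i < n \<Longrightarrow> j < n \<Longrightarrow> cinner (u i) (h j) = (if i = j then 1 else 0)"
    using lin_indep_dual[OF h_indep[OF ds]] by blast
  have "(\<Sum>l<n. cinner (u l) y *\<^sub>C h l) = y" for y
  proof -
    from ds obtain z where z: "z \<in> Pi\<^sub>E {..<length A} (im_seq A)" "sum z {..<length A} = y"
      unfolding is_direct_sum_def by (metis UNIV_I)
    have "\<forall>i. \<exists>c. i < length A \<longrightarrow> z i = (\<Sum>j | j < n \<and> t j = i. c j *\<^sub>C h j)"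
    proof
      fix i
      have "\<exists>c. z i = (\<Sum>j | j < n \<and> t j = i. c j *\<^sub>C h j)" if i: "i < length A"
        using PiE_mem[OF z(1), of i] i unfolding im_seq_iff[OF i, symmetric] by simp
      then show "\<exists>c. i < length A \<longrightarrow> z i = (\<Sum>j | j < n \<and> t j = i. c j *\<^sub>C h j)"
        by (cases "i < length A") auto
    qed
    from choice[OF this] obtain c
      where c: "\<And>i. i < length A \<Longrightarrow> z i = (\<Sum>j | j < n \<and> t j = i. c i j *\<^sub>C h j)" by blast
    have "y = (\<Sum>i<length A. \<Sum>j | j < n \<and> t j = i. c (t j) j *\<^sub>C h j)"
      unfolding z(2)[symmetric] using c by (intro sum.cong refl) auto
    also have "\<dots> = (\<Sum>j<n. c (t j) j *\<^sub>C h j)" by (rule sum_by_type)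
    finally have y: "y = (\<Sum>j<n. c (t j) j *\<^sub>C h j)" .
    have "cinner (u l) y = c (t l) l" if "l < n" for l
    proof -
      have "cinner (u l) y = (\<Sum>j<n. if j = l then c (t j) j else 0)"
        unfolding y cinner_sum_right cinner_scaleC_right using that
        by (intro sum.cong refl) (auto simp: u)
      then show ?thesis using that by simp
    qed
    then have "(\<Sum>l<n. cinner (u l) y *\<^sub>C h l) = (\<Sum>j<n. c (t j) j *\<^sub>C h j)"
      by (intro sum.cong refl) auto
    with y show ?thesis by simp
  qed
  with u have "adapted_MH e n A t u" by unfold_locales auto
  then show thesis by (rule that)
qed

end

context adapted_MH
begin

lemma h_comb_coord: "l < n \<Longrightarrow> cinner (u l) (\<Sum>j<n. c j *\<^sub>C h j) = c l"
proof -
  assume l: "l < n"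
  have "cinner (u l) (\<Sum>j<n. c j *\<^sub>C h j) = (\<Sum>j<n. if l = j then c j else 0)"
    unfolding cinner_sum_right cinner_scaleC_right using l by (intro sum.cong) (auto simp: dual)
  then show ?thesis using l by simp
qed

lemma h_comb_coord': "l < n \<Longrightarrow> cinner (u l) (\<Sum>j | j < n \<and> P j. c j *\<^sub>C h j) = (if P l then c l else 0)"
proof -
  assume l: "l < n"
  have "(\<Sum>j | j < n \<and> P j. c j *\<^sub>C h j) = (\<Sum>j<n. (if P j then c j else 0) *\<^sub>C h j)"
    by (intro sum.mono_neutral_cong_left) auto
  then show ?thesis using h_comb_coord[OF l] by simp
qed

lemma h_coord_eqI: "(\<And>l. l < n \<Longrightarrow> cinner (u l) x = cinner (u l) y) \<Longrightarrow> x = y"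
proof -
  assume "\<And>l. l < n \<Longrightarrow> cinner (u l) x = cinner (u l) y"
  then have "(\<Sum>l<n. cinner (u l) x *\<^sub>C h l) = (\<Sum>l<n. cinner (u l) y *\<^sub>C h l)"
    by (intro sum.cong) auto
  then show ?thesis by (simp only: h_complete)
qed

lemma lin_indep_h: "lin_indep n h"
  unfolding lin_indep_def
proof (intro allI impI)
  fix c l assume *: "(\<Sum>l<n. c l *\<^sub>C h l) = 0" and l: "l < n"
  show "c l = 0" using h_comb_coord[OF l, of c] unfolding * by simp
qed

lemma A_coord:
  assumes "i < length A" "x \<in> dom_seq A i" "l < n"
  shows "cinner (u l) ((A ! i) x) = (if t l = i then cinner (e l) x else 0)"
  unfolding A_coords[OF assms(1,2)] using assms(3) by (rule h_comb_coord')

lemma im_seq_coords: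
  assumes i: "i < length A"
  shows "y \<in> im_seq A i \<longleftrightarrow> (\<forall>l<n. t l \<noteq> i \<longrightarrow> cinner (u l) y = 0)"
proof
  assume "y \<in> im_seq A i"
  then show "\<forall>l<n. t l \<noteq> i \<longrightarrow> cinner (u l) y = 0"
    unfolding im_seq_iff[OF i] by (auto simp: h_comb_coord')
next
  assume *: "\<forall>l<n. t l \<noteq> i \<longrightarrow> cinner (u l) y = 0"
  have "y = (\<Sum>j | j < n \<and> t j = i. cinner (u j) y *\<^sub>C h j)"
    using * by (intro h_coord_eqI) (auto simp: h_comb_coord')
  then show "y \<in> im_seq A i" unfolding im_seq_iff[OF i] by (rule exI[of _ "\<lambda>j. cinner (u j) y"])
qed

lemma im_sum_coords:
  "i \<le> length A \<Longrightarrow> y \<in> (\<Sum>k<i. im_seq A k) \<longleftrightarrow> (\<forall>l<n. \<not> t l < i \<longrightarrow> cinner (u l) y = 0)"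
proof (induction i arbitrary: y)
  case 0
  have "y = 0" if "\<forall>l<n. cinner (u l) y = 0"
    using that by (intro h_coord_eqI) auto
  then show ?case by auto
next
  case (Suc i)
  then have i: "i < length A" by simp
  note IH = Suc.IH[OF less_imp_le[OF i]]
  show ?case
  proof
    assume "y \<in> (\<Sum>k<Suc i. im_seq A k)"
    then obtain a b where "y = a + b" "a \<in> (\<Sum>k<i. im_seq A k)" "b \<in> im_seq A i"
      by (auto elim: set_plus_elim)
    then show "\<forall>l<n. \<not> t l < Suc i \<longrightarrow> cinner (u l) y = 0"
      unfolding IH im_seq_coords[OF i] by (auto simp: cinner_add_right)
  next
    assume *: "\<forall>l<n. \<not> t l < Suc i \<longrightarrow> cinner (u l) y = 0"
    define a where "a = (\<Sum>j | j < n \<and> t j < i. cinner (u j) y *\<^sub>C h j)"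
    define b where "b = (\<Sum>j | j < n \<and> t j = i. cinner (u j) y *\<^sub>C h j)"
    have "y = a + b"
      using * by (intro h_coord_eqI) (auto simp: a_def b_def h_comb_coord' cinner_add_right)
    moreover have "a \<in> (\<Sum>k<i. im_seq A k)" unfolding IH by (simp add: a_def h_comb_coord')
    moreover have "b \<in> im_seq A i" unfolding im_seq_coords[OF i] by (simp add: b_def h_comb_coord')
    ultimately show "y \<in> (\<Sum>k<Suc i. im_seq A k)" by (simp add: set_plus_intro)
  qed
qed

text \<open>Coordinates of \<open>y\<close> of type below \<open>i\<close> are free, as they form
  the indeterminacy; coordinates of \<open>x\<close> of type above \<open>i\<close> are free, as
  \<open>A ! i\<close> kills them. In type \<open>i\<close> the relation is the identity matrix,
  since \<open>A ! i\<close> sends \<open>e l\<close> to \<open>h l\<close>.\<close>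

lemma phi_coords:
  assumes i: "i < length A"
  shows "(x, y) \<in> phi A ! i \<longleftrightarrow> (\<forall>l<n. (t l < i \<longrightarrow> cinner (e l) x = 0)
    \<and> (t l = i \<longrightarrow> cinner (u l) y = cinner (e l) x) \<and> (i < t l \<longrightarrow> cinner (u l) y = 0))"
    (is "_ \<longleftrightarrow> ?R")
proof -
  have "(x, y) \<in> phi A ! i \<longleftrightarrow> (\<exists>w. x \<in> dom_seq A i \<and> w \<in> (\<Sum>k<i. im_seq A k) \<and> y = (A ! i) x + w)"
    using i by (rule phi_nth_iff)
  also have "\<dots> \<longleftrightarrow> ?R"
  proof
    assume "\<exists>w. x \<in> dom_seq A i \<and> w \<in> (\<Sum>k<i. im_seq A k) \<and> y = (A ! i) x + w"
    then obtain w where x: "x \<in> dom_seq A i" and w: "\<forall>l<n. \<not> t l < i \<longrightarrow> cinner (u l) w = 0"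
      and y: "y = (A ! i) x + w"
      unfolding im_sum_coords[OF less_imp_le[OF i]] by blast
    then show ?R
      using dom[of i x] i by (auto simp: cinner_add_right A_coord[OF i x])
  next
    assume R: ?R
    then have x: "x \<in> dom_seq A i" using dom[of i x] i by simp
    have "y - (A ! i) x \<in> (\<Sum>k<i. im_seq A k)"
      unfolding im_sum_coords[OF less_imp_le[OF i]]
      using R by (auto simp: cinner_diff_right A_coord[OF i x] not_less le_less)
    with x show "\<exists>w. x \<in> dom_seq A i \<and> w \<in> (\<Sum>k<i. im_seq A k) \<and> y = (A ! i) x + w"
      by (intro exI[of _ "y - (A ! i) x"]) simp
  qed
  finally show ?thesis .
qed

lemma cdim_UNIV: "cdim (UNIV :: 'v set) = n"
proof -
  have ind: "lin_indep n e"
    unfolding lin_indep_def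
  proof (intro allI impI)
    fix c l assume *: "(\<Sum>l<n. c l *\<^sub>C e l) = 0" and l: "l < n"
    show "c l = 0" using coord_sum[OF l, of c] unfolding * by simp
  qed
  have "x \<in> cspan (e ` {..<n})" for x
  proof -
    have "(\<Sum>l<n. cinner (e l) x *\<^sub>C e l) \<in> cspan (e ` {..<n})"
      by (intro complex_vector.span_sum complex_vector.span_scale complex_vector.span_base) auto
    then show ?thesis by (simp only: complete)
  qed
  then have "cspan (e ` {..<n}) = UNIV" by auto
  then show ?thesis using cdim_span_lin_indep[OF ind] by simp
qed

lemma cdim_phi:
  assumes i: "i < length A"
  shows "csubspace (phi A ! i)" and "cdim (phi A ! i) = n"
proof -
  show sub: "csubspace (phi A ! i)"
    unfolding complex_vector.subspace_def
  proof (intro conjI ballI allI)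
    show "0 \<in> phi A ! i" by (simp add: zero_prod_def phi_coords[OF i])
  next
    fix p q assume "p \<in> phi A ! i" "q \<in> phi A ! i"
    then show "p + q \<in> phi A ! i"
      by (cases p, cases q) (simp add: phi_coords[OF i] cinner_add_right)
  next
    fix c p assume "p \<in> phi A ! i"
    then show "c *\<^sub>C p \<in> phi A ! i"
      by (cases p) (simp add: phi_coords[OF i] cinner_scaleC_right scaleC_prod_def)
  qed
  \<comment> \<open>One vector per index: \<open>(e l, 0)\<close>, \<open>(e l, h l)\<close> or
    \<open>(0, h l)\<close> as \<open>t l\<close> is above, equal to or below \<open>i\<close>. This
    is why every relation of the hinge has dimension \<open>n\<close>.\<close>
  define q where "q l = (if i \<le> t l then (e l, if t l = i then h l else 0) else (0, h l))" for l
  have fst: "fst (\<Sum>l<n. c l *\<^sub>C q l) = (\<Sum>j | j < n \<and> i \<le> t j. c j *\<^sub>C e j)" for c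
  proof -
    have "fst (\<Sum>l<n. c l *\<^sub>C q l) = (\<Sum>l<n. c l *\<^sub>C fst (q l))"
      by (simp add: fst_sum scaleC_prod_def)
    also have "\<dots> = (\<Sum>j | j < n \<and> i \<le> t j. c j *\<^sub>C e j)"
      by (intro sum.mono_neutral_cong_right) (auto simp: q_def)
    finally show ?thesis .
  qed
  have snd: "snd (\<Sum>l<n. c l *\<^sub>C q l) = (\<Sum>j | j < n \<and> t j \<le> i. c j *\<^sub>C h j)" for c
  proof -
    have "snd (\<Sum>l<n. c l *\<^sub>C q l) = (\<Sum>l<n. c l *\<^sub>C snd (q l))"
      by (simp add: snd_sum scaleC_prod_def)
    also have "\<dots> = (\<Sum>j | j < n \<and> t j \<le> i. c j *\<^sub>C h j)"
      by (intro sum.mono_neutral_cong_right) (auto simp: q_def)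
    finally show ?thesis .
  qed
  have ind: "lin_indep n q"
    unfolding lin_indep_def
  proof (intro allI impI)
    fix c l assume *: "(\<Sum>l<n. c l *\<^sub>C q l) = 0" and l: "l < n"
    have "cinner (e l) (\<Sum>j | j < n \<and> i \<le> t j. c j *\<^sub>C e j) = 0"
      unfolding fst[symmetric] * by simp
    moreover have "cinner (u l) (\<Sum>j | j < n \<and> t j \<le> i. c j *\<^sub>C h j) = 0"
      unfolding snd[symmetric] * by simp
    ultimately show "c l = 0"
      using l by (auto simp: e_comb_coord h_comb_coord' split: if_splits)
  qed
  have "phi A ! i = cspan (q ` {..<n})"
  proof
    show "cspan (q ` {..<n}) \<subseteq> phi A ! i"
      using sub by (intro complex_vector.span_minimal) (auto simp: q_def phi_coords[OF i] orth dual)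
    show "phi A ! i \<subseteq> cspan (q ` {..<n})"
    proof
      fix p assume "p \<in> phi A ! i"
      then obtain x y where p: "p = (x, y)" "(x, y) \<in> phi A ! i" by (cases p) auto
      define c where "c l = (if i \<le> t l then cinner (e l) x else cinner (u l) y)" for l
      have "x = (\<Sum>j | j < n \<and> i \<le> t j. c j *\<^sub>C e j)"
        using p(2) unfolding phi_coords[OF i]
        by (intro coord_eqI) (auto simp: e_comb_coord c_def not_le)
      moreover have "y = (\<Sum>j | j < n \<and> t j \<le> i. c j *\<^sub>C h j)"
        using p(2) unfolding phi_coords[OF i]
        by (intro h_coord_eqI) (auto simp: h_comb_coord' c_def not_le le_less)
      ultimately have "p = (\<Sum>l<n. c l *\<^sub>C q l)"
        unfolding p(1) by (simp add: prod_eq_iff fst snd)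
      moreover have "(\<Sum>l<n. c l *\<^sub>C q l) \<in> cspan (q ` {..<n})"
        by (intro complex_vector.span_sum complex_vector.span_scale complex_vector.span_base) auto
      ultimately show "p \<in> cspan (q ` {..<n})" by simp
    qed
  qed
  then show "cdim (phi A ! i) = n" using cdim_span_lin_indep[OF ind] by simp
qed

lemma Domain_phi: "i < length A \<Longrightarrow> x \<in> Domain (phi A ! i) \<longleftrightarrow> (\<forall>l<n. t l < i \<longrightarrow> cinner (e l) x = 0)"
proof
  assume i: "i < length A" and *: "\<forall>l<n. t l < i \<longrightarrow> cinner (e l) x = 0"
  have "(x, \<Sum>j | j < n \<and> t j = i. cinner (e j) x *\<^sub>C h j) \<in> phi A ! i"
    using * by (simp add: phi_coords[OF i] h_comb_coord')
  then show "x \<in> Domain (phi A ! i)" by blast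
qed (auto simp: phi_coords)

lemma Range_phi: "i < length A \<Longrightarrow> y \<in> Range (phi A ! i) \<longleftrightarrow> (\<forall>l<n. i < t l \<longrightarrow> cinner (u l) y = 0)"
proof
  assume i: "i < length A" and *: "\<forall>l<n. i < t l \<longrightarrow> cinner (u l) y = 0"
  have "(\<Sum>j | j < n \<and> t j = i. cinner (u j) y *\<^sub>C e j, y) \<in> phi A ! i"
    using * by (simp add: phi_coords[OF i] e_comb_coord)
  then show "y \<in> Range (phi A ! i)" by blast
qed (auto simp: phi_coords)

lemma Ker_phi: "i < length A \<Longrightarrow> x \<in> Ker_rel (phi A ! i) \<longleftrightarrow> (\<forall>l<n. t l \<le> i \<longrightarrow> cinner (e l) x = 0)"
  by (auto simp: Ker_rel_def phi_coords le_less)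

lemma Indef_phi: "i < length A \<Longrightarrow> y \<in> Indef_rel (phi A ! i) \<longleftrightarrow> (\<forall>l<n. i \<le> t l \<longrightarrow> cinner (u l) y = 0)"
  by (auto simp: Indef_rel_def phi_coords le_less)

lemma phi_in_Hinge:
  assumes A: "A \<in> M_set"
  shows "phi A \<in> Hinge"
  unfolding Hinge_def mem_Collect_eq
proof (intro conjI allI impI)
  have len [simp]: "length (phi A) = length A" by (simp add: phi_def)
  have A0: "0 < length A" using A by (auto simp: M_set_def)
  then show ne: "phi A \<noteq> []" by (metis len length_greater_0_conv)
  show "csubspace (phi A ! j)" "cdim (phi A ! j) = cdim (UNIV :: 'v set)" if "j < length (phi A)" for j
    using cdim_phi[of j] that by (simp_all add: cdim_UNIV)
  fix j assume "Suc j < length (phi A)"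
  then have j: "Suc j < length A" by simp
  show "Ker_rel (phi A ! j) = Domain (phi A ! Suc j)"
    using j by (intro set_eqI) (simp add: Ker_phi Domain_phi less_Suc_eq_le)
  show "Range (phi A ! j) = Indef_rel (phi A ! Suc j)"
    using j by (intro set_eqI) (simp add: Range_phi Indef_phi Suc_le_eq)
next
  have A0: "0 < length A" using A by (auto simp: M_set_def)
  have len: "length (phi A) = length A" by (simp add: phi_def)
  have "hd (phi A) = phi A ! 0" "last (phi A) = phi A ! (length A - 1)"
    using A0 len by (metis hd_conv_nth length_greater_0_conv, metis last_conv_nth length_greater_0_conv)
  moreover have "\<not> length A - 1 < t l" if "l < n" for l using t_less[OF that] by simp
  ultimately show "Domain (hd (phi A)) = UNIV" "Range (last (phi A)) = UNIV"
    using A0 by (auto simp: Domain_phi Range_phi simp del: Domain_iff Range_iff)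
next
  fix j assume "j < length (phi A)"
  then have j: "j < length A" by (simp add: phi_def)
  \<comment> \<open>In a product of kernel and indeterminacy the domain equals the kernel; a vector
    not killed by \<open>A ! j\<close> separates the two.\<close>
  then have "A ! j \<noteq> 0" using A by (simp add: M_set_def)
  then obtain x where "(A ! j) x \<noteq> 0" by (auto simp: fun_eq_iff)
  then have x: "x \<in> dom_seq A j" "x \<notin> dom_seq A (Suc j)"
    using hom_spaceD(4)[OF hom[OF j]] by auto
  then have "x \<in> Domain (phi A ! j)" "x \<notin> Ker_rel (phi A ! j)"
    using j dom[of j x] dom[of "Suc j" x] by (auto simp: Domain_phi Ker_phi less_Suc_eq_le simp del: dom_seq.simps Domain_iff)
  then show "phi A ! j \<noteq> Ker_rel (phi A ! j) \<times> Indef_rel (phi A ! j)" by auto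
qed

end

lemma ex_adapted_MH:
  fixes A :: "('v::hermitian_space \<Rightarrow> 'v) list"
  assumes A: "A \<in> MH_set" and B: "\<exists>B :: 'v set. finite B \<and> cspan B = UNIV"
  obtains e t u where "adapted_MH e (cdim (UNIV :: 'v set)) A t u"
proof -
  from B obtain B :: "'v set" where B: "finite B" "cspan B = UNIV" by blast
  from A have AM: "A \<in> M_set" and ds: "is_direct_sum {..<length A} (im_seq A) UNIV"
    by (simp_all add: MH_set_def)
  obtain e n t where "adapted e n A t" by (rule ex_adapted[OF AM B])
  then interpret adapted e n A t .
  obtain u where "adapted_MH e n A t u" by (rule ex_dual[OF ds])
  then show thesis using that adapted_MH.cdim_UNIV by metis
qed

section \<open>Equivalence of hinges and change of representatives\<close>

lemma scale_rel_iff: "c \<noteq> 0 \<Longrightarrow> (x, y) \<in> scale_rel c P \<longleftrightarrow> (x, inverse c *\<^sub>C y) \<in> P"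
  unfolding scale_rel_def by (force simp: scaleC_scaleC scaleC_one)

lemma hinge_equiv_equiv: "equiv Hinge (hinge_equiv :: (('v::complex_vector) rel list \<times> 'v rel list) set)"
proof (rule equivI)
  show "hinge_equiv \<subseteq> Hinge \<times> (Hinge :: 'v rel list set)" by (auto simp: hinge_equiv_def)
  show "refl_on Hinge (hinge_equiv :: ('v rel list \<times> 'v rel list) set)"
    by (intro refl_onI) (auto simp: hinge_equiv_def scale_rel_iff scaleC_one intro!: exI[of _ "\<lambda>_. 1"])
  show "sym (hinge_equiv :: ('v rel list \<times> 'v rel list) set)"
  proof (rule symI)
    fix P Q :: "'v rel list" assume "(P, Q) \<in> hinge_equiv"
    then obtain c where c: "P \<in> Hinge" "Q \<in> Hinge" "length Q = length P"
      "\<forall>i<length P. c i \<noteq> 0 \<and> Q ! i = scale_rel (c i) (P ! i)"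
      by (auto simp: hinge_equiv_def)
    then have "\<forall>i<length Q. inverse (c i) \<noteq> 0 \<and> P ! i = scale_rel (inverse (c i)) (Q ! i)"
      by (auto simp: scale_rel_iff scaleC_scaleC scaleC_one)
    with c(1-3) show "(Q, P) \<in> hinge_equiv"
      by (auto simp: hinge_equiv_def intro!: exI[of _ "\<lambda>i. inverse (c i)"])
  qed
  show "trans (hinge_equiv :: ('v rel list \<times> 'v rel list) set)"
  proof (rule transI)
    fix P Q R :: "'v rel list" assume PQ: "(P, Q) \<in> hinge_equiv" and QR: "(Q, R) \<in> hinge_equiv"
    from PQ obtain c where c: "P \<in> Hinge" "length Q = length P"
      "\<forall>i<length P. c i \<noteq> 0 \<and> Q ! i = scale_rel (c i) (P ! i)"
      by (auto simp: hinge_equiv_def)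
    from QR obtain d where d: "R \<in> Hinge" "length R = length Q"
      "\<forall>i<length Q. d i \<noteq> 0 \<and> R ! i = scale_rel (d i) (Q ! i)"
      by (auto simp: hinge_equiv_def)
    have "\<forall>i<length P. d i * c i \<noteq> 0 \<and> R ! i = scale_rel (d i * c i) (P ! i)"
      using c d by (auto simp: scale_rel_iff scaleC_scaleC mult.commute)
    with c d show "(P, R) \<in> hinge_equiv"
      by (auto simp: hinge_equiv_def intro!: exI[of _ "\<lambda>i. d i * c i"])
  qed
qed

text \<open>The degree records how often each type occurs, so both products are \<open>f i\<close>
  to the power of the degree at \<open>i\<close>, multiplied over all \<open>i\<close>.\<close>

lemma degree_of_prod:
  fixes f :: "nat \<Rightarrow> 'b::comm_monoid_mult"
  assumes "degree_of s k = degree_of s' k"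
  shows "(\<Prod>a<k. f (s a)) = (\<Prod>a<k. f (s' a))"
proof -
  define T where "T = s ` {..<k} \<union> s' ` {..<k}"
  have *: "(\<Prod>a<k. f (r a)) = (\<Prod>i\<in>T. f i ^ degree_of r k i)" if "r ` {..<k} \<subseteq> T" for r
  proof -
    have "(\<Prod>a<k. f (r a)) = (\<Prod>i\<in>T. \<Prod>a | a \<in> {..<k} \<and> r a = i. f (r a))"
      using that by (intro prod.group[symmetric]) (auto simp: T_def)
    also have "\<dots> = (\<Prod>i\<in>T. f i ^ degree_of r k i)"
      unfolding degree_of_def by (intro prod.cong refl) simp
    finally show ?thesis .
  qed
  show ?thesis unfolding *[of s, unfolded T_def, simplified] *[of s', unfolded T_def, simplified] assms ..
qed

lemma length_phi [simp]: "length (phi A) = length A"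
  by (simp add: phi_def)

lemma proj_class_scale: "c \<noteq> 0 \<Longrightarrow> proj_class (c *\<^sub>C w) = proj_class w"
  unfolding proj_class_def
proof safe
  fix d :: complex assume "c \<noteq> 0" "d \<noteq> 0"
  then show "\<exists>e. d *\<^sub>C c *\<^sub>C w = e *\<^sub>C w \<and> e \<noteq> 0"
    by (intro exI[of _ "d * c"]) (simp add: scaleC_scaleC)
  show "\<exists>e. d *\<^sub>C w = e *\<^sub>C c *\<^sub>C w \<and> e \<noteq> 0"
    using \<open>c \<noteq> 0\<close> \<open>d \<noteq> 0\<close> by (intro exI[of _ "d / c"]) (simp add: scaleC_scaleC)
qed

lemma proj_class_eqD:
  assumes "proj_class w = proj_class w'"
  obtains c where "c \<noteq> 0" "w' = c *\<^sub>C w"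
proof -
  have "w' \<in> proj_class w'"
    unfolding proj_class_def by (auto simp: scaleC_one intro!: exI[of _ 1])
  then have "w' \<in> proj_class w" using assms by simp
  then show thesis using that unfolding proj_class_def by blast
qed

lemma proj_seq_eqD:
  assumes "proj_seq A = proj_seq B"
  obtains c where "length B = length A" "\<And>i. i < length A \<Longrightarrow> c i \<noteq> 0"
    "\<And>i. i < length A \<Longrightarrow> B ! i = c i *\<^sub>C A ! i"
proof -
  have len: "length B = length A"
    using assms unfolding proj_seq_def by (metis length_map)
  have "\<exists>c. c \<noteq> 0 \<and> B ! i = c *\<^sub>C A ! i" if "i < length A" for i
  proof -
    have "proj_class (A ! i) = proj_class (B ! i)"
      using that len assms unfolding proj_seq_def by (metis nth_map)
    then show ?thesis by (rule proj_class_eqD) blast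
  qed
  then have "\<forall>i. \<exists>c. i < length A \<longrightarrow> c \<noteq> 0 \<and> B ! i = c *\<^sub>C A ! i" by blast
  from choice[OF this] show thesis using that len by blast
qed

lemma dom_seq_proj_seq:
  assumes "proj_seq A = proj_seq B"
  shows "i \<le> length A \<Longrightarrow> dom_seq B i = dom_seq A i"
proof (induction i)
  case (Suc i)
  obtain c where "c i \<noteq> 0" "B ! i = c i *\<^sub>C A ! i"
    using proj_seq_eqD[OF assms] Suc.prems by (metis Suc_le_lessD)
  with Suc show ?case by (auto simp: scaleC_fun_def)
qed simp

lemma im_seq_proj_seq:
  assumes "proj_seq A = proj_seq B" "A \<in> M_set" "i < length A"
  shows "im_seq B i = im_seq A i"
proof -
  obtain c where c: "c i \<noteq> 0" "B ! i = c i *\<^sub>C A ! i"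
    using proj_seq_eqD[OF assms(1)] assms(3) by metis
  have hom: "A ! i \<in> hom_space (dom_seq A i) UNIV" using assms by (simp add: M_set_def)
  have sub: "csubspace (dom_seq A i)" using assms by (intro csubspace_dom_seq) auto
  have dom: "dom_seq B i = dom_seq A i" using assms by (intro dom_seq_proj_seq) auto
  show ?thesis
    unfolding im_seq_def dom
  proof safe
    fix x assume x: "x \<in> dom_seq A i"
    have "(B ! i) x = (A ! i) (c i *\<^sub>C x)"
      using hom_spaceD(3)[OF hom x] by (simp add: c scaleC_fun_def)
    moreover have "c i *\<^sub>C x \<in> dom_seq A i" using complex_vector.subspace_scale[OF sub x] .
    ultimately show "(B ! i) x \<in> (A ! i) ` dom_seq A i" by simp
    have "(A ! i) x = (B ! i) (inverse (c i) *\<^sub>C x)"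
      using hom_spaceD(3)[OF hom x, of "inverse (c i)"] c by (simp add: scaleC_fun_def scaleC_scaleC scaleC_one)
    moreover have "inverse (c i) *\<^sub>C x \<in> dom_seq A i" using complex_vector.subspace_scale[OF sub x] .
    ultimately show "(A ! i) x \<in> (B ! i) ` dom_seq A i" by simp
  qed
qed

lemma zero_in_im_sum:
  assumes A: "A \<in> M_set"
  shows "i \<le> length A \<Longrightarrow> 0 \<in> (\<Sum>k<i. im_seq A k)"
proof (induction i)
  case (Suc i)
  then have "A ! i \<in> hom_space (dom_seq A i) UNIV" using A by (simp add: M_set_def)
  moreover have sub: "csubspace (dom_seq A i)" using A Suc.prems by (intro csubspace_dom_seq) auto
  ultimately have "(A ! i) 0 = 0" by (rule hom_space_zero)
  then have "0 \<in> im_seq A i"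
    unfolding im_seq_def using complex_vector.subspace_0[OF sub] by (metis imageI)
  with Suc set_plus_intro[of 0 "\<Sum>k<i. im_seq A k" 0 "im_seq A i"] show ?case by simp
qed simp

text \<open>Rescaling \<open>A_i\<close> by \<open>c i\<close> changes neither kernels nor images,
  so it rescales the graph part of the relation only; the indeterminacy is a subspace and absorbs
  the factor \<open>c i\<close>.\<close>

lemma phi_proj_seq:
  fixes A B :: "('v::hermitian_space \<Rightarrow> 'v) list"
  assumes fin: "\<exists>B :: 'v set. finite B \<and> cspan B = UNIV"
    and eq: "proj_seq A = proj_seq B" and A: "A \<in> MH_set" and B: "B \<in> MH_set"
  shows "(phi A, phi B) \<in> hinge_equiv"
proof -
  obtain e t u where "adapted_MH e (cdim (UNIV :: 'v set)) A t u"
    using ex_adapted_MH[OF A fin] .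
  then interpret adapted_MH e "cdim (UNIV :: 'v set)" A t u .
  obtain e' t' u' where B': "adapted_MH e' (cdim (UNIV :: 'v set)) B t' u'"
    using ex_adapted_MH[OF B fin] .
  have M: "A \<in> M_set" "B \<in> M_set" using A B by (simp_all add: MH_set_def)
  obtain c where len: "length B = length A" and c: "\<And>i. i < length A \<Longrightarrow> c i \<noteq> 0"
    "\<And>i. i < length A \<Longrightarrow> B ! i = c i *\<^sub>C A ! i" using proj_seq_eqD[OF eq] by metis
  have "phi B ! i = scale_rel (c i) (phi A ! i)" if i: "i < length A" for i
  proof -
    have W: "(\<Sum>k<i. im_seq B k) = (\<Sum>k<i. im_seq A k)"
      using im_seq_proj_seq[OF eq M(1)] i by (intro sum.cong) auto
    have W_scale: "d *\<^sub>C w \<in> (\<Sum>k<i. im_seq A k)" if "w \<in> (\<Sum>k<i. im_seq A k)" for d w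
      using that i by (simp add: im_sum_coords cinner_scaleC_right)
    have "(x, y) \<in> phi B ! i \<longleftrightarrow> (x, inverse (c i) *\<^sub>C y) \<in> phi A ! i" for x y
    proof -
      have "(x, y) \<in> phi B ! i
          \<longleftrightarrow> (\<exists>w. x \<in> dom_seq A i \<and> w \<in> (\<Sum>k<i. im_seq A k) \<and> y = c i *\<^sub>C (A ! i) x + w)"
        using i len dom_seq_proj_seq[OF eq, of i]
        by (simp add: phi_nth_iff W c scaleC_fun_def)
      also have "\<dots> \<longleftrightarrow> (\<exists>w. x \<in> dom_seq A i \<and> w \<in> (\<Sum>k<i. im_seq A k)
          \<and> inverse (c i) *\<^sub>C y = (A ! i) x + w)" (is "?L \<longleftrightarrow> ?R")
      proof
        assume ?L
        then obtain w where w: "x \<in> dom_seq A i" "w \<in> (\<Sum>k<i. im_seq A k)" "y = c i *\<^sub>C (A ! i) x + w"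
          by blast
        then show ?R
          using c(1)[OF i] W_scale[OF w(2)]
          by (intro exI[of _ "inverse (c i) *\<^sub>C w"]) (simp add: scaleC_add_right scaleC_scaleC scaleC_one)
      next
        assume ?R
        then obtain w where w: "x \<in> dom_seq A i" "w \<in> (\<Sum>k<i. im_seq A k)"
            "inverse (c i) *\<^sub>C y = (A ! i) x + w" by blast
        have "y = c i *\<^sub>C inverse (c i) *\<^sub>C y"
          using c(1)[OF i] by (simp add: scaleC_scaleC scaleC_one)
        then have "y = c i *\<^sub>C (A ! i) x + c i *\<^sub>C w"
          unfolding w(3) scaleC_add_right .
        with w W_scale[OF w(2)] show ?L by blast
      qed
      also have "\<dots> \<longleftrightarrow> (x, inverse (c i) *\<^sub>C y) \<in> phi A ! i"
        using i by (simp add: phi_nth_iff)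
      finally show ?thesis .
    qed
    then show ?thesis using c(1)[OF i] by (auto simp: scale_rel_iff)
  qed
  with c len show ?thesis
    using phi_in_Hinge[OF M(1)] adapted_MH.phi_in_Hinge[OF B' M(2)]
    unfolding hinge_equiv_def by (auto simp: length_phi intro!: exI[of _ c])
qed

context adapted
begin

text \<open>Equal degrees provide some \<open>b < k\<close> of the same type as \<open>L a\<close>.
  By monotonicity all basis vectors of the smaller type \<open>t j\<close> have index below
  \<open>k\<close>, so the degree at \<open>t j\<close> counts all of them, and the injective
  \<open>L\<close> hits each.\<close>

lemma top_degree_exhausts:
  assumes L: "L \<in> PiE {..<k} (\<lambda>_. {..<n})" "inj_on L {..<k}" "degree_of (t \<circ> L) k = degree_of t k"
    and k: "k \<le> n" and a: "a < k" and j: "j < n" "t j < t (L a)"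
  shows "j \<in> L ` {..<k}"
proof -
  have "degree_of (t \<circ> L) k (t (L a)) \<noteq> 0"
    using a by (auto simp: degree_of_def card_eq_0_iff)
  then have "degree_of t k (t (L a)) \<noteq> 0" using L(3) by simp
  then obtain b where b: "b < k" "t b = t (L a)"
    unfolding degree_of_def by (metis (mono_tags, lifting) card.empty empty_Collect_eq)
  have "l < k" if "l < n" "t l = t j" for l
  proof (rule ccontr)
    assume "\<not> l < k"
    then have "t b \<le> t l" using b that by (intro t_mono) auto
    then show False using b j that by simp
  qed
  then have eq: "{l. l < k \<and> t l = t j} = {l. l < n \<and> t l = t j}" using k by auto
  have "L ` {l. l < k \<and> (t \<circ> L) l = t j} = {l. l < n \<and> t l = t j}"
  proof (rule card_subset_eq)
    show "L ` {l. l < k \<and> (t \<circ> L) l = t j} \<subseteq> {l. l < n \<and> t l = t j}" using L(1) by auto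
    have "inj_on L {l. l < k \<and> (t \<circ> L) l = t j}" using L(2) by (rule inj_on_subset) auto
    then have "card (L ` {l. l < k \<and> (t \<circ> L) l = t j}) = degree_of (t \<circ> L) k (t j)"
      unfolding degree_of_def by (rule card_image)
    also have "\<dots> = card {l. l < n \<and> t l = t j}"
      unfolding L(3) degree_of_def eq ..
    finally show "card (L ` {l. l < k \<and> (t \<circ> L) l = t j}) = card {l. l < n \<and> t l = t j}" .
  qed simp
  then have "j \<in> L ` {l. l < k \<and> (t \<circ> L) l = t j}" using j by blast
  then show ?thesis by auto
qed

lemma wedge_not_inj: "\<not> inj_on L {..<k} \<Longrightarrow> wedge k (v \<circ> L) = 0"
  using wedge_repeat[of _ k _ "v \<circ> L"] by (auto simp: inj_on_def)

end

lemma oper_scale: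
  assumes "\<And>L. L \<in> PiE {..<k} (\<lambda>_. {..<n}) \<Longrightarrow> W' L = c *\<^sub>C W L"
  shows "oper k e n W' = c *\<^sub>C oper k e n W"
proof
  fix w
  have "(\<Sum>L\<in>PiE {..<k} (\<lambda>_. {..<n}). w (e \<circ> L) *\<^sub>C W' L)
    = c *\<^sub>C (\<Sum>L\<in>PiE {..<k} (\<lambda>_. {..<n}). w (e \<circ> L) *\<^sub>C W L)"
    unfolding complex_vector.scale_sum_right
    using assms by (intro sum.cong refl) (simp add: scaleC_scaleC mult.commute)
  moreover have "(c *\<^sub>C T) w = c *\<^sub>C T w" for T :: "'a ext_end"
    by (simp only: scaleC_fun_def)
  ultimately show "oper k e n W' w = (c *\<^sub>C oper k e n W) w"
    by (simp add: oper_def scaleC_scaleC mult.commute)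
qed

context adapted_MH
begin

text \<open>The flag consists of the domains of the relations, which scaling leaves alone; so
  \<open>e\<close> and \<open>t\<close> are adapted to \<open>B\<close> too, and both operators are
  written in the same basis. The products of scalars agree for all multi-indices of top degree by
  \<open>degree_of_prod\<close>, leaving one common factor.\<close>

lemma ext_seq_hinge_equiv:
  assumes M: "A \<in> M_set" "B \<in> M_set" and eq: "(phi A, phi B) \<in> hinge_equiv"
    and k: "1 \<le> k" "k \<le> n"
  shows "proj_class (ext_seq k B) = proj_class (ext_seq k A)"
proof -
  have len: "length B = length A"
    using eq by (auto simp: hinge_equiv_def length_phi)
  obtain c where c: "\<And>i. i < length A \<Longrightarrow> c i \<noteq> 0"
      "\<And>i. i < length A \<Longrightarrow> phi B ! i = scale_rel (c i) (phi A ! i)"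
    using eq by (auto simp: hinge_equiv_def length_phi)
  have Dom: "Domain (phi A ! i) = dom_seq A i" if "i < length A" for i
    using that by (intro set_eqI) (simp add: Domain_phi dom)
  have "dom_seq B i = dom_seq A i" if "i \<le> length A" for i
  \<comment> \<open>The last member of the flag is not the domain of a relation; it is zero for both
    sequences.\<close>
  proof (cases "i = length A")
    case True
    then show ?thesis using M len by (simp add: M_set_def)
  next
    case False
    with that have i: "i < length A" by simp
    have "x \<in> dom_seq B i \<longleftrightarrow> x \<in> Domain (phi B ! i)" for x
    proof
      assume "x \<in> dom_seq B i"
      moreover have "0 \<in> (\<Sum>k<i. im_seq B k)"
        using M i len by (intro zero_in_im_sum) auto
      ultimately have "(x, (B ! i) x) \<in> phi B ! i"
        using i len by (subst phi_nth_iff) auto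
      then show "x \<in> Domain (phi B ! i)" by blast
    next
      assume "x \<in> Domain (phi B ! i)"
      then show "x \<in> dom_seq B i" using i len by (auto simp: phi_nth_iff)
    qed
    moreover have "Domain (phi B ! i) = Domain (phi A ! i)"
      unfolding c(2)[OF i] by (force simp: scale_rel_def)
    ultimately show ?thesis using Dom[OF i] by blast
  qed
  with M have "adapted e n B t"
    by unfold_locales (simp_all add: t_mono t_less len dom M_set_def)
  then interpret B: adapted e n B t .
  define y where "y l = inverse (c (t l)) *\<^sub>C B.h l" for l
  have y: "(e l, y l) \<in> phi A ! t l" if l: "l < n" for l
  proof -
    have "(e l, B.h l) \<in> phi B ! t l"
    proof -
      have "0 \<in> (\<Sum>k<t l. im_seq B k)"
        using M t_less[OF l] len by (intro zero_in_im_sum) auto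
      then show ?thesis
        using l t_less[OF l] len B.e_in_dom[OF l, of "t l"]
        by (subst phi_nth_iff) (auto simp: B.h_def)
    qed
    then show ?thesis
      using c(1)[OF t_less[OF l]] unfolding c(2)[OF t_less[OF l]] y_def by (simp add: scale_rel_iff)
  qed
  have Bh: "B.h l = c (t l) *\<^sub>C y l" if "l < n" for l
    using c(1)[OF t_less[OF that]] by (simp add: y_def scaleC_scaleC scaleC_one)
  \<comment> \<open>Both \<open>y l\<close> and \<open>h l\<close> are related to \<open>e l\<close>
    under \<open>phi A ! t l\<close>, so they differ by an element of its indeterminacy.\<close>
  have diff: "y l - h l \<in> cspan (h ` {j. j < n \<and> t j < t l})" if l: "l < n" for l
  proof -
    have "y l - h l = (\<Sum>j | j < n \<and> t j < t l. cinner (u j) (y l) *\<^sub>C h j)"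
    proof (rule h_coord_eqI)
      fix j assume j: "j < n"
      show "cinner (u j) (y l - h l) = cinner (u j) (\<Sum>j | j < n \<and> t j < t l. cinner (u j) (y l) *\<^sub>C h j)"
        unfolding h_comb_coord'[OF j]
        using y[OF l] j l unfolding phi_coords[OF t_less[OF l]]
        by (auto simp: cinner_diff_right dual orth not_less le_less)
    qed
    also have "\<dots> \<in> cspan (h ` {j. j < n \<and> t j < t l})"
      by (intro complex_vector.span_sum complex_vector.span_scale complex_vector.span_base) auto
    finally show ?thesis .
  qed
  let ?c = "\<Prod>a<k. c (t a)"
  have "?c \<noteq> 0" using c(1) t_less k by simp
  moreover have "B.ext_op k = ?c *\<^sub>C ext_op k"
    unfolding B.ext_op_def ext_op_def
  proof (rule oper_scale)
    fix L assume L: "L \<in> PiE {..<k} (\<lambda>_. {..<n})"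
    then have Ln: "L a < n" if "a < k" for a using that by auto
    show "(if degree_of (t \<circ> L) k = degree_of t k then wedge k (B.h \<circ> L) else 0)
      = ?c *\<^sub>C (if degree_of (t \<circ> L) k = degree_of t k then wedge k (h \<circ> L) else 0)"
    proof (cases "degree_of (t \<circ> L) k = degree_of t k \<and> inj_on L {..<k}")
      case True
      have "wedge k (B.h \<circ> L) = (\<Prod>a<k. c (t (L a))) *\<^sub>C wedge k (y \<circ> L)"
        using Bh Ln by (intro wedge_scale) simp
      also have "(\<Prod>a<k. c (t (L a))) = ?c"
        using degree_of_prod[of "t \<circ> L" k t c] True by simp
      also have "wedge k (y \<circ> L) = wedge k (h \<circ> L)"
      proof (rule wedge_triangular[where r = "t \<circ> L"])
        fix a assume a: "a < k"
        have "h ` {j. j < n \<and> t j < t (L a)} \<subseteq> (h \<circ> L) ` {b. b < k \<and> (t \<circ> L) b < (t \<circ> L) a}"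
          using top_degree_exhausts[OF L _ _ k(2) a] True by fastforce
        from complex_vector.span_mono[OF this]
        show "(y \<circ> L) a - (h \<circ> L) a \<in> cspan ((h \<circ> L) ` {b. b < k \<and> (t \<circ> L) b < (t \<circ> L) a})"
          using diff[OF Ln[OF a]] by auto
      qed
      finally show ?thesis using True by (simp add: comp_def)
    next
      case False
      then show ?thesis by (auto simp: wedge_not_inj)
    qed
  qed
  ultimately show ?thesis
    unfolding B.ext_seq_eq[OF k] ext_seq_eq[OF k] by (simp add: proj_class_scale)
qed

end

section \<open>The topology of the space of sequences\<close>

lemma openin_proj_topology:
  "openin (proj_topology W) S \<longleftrightarrow> S \<subseteq> proj_space W \<and>
    openin (top_of_set (W - {0})) {w \<in> W - {0}. proj_class w \<in> S}"
  unfolding proj_topology_def topology_inverse'[OF istopology_proj_topology] ..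

lemma topspace_proj_topology [simp]: "topspace (proj_topology W) = proj_space W"
proof
  show "topspace (proj_topology W) \<subseteq> proj_space W"
    unfolding topspace_def openin_proj_topology by auto
  have "{w \<in> W - {0}. proj_class w \<in> proj_space W} = W - {0}" by (auto simp: proj_space_def)
  then have "openin (proj_topology W) (proj_space W)" by (simp add: openin_proj_topology)
  then show "proj_space W \<subseteq> topspace (proj_topology W)" by (rule openin_subset)
qed

text \<open>Representatives of a class differ by a nonzero scalar, so a scale-invariant condition
  \<open>Q\<close> on vectors is a condition on classes; its solutions form the preimage of
  \<open>S\<close>.\<close>

lemma openin_proj_topologyI:
  assumes Q: "\<And>c w. c \<noteq> 0 \<Longrightarrow> w \<in> W - {0} \<Longrightarrow> Q w \<Longrightarrow> Q (c *\<^sub>C w)"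
    and T: "open T" "\<And>w. w \<in> W - {0} \<Longrightarrow> Q w \<longleftrightarrow> w \<in> T"
  defines "S \<equiv> proj_class ` {w \<in> W - {0}. Q w}"
  shows "openin (proj_topology W) S" and "w \<in> W - {0} \<Longrightarrow> proj_class w \<in> S \<longleftrightarrow> Q w"
proof -
  show S: "proj_class w \<in> S \<longleftrightarrow> Q w" if "w \<in> W - {0}" for w
  proof
    assume "proj_class w \<in> S"
    then obtain w' where w': "w' \<in> W - {0}" "Q w'" "proj_class w' = proj_class w"
      unfolding S_def by auto
    from w'(3) obtain c where "c \<noteq> 0" "w = c *\<^sub>C w'" by (rule proj_class_eqD)
    with Q w' show "Q w" by blast
  qed (use that in \<open>auto simp: S_def\<close>)
  have "{w \<in> W - {0}. proj_class w \<in> S} = (W - {0}) \<inter> T"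
    using S T(2) by blast
  moreover have "S \<subseteq> proj_space W" by (auto simp: S_def proj_space_def)
  ultimately show "openin (proj_topology W) S"
    using T(1) by (simp add: openin_proj_topology openin_open_Int)
qed

lemma restr_hom_space:
  assumes f: "f \<in> hom_space U' W" and U: "csubspace U" "U \<subseteq> U'"
  shows "restr f U \<in> hom_space U W"
proof -
  have "x + y \<in> U" "c *\<^sub>C x \<in> U" if "x \<in> U" "y \<in> U" for x y c
    using complex_vector.subspace_add complex_vector.subspace_scale U(1) that by blast+
  then show ?thesis
    using hom_spaceD(1-3)[OF f] U(2) by (auto simp: hom_space_def restr_def subset_iff)
qed

lemma restr_scale: "restr (c *\<^sub>C f) U = c *\<^sub>C restr f U"
  by (rule ext) (simp add: restr_def scaleC_fun_def)

lemma restr_restr: "U \<subseteq> U' \<Longrightarrow> restr (restr f U') U = restr f U"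
  by (auto simp: restr_def fun_eq_iff)

lemma restr_hom_space_self: "f \<in> hom_space U W \<Longrightarrow> restr f U = f"
  by (auto simp: restr_def hom_space_def)

lemma continuous_on_restr: "continuous_on UNIV (\<lambda>f. restr f U :: 'a \<Rightarrow> 'b::{topological_space, zero})"
proof (rule continuous_on_coordinatewise_then_product)
  show "continuous_on UNIV (\<lambda>f :: 'a \<Rightarrow> 'b. restr f U x)" for x
    by (cases "x \<in> U") (simp_all add: restr_def)
qed

text \<open>The definition asks the condition of some representative. Scaling the maps changes
  neither the domains nor the classes of the restrictions, so any representative may be
  tested.\<close>

lemma PM_nbhd_iff:
  assumes B: "B \<in> M_set"
  shows "proj_seq B \<in> PM_nbhd A U \<longleftrightarrow> (\<forall>i<length A. \<exists>j<length B. dom_seq A i \<subseteq> dom_seq B j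
    \<and> restr (B ! j) (dom_seq A i) \<noteq> 0 \<and> proj_class (restr (B ! j) (dom_seq A i)) \<in> U i)"
proof
  assume "proj_seq B \<in> PM_nbhd A U"
  then obtain B' where eq: "proj_seq B' = proj_seq B" and B': "B' \<in> M_set"
    and cond: "\<forall>i<length A. \<exists>j<length B'. dom_seq A i \<subseteq> dom_seq B' j
      \<and> restr (B' ! j) (dom_seq A i) \<noteq> 0 \<and> proj_class (restr (B' ! j) (dom_seq A i)) \<in> U i"
    unfolding PM_nbhd_def by auto
  obtain c where c: "length B = length B'" "\<And>j. j < length B' \<Longrightarrow> c j \<noteq> 0"
    "\<And>j. j < length B' \<Longrightarrow> B ! j = c j *\<^sub>C B' ! j" by (rule proj_seq_eqD[OF eq]) blast
  show "\<forall>i<length A. \<exists>j<length B. dom_seq A i \<subseteq> dom_seq B j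
    \<and> restr (B ! j) (dom_seq A i) \<noteq> 0 \<and> proj_class (restr (B ! j) (dom_seq A i)) \<in> U i"
  proof (intro allI impI)
    fix i assume "i < length A"
    with cond obtain j where j: "j < length B'" "dom_seq A i \<subseteq> dom_seq B' j"
      "restr (B' ! j) (dom_seq A i) \<noteq> 0" "proj_class (restr (B' ! j) (dom_seq A i)) \<in> U i" by blast
    then show "\<exists>j<length B. dom_seq A i \<subseteq> dom_seq B j
      \<and> restr (B ! j) (dom_seq A i) \<noteq> 0 \<and> proj_class (restr (B ! j) (dom_seq A i)) \<in> U i"
      using c(1) c(2,3)[OF j(1)] dom_seq_proj_seq[OF eq, of j]
      by (intro exI[of _ j]) (simp add: restr_scale proj_class_scale)
  qed
qed (use B in \<open>auto simp: PM_nbhd_def\<close>)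

lemma openin_PM_topology:
  "openin PM_topology S \<longleftrightarrow> S \<subseteq> PM \<and>
    (\<forall>A\<in>M_set. proj_seq A \<in> S \<longrightarrow>
      (\<exists>U. (\<forall>i<length A. openin (proj_topology (hom_space (dom_seq A i) UNIV)) (U i)
              \<and> proj_class (A ! i) \<in> U i) \<and> PM_nbhd A U \<subseteq> S))"
  unfolding PM_topology_def topology_inverse'[OF istopology_PM_topology] ..

text \<open>Around a point \<open>B\<close> of the set, the condition on a map defined on
  \<open>V(B)_(J i)\<close> is put on its restriction to \<open>V(A)_i\<close>. Restricting from a
  larger space in two steps is the same as restricting at once, so closeness to \<open>B\<close>
  passes on to the original condition.\<close>

lemma openin_PM_nbhd:
  fixes A :: "('v::hermitian_space \<Rightarrow> 'v) list"
  assumes A: "A \<in> M_set"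
    and U: "\<And>i. i < length A \<Longrightarrow> openin (proj_topology (hom_space (dom_seq A i) UNIV)) (U i)"
  shows "openin PM_topology (PM_nbhd A U)"
  unfolding openin_PM_topology
proof (intro conjI ballI impI)
  show "PM_nbhd A U \<subseteq> PM" by (auto simp: PM_nbhd_def PM_def)
  fix B :: "('v \<Rightarrow> 'v) list" assume B: "B \<in> M_set" "proj_seq B \<in> PM_nbhd A U"
  let ?H = "\<lambda>i. hom_space (dom_seq A i) (UNIV :: 'v set)"
  let ?HB = "\<lambda>j. hom_space (dom_seq B j) (UNIV :: 'v set)"
  from B have "\<forall>i. \<exists>j. i < length A \<longrightarrow> j < length B \<and> dom_seq A i \<subseteq> dom_seq B j
    \<and> restr (B ! j) (dom_seq A i) \<noteq> 0 \<and> proj_class (restr (B ! j) (dom_seq A i)) \<in> U i"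
    unfolding PM_nbhd_iff[OF B(1)] by blast
  from choice[OF this] obtain J where J: "\<And>i. i < length A \<Longrightarrow> J i < length B \<and> dom_seq A i \<subseteq> dom_seq B (J i)
    \<and> restr (B ! J i) (dom_seq A i) \<noteq> 0 \<and> proj_class (restr (B ! J i) (dom_seq A i)) \<in> U i" by blast
  have "\<exists>T. open T \<and> {w \<in> ?H i - {0}. proj_class w \<in> U i} = (?H i - {0}) \<inter> T" if "i < length A" for i
    using U[OF that] unfolding openin_proj_topology openin_open by auto
  then have "\<forall>i. \<exists>T. i < length A \<longrightarrow> open T \<and> {w \<in> ?H i - {0}. proj_class w \<in> U i} = (?H i - {0}) \<inter> T"
    by blast
  from choice[OF this] obtain T where T: "\<And>i. i < length A \<Longrightarrow> open (T i)"
    "\<And>i. i < length A \<Longrightarrow> {w \<in> ?H i - {0}. proj_class w \<in> U i} = (?H i - {0}) \<inter> T i" by blast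
  define R where "R i w = restr w (dom_seq A i)" for i and w :: "'v \<Rightarrow> 'v"
  \<comment> \<open>Several \<open>i\<close> may share the same \<open>J i\<close>, so all their
    conditions are imposed on the map with index \<open>j\<close>. Nonvanishing is one of them,
    because a restriction of a nonzero map can be zero.\<close>
  define Q where "Q j w \<longleftrightarrow> (\<forall>i<length A. J i = j \<longrightarrow> R i w \<noteq> 0 \<and> proj_class (R i w) \<in> U i)" for j w
  define U' where "U' j = proj_class ` {w \<in> ?HB j - {0}. Q j w}" for j
  have RH: "R i w \<in> ?H i" if "i < length A" "w \<in> ?HB (J i)" for i w
    unfolding R_def using that(1) J[OF that(1)] A
    by (intro restr_hom_space[OF that(2)] csubspace_dom_seq) auto
  have ne: "{w :: 'v \<Rightarrow> 'v. w \<noteq> 0} = (\<Union>x. {w. w x \<noteq> 0})" by (auto simp: fun_eq_iff)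
  have "open {w :: 'v \<Rightarrow> 'v. w x \<noteq> 0}" for x
    by (intro open_Collect_neq continuous_on_product_coordinates continuous_on_const)
  then have open_ne: "open {w :: 'v \<Rightarrow> 'v. w \<noteq> 0}" unfolding ne by blast
  define T' where "T' j = (\<Inter>i\<in>{i. i < length A \<and> J i = j}. R i -` (T i \<inter> {w. w \<noteq> 0}))" for j
  have cont: "continuous_on UNIV (R i)" for i
    unfolding R_def[abs_def] by (rule continuous_on_restr)
  have open_T': "open (T' j)" for j
    unfolding T'_def by (intro open_INT ballI open_vimage[OF _ cont] open_Int open_ne T(1)) auto
  have Q_scale: "Q j (c *\<^sub>C w)" if "c \<noteq> 0" "Q j w" for c j w
    using that by (auto simp: Q_def R_def restr_scale proj_class_scale)
  have Q_T': "Q j w \<longleftrightarrow> w \<in> T' j" if "w \<in> ?HB j - {0}" for j w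
  proof -
    have "(R i w \<noteq> 0 \<and> proj_class (R i w) \<in> U i) \<longleftrightarrow> R i w \<in> T i \<inter> {w. w \<noteq> 0}"
      if "i < length A" "J i = j" for i
      using T(2)[OF that(1)] RH[OF that(1), of w] that \<open>w \<in> ?HB j - {0}\<close> by blast
    then show ?thesis unfolding Q_def T'_def by auto
  qed
  have U': "openin (proj_topology (?HB j)) (U' j)"
    "w \<in> ?HB j - {0} \<Longrightarrow> proj_class w \<in> U' j \<longleftrightarrow> Q j w" for j w
    unfolding U'_def
    by (rule openin_proj_topologyI[OF Q_scale open_T' Q_T'], assumption+)+
  show "\<exists>U'. (\<forall>j<length B. openin (proj_topology (?HB j)) (U' j) \<and> proj_class (B ! j) \<in> U' j)
    \<and> PM_nbhd B U' \<subseteq> PM_nbhd A U"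
  proof (intro exI[of _ U'] conjI allI impI U'(1))
    fix j assume j: "j < length B"
    then have "B ! j \<in> ?HB j - {0}" using B(1) by (auto simp: M_set_def)
    moreover have "Q j (B ! j)" using J by (auto simp: Q_def R_def)
    ultimately show "proj_class (B ! j) \<in> U' j" using U'(2) by blast
  next
    show "PM_nbhd B U' \<subseteq> PM_nbhd A U"
    proof
      fix p assume p: "p \<in> PM_nbhd B U'"
      then obtain C where C: "C \<in> M_set" "p = proj_seq C" unfolding PM_nbhd_def by blast
      show "p \<in> PM_nbhd A U"
        unfolding C(2) PM_nbhd_iff[OF C(1)]
      proof (intro allI impI)
        fix i assume i: "i < length A"
        from p J[OF i] obtain l where l: "l < length C" "dom_seq B (J i) \<subseteq> dom_seq C l"
          "restr (C ! l) (dom_seq B (J i)) \<noteq> 0"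
          "proj_class (restr (C ! l) (dom_seq B (J i))) \<in> U' (J i)"
          unfolding C(2) PM_nbhd_iff[OF C(1)] by blast
        have "C ! l \<in> hom_space (dom_seq C l) UNIV" using C l by (simp add: M_set_def)
        then have "restr (C ! l) (dom_seq B (J i)) \<in> ?HB (J i) - {0}"
          using l B(1) J[OF i] by (auto intro!: restr_hom_space csubspace_dom_seq)
        with l(4) U'(2) have "Q (J i) (restr (C ! l) (dom_seq B (J i)))" by blast
        with i have "R i (restr (C ! l) (dom_seq B (J i))) \<noteq> 0
          \<and> proj_class (R i (restr (C ! l) (dom_seq B (J i)))) \<in> U i" unfolding Q_def by blast
        moreover have "R i (restr (C ! l) (dom_seq B (J i))) = restr (C ! l) (dom_seq A i)"
          unfolding R_def using J[OF i] by (intro restr_restr) blast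
        ultimately show "\<exists>j<length C. dom_seq A i \<subseteq> dom_seq C j
          \<and> restr (C ! j) (dom_seq A i) \<noteq> 0 \<and> proj_class (restr (C ! j) (dom_seq A i)) \<in> U i"
          using l J[OF i] by auto
      qed
    qed
  qed
qed

text \<open>Basic sets of \<open>PM\<close> are open, so their traces on \<open>PMH\<close> are open
  neighbourhoods, and openness can be tested on elements \<open>B\<close> of \<open>MH_set\<close>
  only.\<close>

lemma openin_PMH_topologyI:
  fixes S :: "('v::hermitian_space \<Rightarrow> 'v) set list set"
  assumes S: "S \<subseteq> PMH"
    and nbhd: "\<And>A. A \<in> MH_set \<Longrightarrow> proj_seq A \<in> S \<Longrightarrow>
      \<exists>U. (\<forall>i<length A. openin (proj_topology (hom_space (dom_seq A i) UNIV)) (U i)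
        \<and> proj_class (A ! i) \<in> U i) \<and> (\<forall>B\<in>MH_set. proj_seq B \<in> PM_nbhd A U \<longrightarrow> proj_seq B \<in> S)"
  shows "openin PMH_topology S"
proof (subst openin_subopen, intro ballI)
  fix p assume p: "p \<in> S"
  with S obtain A where A: "A \<in> MH_set" "p = proj_seq A" by (auto simp: PMH_def)
  then have M: "A \<in> M_set" by (simp add: MH_set_def)
  from nbhd[OF A(1)] p A(2) obtain U where
    U: "\<And>i. i < length A \<Longrightarrow> openin (proj_topology (hom_space (dom_seq A i) UNIV)) (U i)"
    "\<And>i. i < length A \<Longrightarrow> proj_class (A ! i) \<in> U i"
    and sub: "\<And>B. B \<in> MH_set \<Longrightarrow> proj_seq B \<in> PM_nbhd A U \<Longrightarrow> proj_seq B \<in> S" by blast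
  have "openin PMH_topology (PM_nbhd A U \<inter> PMH)"
    unfolding PMH_topology_def by (rule openin_subtopology_Int[OF openin_PM_nbhd[OF M U(1)]])
  moreover have "p \<in> PM_nbhd A U \<inter> PMH"
  proof
    show "p \<in> PMH" using p S by blast
    show "p \<in> PM_nbhd A U"
      unfolding A(2) PM_nbhd_iff[OF M]
    proof (intro allI impI)
      fix i assume i: "i < length A"
      then have Ai: "A ! i \<in> hom_space (dom_seq A i) UNIV" "A ! i \<noteq> 0" using M by (simp_all add: M_set_def)
      with i U(2)[OF i] show "\<exists>j<length A. dom_seq A i \<subseteq> dom_seq A j
        \<and> restr (A ! j) (dom_seq A i) \<noteq> 0 \<and> proj_class (restr (A ! j) (dom_seq A i)) \<in> U i"
        by (intro exI[of _ i]) (simp add: restr_hom_space_self[OF Ai(1)])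
    qed
  qed
  moreover have "PM_nbhd A U \<inter> PMH \<subseteq> S"
    using sub by (auto simp: PMH_def)
  ultimately show "\<exists>T. openin PMH_topology T \<and> p \<in> T \<and> T \<subseteq> S" by blast
qed

lemma topspace_PMH_topology:
  "topspace (PMH_topology :: ('v::{complex_vector, topological_space} \<Rightarrow> 'v) set list topology) = PMH"
proof -
  have "openin PM_topology (PM :: ('v \<Rightarrow> 'v) set list set)"
    unfolding openin_PM_topology
  proof (intro conjI ballI impI)
    fix A :: "('v \<Rightarrow> 'v) list"
    assume A: "A \<in> M_set"
    let ?U = "\<lambda>i. proj_space (hom_space (dom_seq A i) (UNIV :: 'v set))"
    have "openin (proj_topology (hom_space (dom_seq A i) UNIV)) (?U i)" for i
      using openin_topspace[of "proj_topology (hom_space (dom_seq A i) UNIV)"] by simp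
    moreover have "proj_class (A ! i) \<in> ?U i" if "i < length A" for i
      using A that by (auto simp: M_set_def proj_space_def)
    moreover have "PM_nbhd A ?U \<subseteq> PM" by (auto simp: PM_nbhd_def PM_def)
    ultimately show "\<exists>U. (\<forall>i<length A. openin (proj_topology (hom_space (dom_seq A i) UNIV)) (U i)
      \<and> proj_class (A ! i) \<in> U i) \<and> PM_nbhd A U \<subseteq> PM" by (intro exI[of _ ?U]) blast
  qed simp
  then have "(PM :: ('v \<Rightarrow> 'v) set list set) \<subseteq> topspace PM_topology" by (rule openin_subset)
  moreover have "PMH \<subseteq> (PM :: ('v \<Rightarrow> 'v) set list set)" by (auto simp: PMH_def PM_def MH_set_def)
  ultimately show ?thesis by (auto simp: PMH_topology_def)
qed

section \<open>Continuity of the exterior powers\<close>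

lemma tendsto_fun:
  fixes f :: "'i \<Rightarrow> 'a \<Rightarrow> 'b::topological_space"
  assumes "\<And>x. ((\<lambda>i. f i x) \<longlongrightarrow> l x) F"
  shows "(f \<longlongrightarrow> l) F"
proof -
  have "limitin (product_topology (\<lambda>_. euclidean) UNIV) f l F"
    unfolding limitin_componentwise using assms by simp
  then show ?thesis by (simp add: euclidean_product_topology)
qed

lemma tendsto_cinner [tendsto_intros]:
  "(f \<longlongrightarrow> l) F \<Longrightarrow> ((\<lambda>x. cinner u (f x :: 'v::hermitian_space)) \<longlongrightarrow> cinner u l) F"
  unfolding cinner_eq_inner Complex_eq by (intro tendsto_intros)

lemma tendsto_wedge:
  assumes "\<And>i. i < k \<Longrightarrow> ((\<lambda>x. v x i) \<longlongrightarrow> w i) F"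
  shows "((\<lambda>x. wedge k (v x) u) \<longlongrightarrow> wedge k w u) F"
  unfolding wedge_transposed using assms by (intro tendsto_intros) auto

lemma tendsto_oper:
  assumes "\<And>L u. L \<in> PiE {..<k} (\<lambda>_. {..<n}) \<Longrightarrow> ((\<lambda>x. W x L u) \<longlongrightarrow> W' L u) F"
  shows "((\<lambda>x. oper k e n (W x)) \<longlongrightarrow> oper k e n W') F"
proof (rule tendsto_fun, rule tendsto_fun)
  fix w u
  show "((\<lambda>x. oper k e n (W x) w u) \<longlongrightarrow> oper k e n W' w u) F"
  proof (cases "w \<in> ext_power k")
    case True
    then show ?thesis unfolding oper_apply[OF True] using assms by (intro tendsto_intros)
  next
    case False
    then show ?thesis by (simp add: oper_def)
  qed
qed

text \<open>The degree at \<open>i\<close> is read off as an exponent: give the factor 2 to entries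
  that \<open>J\<close> maps to \<open>i\<close> and 1 to the others, and apply
  \<open>degree_of_prod\<close>.\<close>

lemma degree_of_comp:
  assumes "degree_of r k = degree_of r' k"
  shows "degree_of (J \<circ> r) k = degree_of (J \<circ> r') k"
proof
  fix i
  have *: "(\<Prod>a<k. if J (q a) = i then 2 else 1) = (2 :: nat) ^ degree_of (J \<circ> q) k i" for q
  proof -
    have "(\<Prod>a<k. if J (q a) = i then 2 else 1) = (\<Prod>a | a < k \<and> J (q a) = i. 2 :: nat)"
      by (intro prod.mono_neutral_cong_right) auto
    then show ?thesis by (simp add: degree_of_def)
  qed
  have "(2 :: nat) ^ degree_of (J \<circ> r) k i = 2 ^ degree_of (J \<circ> r') k i"
    using degree_of_prod[OF assms, of "\<lambda>l. if J l = i then 2 else 1 :: nat"] unfolding * .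
  then show "degree_of (J \<circ> r) k i = degree_of (J \<circ> r') k i" by simp
qed

text \<open>The quotient is a product over pairs \<open>(l, l')\<close> with \<open>l < k \<le> l'\<close> that exchanges the indices
  missing from the image of \<open>L\<close> with those beyond \<open>k\<close>; the hypothesis on \<open>s\<close> forces \<open>s l = s l'\<close> for all
  of them, and the one on \<open>t\<close> yields a pair with \<open>t l < t l'\<close>.\<close>

lemma multiindex_ratio:
  fixes c :: "nat \<Rightarrow> complex" and t :: "nat \<Rightarrow> nat" and J :: "nat \<Rightarrow> nat"
  assumes L: "L \<in> PiE {..<k} (\<lambda>_. {..<n})" "inj_on L {..<k}" and k: "k \<le> n"
    and t_mono: "\<And>i j. i \<le> j \<Longrightarrow> j < n \<Longrightarrow> t i \<le> t j"
    and J_mono: "\<And>i j. i \<le> j \<Longrightarrow> j < n \<Longrightarrow> J (t i) \<le> J (t j)"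
    and deg_s: "degree_of (J \<circ> t \<circ> L) k = degree_of (J \<circ> t) k"
    and deg_t: "degree_of (t \<circ> L) k \<noteq> degree_of t k"
    and c: "\<And>l. l < n \<Longrightarrow> c (t l) \<noteq> 0"
    and decay: "\<And>l l'. l < n \<Longrightarrow> l' < n \<Longrightarrow> t l < t l' \<Longrightarrow> J (t l) = J (t l') \<Longrightarrow>
      cmod (c (t l')) \<le> \<eta> * cmod (c (t l))"
    and \<eta>: "0 \<le> \<eta>" "\<eta> \<le> 1"
  shows "cmod ((\<Prod>a<k. c (t (L a))) / (\<Prod>a<k. c (t a))) \<le> \<eta>"
proof -
  define K where "K = L ` {..<k}"
  define X where "X = K - {..<k}"
  define Y where "Y = {..<k} - K"
  have fin: "finite K" "finite X" "finite Y" by (simp_all add: K_def X_def Y_def)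
  have Kn: "K \<subseteq> {..<n}" using L(1) by (auto simp: K_def)
  have K_split: "K = (K \<inter> {..<k}) \<union> X" "(K \<inter> {..<k}) \<inter> X = {}" by (auto simp: X_def)
  have k_split: "{..<k} = (K \<inter> {..<k}) \<union> Y" "(K \<inter> {..<k}) \<inter> Y = {}" by (auto simp: Y_def)
  have cardK: "card K = k" unfolding K_def using card_image[OF L(2)] by simp
  have "card K = card (K \<inter> {..<k}) + card X"
    by (subst K_split(1), rule card_Un_disjoint) (use fin K_split(2) in auto)
  moreover have "card {..<k} = card (K \<inter> {..<k}) + card Y"
    by (subst k_split(1), rule card_Un_disjoint) (use fin k_split(2) in auto)
  ultimately have "card Y = card X" using cardK by simp
  then obtain \<sigma> where \<sigma>: "bij_betw \<sigma> Y X"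
    using finite_same_card_bij fin by blast
  have deg: "degree_of (r \<circ> L) k i = degree_of r k i \<longleftrightarrow> card {l \<in> X. r l = i} = card {l \<in> Y. r l = i}"
    for r :: "nat \<Rightarrow> nat" and i
  proof -
    have "degree_of (r \<circ> L) k i = card (L ` {a. a < k \<and> r (L a) = i})"
      unfolding degree_of_def o_apply
      by (intro card_image[symmetric] inj_on_subset[OF L(2)]) auto
    also have "L ` {a. a < k \<and> r (L a) = i} = {l \<in> K \<inter> {..<k}. r l = i} \<union> {l \<in> X. r l = i}"
      by (auto simp: K_def X_def)
    also have "card \<dots> = card {l \<in> K \<inter> {..<k}. r l = i} + card {l \<in> X. r l = i}"
      using fin K_split(2) by (intro card_Un_disjoint) auto
    finally have 1: "degree_of (r \<circ> L) k i = card {l \<in> K \<inter> {..<k}. r l = i} + card {l \<in> X. r l = i}" .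
    have "{l. l < k \<and> r l = i} = {l \<in> K \<inter> {..<k}. r l = i} \<union> {l \<in> Y. r l = i}"
      by (auto simp: Y_def)
    then have "degree_of r k i = card ({l \<in> K \<inter> {..<k}. r l = i} \<union> {l \<in> Y. r l = i})"
      unfolding degree_of_def by simp
    also have "\<dots> = card {l \<in> K \<inter> {..<k}. r l = i} + card {l \<in> Y. r l = i}"
      using fin k_split(2) by (intro card_Un_disjoint) auto
    finally show ?thesis using 1 by simp
  qed
  have XY_s: "card {l \<in> X. J (t l) = i} = card {l \<in> Y. J (t l) = i}" for i
    using deg[of "J \<circ> t" i] deg_s by simp
  \<comment> \<open>Indices in \<open>Y\<close> lie below \<open>k\<close>, those in
    \<open>X\<close> do not, so \<open>J (t (k - 1))\<close> separates the values on
    \<open>Y\<close> from those on \<open>X\<close>. As both sets take the same values, all of them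
    are equal.\<close>
  have s_eq: "J (t x) = J (t y)" if x: "x \<in> X" and y: "y \<in> Y" for x y
  proof -
    have "{l \<in> X. J (t l) = J (t x)} \<noteq> {}" using x by blast
    then have "card {l \<in> Y. J (t l) = J (t x)} \<noteq> 0"
      unfolding XY_s[symmetric] using fin by simp
    then obtain y' where y': "y' \<in> Y" "J (t y') = J (t x)" by (metis (mono_tags, lifting) card.empty empty_Collect_eq)
    have "{l \<in> Y. J (t l) = J (t y)} \<noteq> {}" using y by blast
    then have "card {l \<in> X. J (t l) = J (t y)} \<noteq> 0"
      unfolding XY_s using fin by simp
    then obtain x' where x': "x' \<in> X" "J (t x') = J (t y)" by (metis (mono_tags, lifting) card.empty empty_Collect_eq)
    have less: "q < k" "k \<le> p" "p < n" if "p \<in> X" "q \<in> Y" for p q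
      using that Kn by (auto simp: X_def Y_def)
    have "J (t y') \<le> J (t (k - 1))" "J (t y) \<le> J (t (k - 1))"
      using less[OF x y'(1)] less[OF x y] k by (auto intro!: J_mono)
    moreover have "J (t (k - 1)) \<le> J (t x)" "J (t (k - 1)) \<le> J (t x')"
      using less[OF x y] less[OF x'(1) y] by (auto intro!: J_mono)
    ultimately show ?thesis using y' x' by simp
  qed
  have pair: "\<sigma> y \<in> X" "y < n" "\<sigma> y < n" "t y \<le> t (\<sigma> y)" if y: "y \<in> Y" for y
  proof -
    show x: "\<sigma> y \<in> X" using \<sigma> y by (auto simp: bij_betw_def)
    then show "\<sigma> y < n" using Kn by (auto simp: X_def)
    then show "t y \<le> t (\<sigma> y)" "y < n"
      using x y k by (auto simp: X_def Y_def intro!: t_mono)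
  qed
  have ratio: "cmod (c (t (\<sigma> y)) / c (t y)) \<le> (if t (\<sigma> y) = t y then 1 else \<eta>)" if y: "y \<in> Y" for y
  proof (cases "t (\<sigma> y) = t y")
    case False
    then have "cmod (c (t (\<sigma> y))) \<le> \<eta> * cmod (c (t y))"
      using pair[OF y] s_eq[OF pair(1)[OF y] y] by (intro decay) auto
    then show ?thesis
      using False c[OF pair(2)[OF y]] by (simp add: norm_divide divide_le_eq)
  qed simp
  \<comment> \<open>If \<open>\<sigma>\<close> preserved every type, \<open>X\<close> and
    \<open>Y\<close> would contain each type equally often, and \<open>L\<close> would have the
    degree of \<open>t\<close>.\<close>
  have "\<exists>y\<in>Y. t (\<sigma> y) \<noteq> t y"
  proof (rule ccontr)
    assume "\<not> ?thesis"
    then have eq: "\<And>y. y \<in> Y \<Longrightarrow> t (\<sigma> y) = t y" by blast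
    have "bij_betw \<sigma> {l \<in> Y. t l = i} {l \<in> X. t l = i}" for i
    proof (rule bij_betw_subset[OF \<sigma>])
      show "\<sigma> ` {l \<in> Y. t l = i} = {l \<in> X. t l = i}"
        using \<sigma> eq by (force simp: bij_betw_def)
    qed auto
    then have "card {l \<in> X. t l = i} = card {l \<in> Y. t l = i}" for i
      by (metis bij_betw_same_card)
    then have "degree_of (t \<circ> L) k i = degree_of t k i" for i using deg by blast
    then show False using deg_t by blast
  qed
  then obtain y0 where y0: "y0 \<in> Y" "t (\<sigma> y0) \<noteq> t y0" by blast
  have "(\<Prod>a<k. c (t (L a))) = (\<Prod>l\<in>K. c (t l))"
    unfolding K_def using prod.reindex[OF L(2), of "\<lambda>l. c (t l)"] by simp
  also have "\<dots> = (\<Prod>l\<in>K \<inter> {..<k}. c (t l)) * (\<Prod>l\<in>X. c (t l))"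
    by (subst K_split(1), rule prod.union_disjoint) (use fin K_split(2) in auto)
  also have "(\<Prod>l\<in>X. c (t l)) = (\<Prod>y\<in>Y. c (t (\<sigma> y)))"
    using prod.reindex_bij_betw[OF \<sigma>, of "\<lambda>l. c (t l)"] by simp
  finally have num: "(\<Prod>a<k. c (t (L a))) = (\<Prod>l\<in>K \<inter> {..<k}. c (t l)) * (\<Prod>y\<in>Y. c (t (\<sigma> y)))" .
  have den: "(\<Prod>a<k. c (t a)) = (\<Prod>l\<in>K \<inter> {..<k}. c (t l)) * (\<Prod>y\<in>Y. c (t y))"
    by (subst k_split(1), rule prod.union_disjoint) (use fin k_split(2) in auto)
  have "(\<Prod>l\<in>K \<inter> {..<k}. c (t l)) \<noteq> 0" using c k fin by auto
  then have "(\<Prod>a<k. c (t (L a))) / (\<Prod>a<k. c (t a)) = (\<Prod>y\<in>Y. c (t (\<sigma> y)) / c (t y))"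
    unfolding num den by (simp add: prod_dividef)
  then have "cmod ((\<Prod>a<k. c (t (L a))) / (\<Prod>a<k. c (t a))) = (\<Prod>y\<in>Y. cmod (c (t (\<sigma> y)) / c (t y)))"
    by (simp only: prod_norm)
  also have "\<dots> = cmod (c (t (\<sigma> y0)) / c (t y0)) * (\<Prod>y\<in>Y - {y0}. cmod (c (t (\<sigma> y)) / c (t y)))"
    using fin(3) y0(1) by (rule prod.remove)
  \<comment> \<open>The pair at \<open>y0\<close> changes type and gives \<open>\<eta>\<close>; each
    other factor is at most 1.\<close>
  also have "\<dots> \<le> \<eta> * 1"
  proof (intro mult_mono prod_le_1)
    show "cmod (c (t (\<sigma> y0)) / c (t y0)) \<le> \<eta>" using ratio[OF y0(1)] y0(2) by simp
    fix y assume "y \<in> Y - {y0}"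
    then have "cmod (c (t (\<sigma> y)) / c (t y)) \<le> (if t (\<sigma> y) = t y then 1 else \<eta>)" by (intro ratio) simp
    then show "0 \<le> cmod (c (t (\<sigma> y)) / c (t y)) \<and> cmod (c (t (\<sigma> y)) / c (t y)) \<le> 1"
      using \<eta> by (auto split: if_splits)
  qed (use \<eta> in \<open>auto intro!: prod_nonneg\<close>)
  finally show ?thesis by simp
qed

context onb
begin

text \<open>Scalar coefficients and vectors are separate parameters: the operator of
  \<open>A\<close> and the normalised operator of a nearby \<open>B\<close> are both of this form in
  the same basis, with nearby parameters.\<close>

definition weighted :: "nat \<Rightarrow> ((nat \<Rightarrow> nat) \<Rightarrow> complex) \<Rightarrow> (nat \<Rightarrow> 'v) \<Rightarrow> 'v ext_end"
  where "weighted k \<rho> f = oper k e n (\<lambda>L. \<rho> L *\<^sub>C wedge k (f \<circ> L))"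

text \<open>Counterexamples for the tolerances \<open>1 / Suc m\<close> would give parameters
  converging to \<open>\<rho>\<close> and \<open>f\<close>, hence operators converging pointwise to
  a point of \<open>S\<close> while staying outside \<open>S\<close>.\<close>

lemma weighted_open:
  assumes S: "open S" "weighted k \<rho> f \<in> S"
  obtains \<epsilon> where "0 < \<epsilon>" "\<And>\<rho>' f'. (\<And>L. L \<in> PiE {..<k} (\<lambda>_. {..<n}) \<Longrightarrow> cmod (\<rho>' L - \<rho> L) < \<epsilon>)
    \<Longrightarrow> (\<And>l. l < n \<Longrightarrow> norm (f' l - f l) < \<epsilon>) \<Longrightarrow> weighted k \<rho>' f' \<in> S"
proof (rule ccontr)
  assume "\<not> thesis"
  let ?near = "\<lambda>\<epsilon> \<rho>' f'. (\<forall>L\<in>PiE {..<k} (\<lambda>_. {..<n}). cmod (\<rho>' L - \<rho> L) < \<epsilon>)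
    \<and> (\<forall>l<n. norm (f' l - f l) < \<epsilon>)"
  have "\<exists>p. ?near (1 / Suc m) (fst p) (snd p) \<and> weighted k (fst p) (snd p) \<notin> S" for m
  proof (rule ccontr)
    assume "\<nexists>p. ?near (1 / Suc m) (fst p) (snd p) \<and> weighted k (fst p) (snd p) \<notin> S"
    then have "?near (1 / Suc m) \<rho>' f' \<Longrightarrow> weighted k \<rho>' f' \<in> S" for \<rho>' f' by auto
    then have thesis by (intro that[of "1 / Suc m"]) auto
    with \<open>\<not> thesis\<close> show False ..
  qed
  then have "\<forall>m. \<exists>p. ?near (1 / Suc m) (fst p) (snd p) \<and> weighted k (fst p) (snd p) \<notin> S" by blast
  from choice[OF this] obtain p where p: "\<And>m. ?near (1 / Suc m) (fst (p m)) (snd (p m))"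
    "\<And>m. weighted k (fst (p m)) (snd (p m)) \<notin> S" by blast
  have lim0: "(\<lambda>m. 1 / real (Suc m)) \<longlonglongrightarrow> 0" using LIMSEQ_inverse_real_of_nat by (simp add: inverse_eq_divide)
  have lim_f: "(\<lambda>m. snd (p m) l) \<longlonglongrightarrow> f l" if l: "l < n" for l
  proof (rule LIM_zero_cancel, rule tendsto_norm_zero_cancel, rule tendsto_sandwich[OF _ _ tendsto_const lim0])
    show "\<forall>\<^sub>F m in sequentially. norm (snd (p m) l - f l) \<le> 1 / real (Suc m)"
      using p(1) l by (intro always_eventually allI less_imp_le) blast
  qed simp
  have lim_\<rho>: "(\<lambda>m. fst (p m) L) \<longlonglongrightarrow> \<rho> L" if L: "L \<in> PiE {..<k} (\<lambda>_. {..<n})" for L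
  proof (rule LIM_zero_cancel, rule tendsto_norm_zero_cancel, rule tendsto_sandwich[OF _ _ tendsto_const lim0])
    show "\<forall>\<^sub>F m in sequentially. cmod (fst (p m) L - \<rho> L) \<le> 1 / real (Suc m)"
      using p(1) L by (intro always_eventually allI less_imp_le) blast
  qed simp
  have "(\<lambda>m. weighted k (fst (p m)) (snd (p m))) \<longlonglongrightarrow> weighted k \<rho> f"
    unfolding weighted_def
  proof (rule tendsto_oper)
    fix L and u :: "nat \<Rightarrow> 'v" assume L: "L \<in> PiE {..<k} (\<lambda>_. {..<n})"
    have "(\<lambda>m. wedge k (snd (p m) \<circ> L) u) \<longlonglongrightarrow> wedge k (f \<circ> L) u"
      using L lim_f by (intro tendsto_wedge) auto
    from tendsto_mult[OF lim_\<rho>[OF L] this]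
    show "(\<lambda>m. (fst (p m) L *\<^sub>C wedge k (snd (p m) \<circ> L)) u) \<longlonglongrightarrow> (\<rho> L *\<^sub>C wedge k (f \<circ> L)) u"
      by (simp add: scaleC_fun_def scaleC_complex_def)
  qed
  then have "\<forall>\<^sub>F m in sequentially. weighted k (fst (p m)) (snd (p m)) \<in> S"
    using S by (rule topological_tendstoD)
  then show False using p(2) by simp
qed

end

context adapted
begin

text \<open>Non-injective multi-indices give zero wedges, so their coefficient can be set to 0. This
  fits \<open>multiindex_ratio\<close>, which bounds coefficients for injective
  \<open>L\<close>.\<close>

lemma ext_op_weighted:
  "ext_op k = weighted k (\<lambda>L. if inj_on L {..<k} \<and> degree_of (t \<circ> L) k = degree_of t k then 1 else 0) h"
proof -
  have "ext_op k = 1 *\<^sub>C weighted k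
    (\<lambda>L. if inj_on L {..<k} \<and> degree_of (t \<circ> L) k = degree_of t k then 1 else 0) h"
    unfolding ext_op_def weighted_def by (rule oper_scale) (auto simp: wedge_not_inj scaleC_one)
  then show ?thesis by (simp only: scaleC_one)
qed

end

context adapted_MH
begin

lemma h_lower_bound: obtains \<mu> where "0 < \<mu>" "\<And>l. l < n \<Longrightarrow> \<mu> \<le> norm (h l)"
proof
  \<comment> \<open>The element 1 keeps the set nonempty when \<open>n = 0\<close>.\<close>
  let ?M = "insert 1 ((\<lambda>l. norm (h l)) ` {..<n})"
  have "h l \<noteq> 0" if "l < n" for l using dual[OF that that] by auto
  then show "0 < Min ?M" by (subst Min_gr_iff) auto
  show "Min ?M \<le> norm (h l)" if "l < n" for l using that by (intro Min_le) auto
qed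

text \<open>In a relation among the \<open>f l\<close>, pair with the dual vector \<open>u i\<close>
  at a coefficient \<open>c i\<close> of greatest modulus. The \<open>h l\<close> contribute exactly
  \<open>c i\<close>, and the errors are too small to cancel it.\<close>

lemma lin_indep_near:
  obtains \<delta> where "0 < \<delta>" "\<And>f. (\<And>l. l < n \<Longrightarrow> norm (f l - h l) < \<delta>) \<Longrightarrow> lin_indep n f"
proof -
  define C where "C = 1 + (\<Sum>i<n. norm (u i))"
  \<comment> \<open>Chosen so that \<open>n\<close> errors of size at most
    \<open>2 * C * \<delta>\<close> add up to \<open>n / (n + 1) < 1\<close>; the factor 2 is that
    of \<open>cmod_cinner_le\<close>.\<close>
  define \<delta> where "\<delta> = 1 / (2 * C * (n + 1))"
  have C: "1 \<le> C" by (simp add: C_def sum_nonneg)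
  have uC: "norm (u i) \<le> C" if "i < n" for i
  proof -
    have "norm (u i) \<le> (\<Sum>i<n. norm (u i))" using that by (intro member_le_sum) auto
    then show ?thesis by (simp add: C_def)
  qed
  have \<delta>: "0 < \<delta>" using C by (simp add: \<delta>_def)
  show thesis
  proof (rule that[OF \<delta>])
    fix f assume near: "\<And>l. l < n \<Longrightarrow> norm (f l - h l) < \<delta>"
    show "lin_indep n f"
      unfolding lin_indep_def
    proof (intro allI impI)
      fix c l assume 0: "(\<Sum>l<n. c l *\<^sub>C f l) = 0" and l: "l < n"
      have "Max ((\<lambda>l. cmod (c l)) ` {..<n}) \<in> (\<lambda>l. cmod (c l)) ` {..<n}"
        using l by (intro Max_in) auto
      then obtain i where i: "i < n" "Max ((\<lambda>l. cmod (c l)) ` {..<n}) = cmod (c i)" by auto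
      have max: "cmod (c j) \<le> cmod (c i)" if "j < n" for j
        unfolding i(2)[symmetric] using that by (intro Max_ge) auto
      have "0 = cinner (u i) (\<Sum>j<n. c j *\<^sub>C h j + c j *\<^sub>C (f j - h j))"
        unfolding scaleC_add_right[symmetric] using 0 by simp
      also have "\<dots> = c i + (\<Sum>j<n. c j * cinner (u i) (f j - h j))"
        unfolding sum.distrib cinner_add_right h_comb_coord[OF i(1)]
        by (simp add: cinner_sum_right cinner_scaleC_right)
      finally have "c i = - (\<Sum>j<n. c j * cinner (u i) (f j - h j))" by (simp add: eq_neg_iff_add_eq_0)
      then have "cmod (c i) = cmod (\<Sum>j<n. c j * cinner (u i) (f j - h j))" by (metis norm_minus_cancel)
      also have "\<dots> \<le> (\<Sum>j<n. cmod (c i) * (2 * C * \<delta>))"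
      proof (rule order_trans[OF norm_sum], rule sum_mono)
        fix j assume "j \<in> {..<n}"
        then have j: "j < n" by simp
        have "cmod (cinner (u i) (f j - h j)) \<le> 2 * norm (u i) * norm (f j - h j)"
          by (rule cmod_cinner_le)
        also have "\<dots> \<le> 2 * C * \<delta>"
          using uC[OF i(1)] near[OF j] C by (intro mult_mono) auto
        finally show "cmod (c j * cinner (u i) (f j - h j)) \<le> cmod (c i) * (2 * C * \<delta>)"
          unfolding norm_mult using max[OF j] by (intro mult_mono) auto
      qed
      also have "\<dots> = cmod (c i) * (n / (n + 1))"
        using C by (simp add: \<delta>_def)
      finally have le: "cmod (c i) * 1 \<le> cmod (c i) * (n / (n + 1))" by simp
      have "cmod (c i) = 0"
      proof (rule ccontr)
        assume "cmod (c i) \<noteq> 0"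
        then have "0 < cmod (c i)" by simp
        with le have "1 \<le> real n / (n + 1)" by (simp only: mult_le_cancel_left_pos)
        then show False by (simp add: field_simps)
      qed
      with max[OF l] show "c l = 0" by simp
    qed
  qed
qed

text \<open>The element \<open>B\<close> is close to \<open>A\<close>; the index \<open>J i\<close> and the scalar \<open>c i\<close> are those for which the
  restriction of \<open>B\<^bsub>J i\<^esub>\<close> to \<open>V(A)\<^sub>i\<close> is close to \<open>c i\<close> times \<open>A\<^sub>i\<close>. Since the images of the \<open>A\<^sub>i\<close> are
  independent, the flag of \<open>B\<close> has to be coarser than that of \<open>A\<close>.\<close>

lemma adapted_near:
  assumes B: "B \<in> M_set"
    and J: "\<And>i. i < length A \<Longrightarrow> J i < length B" "\<And>i. i < length A \<Longrightarrow> dom_seq A i \<subseteq> dom_seq B (J i)"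
    and nz: "\<And>i. i < length A \<Longrightarrow> \<exists>x\<in>dom_seq A i. (B ! J i) x \<noteq> 0"
    and ind: "lin_indep n (\<lambda>l. (B ! J (t l)) (e l))"
  shows "adapted e n B (J \<circ> t)"
proof -
  have eJ: "e l \<in> dom_seq B (J (t l))" if l: "l < n" for l
    using J(2)[OF t_less[OF l]] e_in_dom[OF l, of "t l"] by blast
  have flag: "j \<le> length B \<Longrightarrow> x \<in> dom_seq B j \<longleftrightarrow> (\<forall>l<n. J (t l) < j \<longrightarrow> cinner (e l) x = 0)" for j x
  proof (induction j arbitrary: x)
    case (Suc j)
    then have j: "j < length B" by simp
    note IH = Suc.IH[OF less_imp_le[OF j]]
    have hom: "B ! j \<in> hom_space (dom_seq B j) UNIV" using B j by (simp add: M_set_def)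
    have sub: "csubspace (dom_seq B j)" using B j by (intro csubspace_dom_seq) auto
    \<comment> \<open>A basis vector with \<open>J (t l) > j\<close> lies in
      \<open>V(B)_(j+1)\<close> and is killed by \<open>B ! j\<close>. The remaining images belong
      to the independent family, so \<open>B ! j\<close> vanishes at \<open>x\<close> only if the
      coordinates with \<open>J (t l) = j\<close> do.\<close>
    have expand: "(B ! j) x = (\<Sum>l<n. (if J (t l) = j then cinner (e l) x else 0) *\<^sub>C (B ! J (t l)) (e l))"
      if x: "x \<in> dom_seq B j" for x
    proof -
      have c0: "cinner (e l) x = 0" if "l < n" "J (t l) < j" for l using x that unfolding IH by blast
      have "x = (\<Sum>l<n. cinner (e l) x *\<^sub>C e l)" by (simp only: complete)
      also have "\<dots> = (\<Sum>l | l < n \<and> j \<le> J (t l). cinner (e l) x *\<^sub>C e l)"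
        by (intro sum.mono_neutral_right) (auto simp: c0 not_le)
      finally have "(B ! j) x = (B ! j) (\<Sum>l | l < n \<and> j \<le> J (t l). cinner (e l) x *\<^sub>C e l)" by simp
      also have "\<dots> = (\<Sum>l | l < n \<and> j \<le> J (t l). cinner (e l) x *\<^sub>C (B ! j) (e l))"
      proof (rule hom_space_sum[OF hom sub])
        fix l assume "l \<in> {l. l < n \<and> j \<le> J (t l)}"
        then show "e l \<in> dom_seq B j" using eJ[of l] dom_seq_antimono[of j "J (t l)" B] by auto
      qed
      also have "\<dots> = (\<Sum>l<n. (if J (t l) = j then cinner (e l) x else 0) *\<^sub>C (B ! J (t l)) (e l))"
      proof (rule sum.mono_neutral_cong_left)
        fix l assume l: "l \<in> {l. l < n \<and> j \<le> J (t l)}"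
        show "cinner (e l) x *\<^sub>C (B ! j) (e l)
          = (if J (t l) = j then cinner (e l) x else 0) *\<^sub>C (B ! J (t l)) (e l)"
        proof (cases "J (t l) = j")
          case False
          then have "e l \<in> dom_seq B (Suc j)"
            using l eJ[of l] dom_seq_antimono[of "Suc j" "J (t l)" B] by auto
          then show ?thesis using False by simp
        qed simp
      qed auto
      finally show ?thesis .
    qed
    have "x \<in> dom_seq B (Suc j) \<longleftrightarrow> x \<in> dom_seq B j \<and> (B ! j) x = 0" by simp
    also have "\<dots> \<longleftrightarrow> x \<in> dom_seq B j \<and> (\<forall>l<n. J (t l) = j \<longrightarrow> cinner (e l) x = 0)"
    proof (rule conj_cong[OF refl])
      assume x: "x \<in> dom_seq B j"
      show "(B ! j) x = 0 \<longleftrightarrow> (\<forall>l<n. J (t l) = j \<longrightarrow> cinner (e l) x = 0)"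
      proof
        assume "(B ! j) x = 0"
        then show "\<forall>l<n. J (t l) = j \<longrightarrow> cinner (e l) x = 0"
          using lin_indepD[OF ind, of "\<lambda>l. if J (t l) = j then cinner (e l) x else 0"]
          unfolding expand[OF x] by (metis (mono_tags, lifting))
      next
        assume "\<forall>l<n. J (t l) = j \<longrightarrow> cinner (e l) x = 0"
        then show "(B ! j) x = 0" unfolding expand[OF x] by (intro sum.neutral) auto
      qed
    qed
    also have "\<dots> \<longleftrightarrow> (\<forall>l<n. J (t l) < Suc j \<longrightarrow> cinner (e l) x = 0)"
      unfolding IH less_Suc_eq by blast
    finally show ?case .
  qed simp
  show ?thesis
  proof
    fix i j assume ij: "i \<le> j" "j < n"
    show "(J \<circ> t) i \<le> (J \<circ> t) j"
    proof (rule ccontr)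
      assume "\<not> ?thesis"
      \<comment> \<open>If \<open>J\<close> reversed the order, \<open>V(A)_(t j)\<close> would lie
        in the kernel of \<open>B ! J (t j)\<close>, against the nonvanishing of that
        restriction.\<close>
      then have less: "Suc (J (t j)) \<le> J (t i)" by simp
      have "dom_seq A (t j) \<subseteq> dom_seq A (t i)" using t_mono[OF ij] by (rule dom_seq_antimono)
      also have "\<dots> \<subseteq> dom_seq B (J (t i))" using ij t_less by (intro J(2)) auto
      also have "\<dots> \<subseteq> dom_seq B (Suc (J (t j)))" using less by (rule dom_seq_antimono)
      finally show False using nz[OF t_less[OF ij(2)]] by auto
    qed
  next
    fix l assume "l < n"
    then show "(J \<circ> t) l < length B" using t_less J(1) by simp
  next
    fix i assume "i < length B"
    then show "B ! i \<in> hom_space (dom_seq B i) UNIV" using B by (simp add: M_set_def)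
  qed (use flag in simp)
qed

lemma ext_seq_near:
  assumes k: "1 \<le> k" "k \<le> n" and S: "open S" "ext_seq k A \<in> S"
  obtains \<delta> where "0 < \<delta>" "\<And>B J c. B \<in> MH_set \<Longrightarrow>
      (\<And>i. i < length A \<Longrightarrow> J i < length B \<and> dom_seq A i \<subseteq> dom_seq B (J i)
        \<and> (\<exists>x\<in>dom_seq A i. (B ! J i) x \<noteq> 0) \<and> c i \<noteq> 0
        \<and> (\<forall>l<n. i \<le> t l \<longrightarrow> norm (inverse (c i) *\<^sub>C (B ! J i) (e l) - (A ! i) (e l)) < \<delta>))
    \<Longrightarrow> \<exists>w. w \<noteq> 0 \<and> ext_seq k B \<noteq> 0 \<and> ext_seq k B \<in> End_ext k \<and> inverse w *\<^sub>C ext_seq k B \<in> S"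
proof -
  define \<rho> where "\<rho> L = (if inj_on L {..<k} \<and> degree_of (t \<circ> L) k = degree_of t k then 1 else 0 :: complex)" for L
  have "weighted k \<rho> h \<in> S"
    using S(2) unfolding ext_seq_eq[OF k] ext_op_weighted \<rho>_def .
  then obtain \<epsilon> where \<epsilon>: "0 < \<epsilon>"
    "\<And>\<rho>' f'. (\<And>L. L \<in> PiE {..<k} (\<lambda>_. {..<n}) \<Longrightarrow> cmod (\<rho>' L - \<rho> L) < \<epsilon>)
      \<Longrightarrow> (\<And>l. l < n \<Longrightarrow> norm (f' l - h l) < \<epsilon>) \<Longrightarrow> weighted k \<rho>' f' \<in> S"
    using weighted_open[OF S(1)] by metis
  obtain \<mu> where \<mu>: "0 < \<mu>" "\<And>l. l < n \<Longrightarrow> \<mu> \<le> norm (h l)" by (rule h_lower_bound) blast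
  obtain \<delta>0 where \<delta>0: "0 < \<delta>0" "\<And>f. (\<And>l. l < n \<Longrightarrow> norm (f l - h l) < \<delta>0) \<Longrightarrow> lin_indep n f"
    by (rule lin_indep_near) blast
  \<comment> \<open>\<open>\<eta>\<close> bounds the unwanted coefficients: at most 1 for
    \<open>multiindex_ratio\<close> and strictly below \<open>\<epsilon>\<close>. The bound
    \<open>\<eta> * \<mu> / 2\<close> on \<open>\<delta>\<close> is what turns closeness of the maps
    into the ratio \<open>\<eta>\<close> of scalars, since the vectors \<open>f l\<close> have norm
    at least \<open>\<mu> / 2\<close>.\<close>
  define \<eta> where "\<eta> = min 1 (\<epsilon> / 2)"
  define \<delta> where "\<delta> = min (min \<epsilon> \<delta>0) (\<eta> * \<mu> / 2)"
  have \<eta>: "0 < \<eta>" "\<eta> \<le> 1" "\<eta> < \<epsilon>" using \<epsilon>(1) by (auto simp: \<eta>_def)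
  have \<delta>: "0 < \<delta>" "\<delta> \<le> \<epsilon>" "\<delta> \<le> \<delta>0" "\<delta> \<le> \<eta> * \<mu> / 2"
    using \<epsilon>(1) \<delta>0(1) \<mu>(1) \<eta>(1) by (auto simp: \<delta>_def)
  show thesis
  proof (rule that[OF \<delta>(1)])
    fix B J c
    assume BMH: "B \<in> MH_set"
      and near: "\<And>i. i < length A \<Longrightarrow> J i < length B \<and> dom_seq A i \<subseteq> dom_seq B (J i)
        \<and> (\<exists>x\<in>dom_seq A i. (B ! J i) x \<noteq> 0) \<and> c i \<noteq> 0
        \<and> (\<forall>l<n. i \<le> t l \<longrightarrow> norm (inverse (c i) *\<^sub>C (B ! J i) (e l) - (A ! i) (e l)) < \<delta>)"
    have B: "B \<in> M_set" and ds: "is_direct_sum {..<length B} (im_seq B) UNIV"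
      using BMH by (simp_all add: MH_set_def)
    define f where "f l = inverse (c (t l)) *\<^sub>C (B ! J (t l)) (e l)" for l
    have c: "c (t l) \<noteq> 0" if "l < n" for l using near[OF t_less[OF that]] by blast
    have f_near: "norm (f l - h l) < \<delta>" if "l < n" for l
      using near[OF t_less[OF that]] that unfolding f_def h_def by blast
    have Bf: "(B ! J (t l)) (e l) = c (t l) *\<^sub>C f l" if "l < n" for l
      using c[OF that] by (simp add: f_def scaleC_scaleC scaleC_one)
    have indf: "lin_indep n f" using f_near \<delta>(3) by (intro \<delta>0(2)) (meson less_le_trans)
    have "lin_indep n (\<lambda>l. (B ! J (t l)) (e l))"
      unfolding lin_indep_def
    proof (intro allI impI)
      fix a l assume "(\<Sum>l<n. a l *\<^sub>C (B ! J (t l)) (e l)) = 0" and l: "l < n"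
      then have "(\<Sum>l<n. (a l * c (t l)) *\<^sub>C f l) = 0" by (simp add: Bf scaleC_scaleC)
      from lin_indepD[OF indf this l] show "a l = 0" using c[OF l] by simp
    qed
    then have "adapted e n B (J \<circ> t)"
      using near by (intro adapted_near[OF B]) blast+
    then interpret B: adapted e n B "J \<circ> t" .
    have Bh: "B.h l = c (t l) *\<^sub>C f l" if "l < n" for l
      using Bf[OF that] by (simp add: B.h_def)
    define w where "w = (\<Prod>a<k. c (t a))"
    have w: "w \<noteq> 0" using c k by (simp add: w_def)
    \<comment> \<open>The top-degree condition here is that of \<open>B\<close>, whose types are
      \<open>J \<circ> t\<close>; it admits more multi-indices than the one for
      \<open>A\<close>.\<close>
    define \<rho>' where "\<rho>' L = (if inj_on L {..<k} \<and> degree_of (J \<circ> t \<circ> L) k = degree_of (J \<circ> t) k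
      then (\<Prod>a<k. c (t (L a))) / w else 0)" for L
    have ext: "B.ext_op k = w *\<^sub>C weighted k \<rho>' f"
      unfolding B.ext_op_def weighted_def
    proof (rule oper_scale)
      fix L assume L: "L \<in> PiE {..<k} (\<lambda>_. {..<n})"
      have "wedge k (B.h \<circ> L) = (\<Prod>a<k. c (t (L a))) *\<^sub>C wedge k (f \<circ> L)"
        using L Bh by (intro wedge_scale) auto
      then show "(if degree_of (J \<circ> t \<circ> L) k = degree_of (J \<circ> t) k then wedge k (B.h \<circ> L) else 0)
        = w *\<^sub>C \<rho>' L *\<^sub>C wedge k (f \<circ> L)"
        using w by (auto simp: \<rho>'_def scaleC_scaleC wedge_not_inj)
    qed
    \<comment> \<open>The same map \<open>B ! J (t l)\<close> is applied to \<open>e l'\<close> in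
      two ways: at type \<open>t l\<close> it is compared with \<open>A ! t l\<close>, which kills
      \<open>e l'\<close>, and at type \<open>t l'\<close> it gives
      \<open>c (t l') *\<^sub>C f l'\<close>.\<close>
    have decay: "cmod (c (t l')) \<le> \<eta> * cmod (c (t l))"
      if l: "l < n" "l' < n" "t l < t l'" "J (t l) = J (t l')" for l l'
    proof -
      have "e l' \<in> dom_seq A (Suc (t l))" using l by (intro e_in_dom) auto
      then have A0: "(A ! t l) (e l') = 0" by simp
      have "norm (inverse (c (t l)) *\<^sub>C (B ! J (t l)) (e l') - (A ! t l) (e l')) < \<delta>"
        using near[OF t_less[OF l(1)]] l by simp
      then have "cmod (c (t l')) * norm (f l') / cmod (c (t l)) < \<delta>"
        unfolding A0 l(4) Bf[OF l(2)]
        by (simp add: norm_scaleC norm_mult norm_inverse divide_inverse mult_ac)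
      then have up: "cmod (c (t l')) * norm (f l') < \<delta> * cmod (c (t l))"
        using c[OF l(1)] by (simp add: divide_less_eq)
      have "\<mu> / 2 \<le> norm (f l')"
      proof -
        have "\<eta> * \<mu> \<le> 1 * \<mu>" using \<eta>(2) \<mu>(1) by (intro mult_right_mono) auto
        then have "norm (f l' - h l') < \<mu> / 2" using f_near[OF l(2)] \<delta>(4) by simp
        moreover have "norm (h l') \<le> norm (f l') + norm (f l' - h l')"
          by (metis norm_minus_commute norm_triangle_sub)
        ultimately show ?thesis using \<mu>(2)[OF l(2)] by simp
      qed
      then have "cmod (c (t l')) * (\<mu> / 2) \<le> cmod (c (t l')) * norm (f l')"
        by (intro mult_left_mono) auto
      also note up
      also have "\<delta> * cmod (c (t l)) \<le> \<eta> * \<mu> / 2 * cmod (c (t l))"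
        using \<delta>(4) by (intro mult_right_mono) auto
      finally have "cmod (c (t l')) * (\<mu> / 2) \<le> (\<eta> * cmod (c (t l))) * (\<mu> / 2)" by (simp add: mult_ac)
      then show ?thesis by (rule mult_right_le_imp_le) (use \<mu>(1) in simp)
    qed
    have "weighted k \<rho>' f \<in> S"
    proof (rule \<epsilon>(2))
      fix l assume "l < n"
      then show "norm (f l - h l) < \<epsilon>" using f_near \<delta>(2) by (meson less_le_trans)
    next
      fix L assume L: "L \<in> PiE {..<k} (\<lambda>_. {..<n})"
      show "cmod (\<rho>' L - \<rho> L) < \<epsilon>"
      proof (cases "inj_on L {..<k} \<and> degree_of (J \<circ> t \<circ> L) k = degree_of (J \<circ> t) k")
        case True
        show ?thesis
        proof (cases "degree_of (t \<circ> L) k = degree_of t k")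
          case t_eq: True
          have "(\<Prod>a<k. c (t (L a))) = w"
            using degree_of_prod[OF t_eq, of c] by (simp add: w_def)
          then show ?thesis using True t_eq w \<epsilon>(1) by (simp add: \<rho>_def \<rho>'_def)
        next
          case False
          have "cmod ((\<Prod>a<k. c (t (L a))) / (\<Prod>a<k. c (t a))) \<le> \<eta>"
          proof (rule multiindex_ratio[OF L _ k(2) t_mono _ _ False, where J = J])
            show "J (t i) \<le> J (t j)" if "i \<le> j" "j < n" for i j using B.t_mono[OF that] by simp
          qed (use True c decay \<eta> in auto)
          then show ?thesis using True False \<eta>(3) by (simp add: \<rho>_def \<rho>'_def w_def)
        qed
      next
        case False
        \<comment> \<open>Equal degrees for \<open>t\<close> stay equal after merging types by
          \<open>J\<close>; so a coefficient that is zero for \<open>B\<close> is zero for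
          \<open>A\<close> as well.\<close>
        moreover have "degree_of (t \<circ> L) k \<noteq> degree_of t k \<or> \<not> inj_on L {..<k}"
          using False degree_of_comp[of "t \<circ> L" k t J, unfolded o_assoc] by blast
        ultimately show ?thesis using \<epsilon>(1) by (auto simp: \<rho>_def \<rho>'_def)
      qed
    qed
    moreover have "inverse w *\<^sub>C w *\<^sub>C weighted k \<rho>' f = weighted k \<rho>' f"
      using w by (simp add: scaleC_scaleC scaleC_one)
    ultimately show "\<exists>w. w \<noteq> 0 \<and> ext_seq k B \<noteq> 0 \<and> ext_seq k B \<in> End_ext k \<and> inverse w *\<^sub>C ext_seq k B \<in> S"
      using w B.ext_op_nonzero[OF B.h_indep[OF ds] k(2)] B.ext_op_End[of k]
      unfolding B.ext_seq_eq[OF k] by (intro exI[of _ w]) (simp only: ext, simp)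
  qed
qed

end

section \<open>Well-definedness on classes and continuity\<close>

context
  assumes fin: "\<exists>B :: 'v::hermitian_space set. finite B \<and> cspan B = UNIV"
begin

lemma phi_in_Hinge: "A \<in> MH_set \<Longrightarrow> phi A \<in> (Hinge :: 'v rel list set)"
proof -
  assume A: "A \<in> MH_set"
  then obtain e t u where "adapted_MH e (cdim (UNIV :: 'v set)) A t u"
    using ex_adapted_MH[OF A fin] by blast
  then interpret adapted_MH e "cdim (UNIV :: 'v set)" A t u .
  show ?thesis using A by (intro phi_in_Hinge) (simp add: MH_set_def)
qed

lemma Pphi_proj_seq:
  fixes A :: "('v \<Rightarrow> 'v) list"
  assumes A: "A \<in> MH_set"
  shows "Pphi (proj_seq A) = hinge_equiv `` {phi A}"
  unfolding Pphi_def
proof (rule the_equality)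
  fix h assume "\<exists>B\<in>MH_set. proj_seq B = proj_seq A \<and> h = hinge_equiv `` {phi B}"
  then obtain B where B: "B \<in> MH_set" "proj_seq B = proj_seq A" "h = hinge_equiv `` {phi B}" by blast
  then show "h = hinge_equiv `` {phi A}"
    using equiv_class_eq[OF hinge_equiv_equiv phi_proj_seq[OF fin B(2,1) A]] by simp
qed (use A in blast)

lemma proj_class_ext_seq:
  fixes A B :: "('v \<Rightarrow> 'v) list"
  assumes A: "A \<in> MH_set" and B: "B \<in> MH_set" and eq: "(phi A, phi B) \<in> hinge_equiv"
    and k: "1 \<le> k" "k \<le> cdim (UNIV :: 'v set)"
  shows "proj_class (ext_seq k B) = proj_class (ext_seq k A)"
proof -
  obtain e t u where "adapted_MH e (cdim (UNIV :: 'v set)) A t u"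
    using ex_adapted_MH[OF A fin] by blast
  then interpret adapted_MH e "cdim (UNIV :: 'v set)" A t u .
  show ?thesis using A B eq k by (intro ext_seq_hinge_equiv) (simp_all add: MH_set_def)
qed

lemma lambda_bar_proj_seq:
  fixes A :: "('v \<Rightarrow> 'v) list"
  assumes A: "A \<in> MH_set"
  shows "lambda_bar (proj_seq A) = (\<lambda>k\<in>{1..<cdim (UNIV :: 'v set)}. proj_class (ext_seq k A))"
  unfolding lambda_bar_def
proof (rule the_equality)
  fix l assume "\<exists>B\<in>MH_set. proj_seq B = proj_seq A
    \<and> l = (\<lambda>k\<in>{1..<cdim (UNIV :: 'v set)}. proj_class (ext_seq k B))"
  then obtain B where B: "B \<in> MH_set" "proj_seq B = proj_seq A"
    "l = (\<lambda>k\<in>{1..<cdim (UNIV :: 'v set)}. proj_class (ext_seq k B))" by blast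
  show "l = (\<lambda>k\<in>{1..<cdim (UNIV :: 'v set)}. proj_class (ext_seq k A))"
    unfolding B(3) using proj_class_ext_seq[OF A B(1) phi_proj_seq[OF fin B(2)[symmetric] A B(1)]]
    by (intro restrict_ext) auto
qed (use A in blast)

text \<open>Points of \<open>PMH\<close> with the same image under \<open>Pphi\<close> have
  representatives with equivalent hinges, and the classes of \<open>ext_seq\<close> depend only on
  the equivalence class.\<close>

lemma lambda_circ_Pphi:
  fixes p :: "('v \<Rightarrow> 'v) set list"
  assumes p: "p \<in> PMH"
  shows "lambda_circ (Pphi p) = lambda_bar p"
  unfolding lambda_circ_def
proof (rule the_equality)
  from p obtain A where A: "A \<in> MH_set" "p = proj_seq A" by (auto simp: PMH_def)
  fix l assume "\<exists>q\<in>PMH. Pphi q = Pphi p \<and> l = lambda_bar q"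
  then obtain B where B: "B \<in> MH_set" "Pphi (proj_seq B) = Pphi p" "l = lambda_bar (proj_seq B)"
    by (auto simp: PMH_def)
  then have "hinge_equiv `` {phi A} = hinge_equiv `` {phi B}"
    unfolding A(2) Pphi_proj_seq[OF A(1)] Pphi_proj_seq[OF B(1)] by simp
  then have "(phi A, phi B) \<in> hinge_equiv"
    using eq_equiv_class[OF _ hinge_equiv_equiv phi_in_Hinge[OF B(1)]] by blast
  then show "l = lambda_bar p"
    unfolding B(3) A(2) lambda_bar_proj_seq[OF A(1)] lambda_bar_proj_seq[OF B(1)]
    using proj_class_ext_seq[OF A(1) B(1)] by (intro restrict_ext) auto
qed (use p in blast)

lemma ext_seq_in_End_ext:
  fixes A :: "('v \<Rightarrow> 'v) list"
  assumes A: "A \<in> MH_set" and k: "1 \<le> k" "k \<le> cdim (UNIV :: 'v set)"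
  shows "ext_seq k A \<in> End_ext k - {0}"
proof -
  obtain e t u where "adapted_MH e (cdim (UNIV :: 'v set)) A t u"
    using ex_adapted_MH[OF A fin] by blast
  then interpret adapted_MH e "cdim (UNIV :: 'v set)" A t u .
  show ?thesis
    unfolding ext_seq_eq[OF k] using ext_op_End ext_op_nonzero[OF lin_indep_h k(2)] by simp
qed

lemma continuous_map_ext_seq:
  assumes k: "1 \<le> k" "k < cdim (UNIV :: 'v set)"
  shows "continuous_map (PMH_topology :: ('v \<Rightarrow> 'v) set list topology) (proj_topology (End_ext k))
    (\<lambda>p. lambda_bar p k)"
proof -
  let ?n = "cdim (UNIV :: 'v set)"
  have lam: "lambda_bar (proj_seq A) k = proj_class (ext_seq k A)" if "A \<in> MH_set" for A :: "('v \<Rightarrow> 'v) list"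
    using k by (simp add: lambda_bar_proj_seq[OF that])
  note top = topspace_PMH_topology
  show ?thesis
    unfolding continuous_map_def top
  proof (intro conjI allI impI)
    show "(\<lambda>p. lambda_bar p k) \<in> (PMH :: ('v \<Rightarrow> 'v) set list set) \<rightarrow> topspace (proj_topology (End_ext k))"
    proof
      fix p :: "('v \<Rightarrow> 'v) set list" assume "p \<in> PMH"
      then obtain A where A: "A \<in> MH_set" "p = proj_seq A" by (auto simp: PMH_def)
      then show "lambda_bar p k \<in> topspace (proj_topology (End_ext k))"
        using ext_seq_in_End_ext[OF A(1) k(1)] k(2) by (simp add: lam proj_space_def)
    qed
    fix S :: "'v ext_end set set"
    assume S: "openin (proj_topology (End_ext k)) S"
    then obtain T where T: "open T" "{w \<in> End_ext k - {0}. proj_class w \<in> S} = (End_ext k - {0}) \<inter> T"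
      unfolding openin_proj_topology openin_open by auto
    show "openin (PMH_topology :: ('v \<Rightarrow> 'v) set list topology) {p \<in> PMH. lambda_bar p k \<in> S}"
    proof (rule openin_PMH_topologyI)
      fix A :: "('v \<Rightarrow> 'v) list"
      assume A: "A \<in> MH_set" and AS: "proj_seq A \<in> {p \<in> PMH. lambda_bar p k \<in> S}"
      then have M: "A \<in> M_set" by (simp add: MH_set_def)
      obtain e t u where "adapted_MH e ?n A t u"
        using ex_adapted_MH[OF A fin] by blast
      then interpret adapted_MH e ?n A t u .
      have "ext_seq k A \<in> T"
        using AS T(2) ext_seq_in_End_ext[OF A k(1)] k(2) by (auto simp: lam[OF A])
      with T(1) k have "1 \<le> k" "k \<le> ?n" "open T" "ext_seq k A \<in> T" by simp_all
      then obtain \<delta> where \<delta>: "0 < \<delta>" and near: "\<And>B J c. B \<in> MH_set \<Longrightarrow>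
          (\<And>i. i < length A \<Longrightarrow> J i < length B \<and> dom_seq A i \<subseteq> dom_seq B (J i)
            \<and> (\<exists>x\<in>dom_seq A i. (B ! J i) x \<noteq> 0) \<and> c i \<noteq> 0
            \<and> (\<forall>l<?n. i \<le> t l \<longrightarrow> norm (inverse (c i) *\<^sub>C (B ! J i) (e l) - (A ! i) (e l)) < \<delta>))
        \<Longrightarrow> \<exists>w. w \<noteq> 0 \<and> ext_seq k B \<noteq> 0 \<and> ext_seq k B \<in> End_ext k \<and> inverse w *\<^sub>C ext_seq k B \<in> T"
        by (rule ext_seq_near) blast
      \<comment> \<open>The \<open>e l\<close> with \<open>i \<le> t l\<close> form a basis of
        \<open>V(A)_i\<close>. Since the scalar \<open>c\<close> is quantified inside, closeness to
        some multiple of \<open>A ! i\<close> is invariant under scaling and defines a set of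
        classes.\<close>
      define Q where "Q i f \<longleftrightarrow> (\<exists>c. c \<noteq> 0 \<and>
        (\<forall>l<?n. i \<le> t l \<longrightarrow> norm (inverse c *\<^sub>C f (e l) - (A ! i) (e l)) < \<delta>))" for i and f :: "'v \<Rightarrow> 'v"
      define H where "H i = hom_space (dom_seq A i) (UNIV :: 'v set)" for i
      define U where "U i = proj_class ` {f \<in> H i - {0}. Q i f}" for i
      have Q_scale: "Q i (d *\<^sub>C f)" if "d \<noteq> 0" "f \<in> H i - {0}" "Q i f" for i d f
      proof -
        from that(3) obtain c where "c \<noteq> 0"
          "\<forall>l<?n. i \<le> t l \<longrightarrow> norm (inverse c *\<^sub>C f (e l) - (A ! i) (e l)) < \<delta>"
          unfolding Q_def by blast
        moreover have "inverse (c * d) *\<^sub>C (d *\<^sub>C f) x = inverse c *\<^sub>C f x" for x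
          using that(1) by (simp add: scaleC_fun_def scaleC_scaleC)
        ultimately show ?thesis
          unfolding Q_def using that(1) by (intro exI[of _ "c * d"]) simp
      qed
      have Q_open: "open {f. Q i f}" for i
      proof -
        have "open {f :: 'v \<Rightarrow> 'v. norm (inverse c *\<^sub>C f (e l) - (A ! i) (e l)) < \<delta>}" for c l
          by (intro open_Collect_less continuous_intros continuous_on_product_coordinates)
        then have op: "open (\<Inter>l\<in>{l. l < ?n \<and> i \<le> t l}.
            {f :: 'v \<Rightarrow> 'v. norm (inverse c *\<^sub>C f (e l) - (A ! i) (e l)) < \<delta>})" for c
          by (intro open_INT) auto
        \<comment> \<open>For fixed \<open>c\<close> only finitely many values of \<open>f\<close>
          are restricted, an open condition for pointwise convergence.\<close>
        have "{f. Q i f} = (\<Union>c\<in>- {0}. \<Inter>l\<in>{l. l < ?n \<and> i \<le> t l}.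
            {f. norm (inverse c *\<^sub>C f (e l) - (A ! i) (e l)) < \<delta>})"
          unfolding Q_def by (rule set_eqI) (simp add: Bex_def imp_conjL)
        then show ?thesis by (rule ssubst) (intro open_UN ballI op)
      qed
      have U: "openin (proj_topology (H i)) (U i)"
        "f \<in> H i - {0} \<Longrightarrow> proj_class f \<in> U i \<longleftrightarrow> Q i f" for i f
      proof -
        note scale = Q_scale[where i = i]
        note I = openin_proj_topologyI[where W = "H i" and Q = "Q i" and T = "{f. Q i f}",
            OF scale Q_open, unfolded mem_Collect_eq]
        show "openin (proj_topology (H i)) (U i)" unfolding U_def by (rule I(1)) auto
        show "f \<in> H i - {0} \<Longrightarrow> proj_class f \<in> U i \<longleftrightarrow> Q i f" unfolding U_def by (rule I(2)) auto
      qed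
      show "\<exists>U. (\<forall>i<length A. openin (proj_topology (hom_space (dom_seq A i) UNIV)) (U i)
          \<and> proj_class (A ! i) \<in> U i)
        \<and> (\<forall>B\<in>MH_set. proj_seq B \<in> PM_nbhd A U \<longrightarrow> proj_seq B \<in> {p \<in> PMH. lambda_bar p k \<in> S})"
      proof (intro exI[of _ U] conjI allI ballI impI)
        show "openin (proj_topology (hom_space (dom_seq A i) UNIV)) (U i)" for i
          using U(1)[of i] by (simp add: H_def)
        fix i assume i: "i < length A"
        then have "A ! i \<in> H i - {0}" using M by (simp add: M_set_def H_def)
        moreover have "Q i (A ! i)"
          unfolding Q_def using \<delta> by (intro exI[of _ 1]) (simp add: scaleC_one)
        ultimately show "proj_class (A ! i) \<in> U i" using U(2) by blast
      next
        fix B :: "('v \<Rightarrow> 'v) list" assume B: "B \<in> MH_set" and AB: "proj_seq B \<in> PM_nbhd A U"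
        then have BM: "B \<in> M_set" by (simp add: MH_set_def)
        have "\<exists>J c. i < length A \<longrightarrow> J < length B \<and> dom_seq A i \<subseteq> dom_seq B J
            \<and> (\<exists>x\<in>dom_seq A i. (B ! J) x \<noteq> 0) \<and> c \<noteq> 0
            \<and> (\<forall>l<?n. i \<le> t l \<longrightarrow> norm (inverse c *\<^sub>C (B ! J) (e l) - (A ! i) (e l)) < \<delta>)" for i
          proof (cases "i < length A")
            case True
            with AB obtain J where J: "J < length B" "dom_seq A i \<subseteq> dom_seq B J"
              "restr (B ! J) (dom_seq A i) \<noteq> 0" "proj_class (restr (B ! J) (dom_seq A i)) \<in> U i"
              unfolding PM_nbhd_iff[OF BM] by blast
            have "B ! J \<in> hom_space (dom_seq B J) UNIV" using BM J(1) by (simp add: M_set_def)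
            then have "restr (B ! J) (dom_seq A i) \<in> H i - {0}"
              unfolding H_def using J True M by (auto intro!: restr_hom_space csubspace_dom_seq)
            with J(4) have "Q i (restr (B ! J) (dom_seq A i))" using U(2) by blast
            then obtain c where c: "c \<noteq> 0" "\<forall>l<?n. i \<le> t l \<longrightarrow>
                norm (inverse c *\<^sub>C restr (B ! J) (dom_seq A i) (e l) - (A ! i) (e l)) < \<delta>"
              unfolding Q_def by blast
            \<comment> \<open>\<open>i \<le> t l\<close> places \<open>e l\<close> in
              \<open>V(A)_i\<close>, where restriction changes nothing.\<close>
            then have "\<forall>l<?n. i \<le> t l \<longrightarrow> norm (inverse c *\<^sub>C (B ! J) (e l) - (A ! i) (e l)) < \<delta>"
              using e_in_dom by (auto simp: restr_def)
            moreover have "\<exists>x\<in>dom_seq A i. (B ! J) x \<noteq> 0"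
              using J(3) by (auto simp: restr_def fun_eq_iff split: if_splits)
            ultimately show ?thesis using J c(1) by blast
          qed simp
        then have "\<forall>i. \<exists>J c. i < length A \<longrightarrow> J < length B \<and> dom_seq A i \<subseteq> dom_seq B J
            \<and> (\<exists>x\<in>dom_seq A i. (B ! J) x \<noteq> 0) \<and> c \<noteq> 0
            \<and> (\<forall>l<?n. i \<le> t l \<longrightarrow> norm (inverse c *\<^sub>C (B ! J) (e l) - (A ! i) (e l)) < \<delta>)" ..
        then obtain J c where "\<And>i. i < length A \<Longrightarrow> J i < length B \<and> dom_seq A i \<subseteq> dom_seq B (J i)
            \<and> (\<exists>x\<in>dom_seq A i. (B ! J i) x \<noteq> 0) \<and> c i \<noteq> 0
            \<and> (\<forall>l<?n. i \<le> t l \<longrightarrow> norm (inverse (c i) *\<^sub>C (B ! J i) (e l) - (A ! i) (e l)) < \<delta>)"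
          unfolding choice_iff by blast
        from near[OF B this] obtain w where w: "w \<noteq> 0" "ext_seq k B \<noteq> 0" "ext_seq k B \<in> End_ext k"
          "inverse w *\<^sub>C ext_seq k B \<in> T" by blast
        have "inverse w *\<^sub>C ext_seq k B \<in> End_ext k"
          using w(3) unfolding End_ext_def by (rule hom_space_scale[OF _ csubspace_ext_power])
        moreover have "inverse w *\<^sub>C ext_seq k B \<noteq> 0" using w(1,2) by simp
        ultimately have "proj_class (inverse w *\<^sub>C ext_seq k B) \<in> S" using w(4) T(2) by blast
        then have "proj_class (ext_seq k B) \<in> S" using w(1) by (simp add: proj_class_scale)
        then show "proj_seq B \<in> {p \<in> PMH. lambda_bar p k \<in> S}"
          using B by (auto simp: lam PMH_def)
      qed
    qed auto
  qed
qed

end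

theorem corollary8p3:
  fixes n :: nat
  assumes "\<exists>B :: 'v::hermitian_space set. finite B \<and> cspan B = UNIV"
    and "cdim (UNIV :: 'v set) = n"
    and "n \<ge> 1"
  shows "continuous_map
    (PMH_topology :: ('v \<Rightarrow> 'v) set list topology)
    (Hinge_star_topology :: 'v rel list set topology)
    Pphi"
  unfolding Hinge_star_topology_def
\<comment> \<open>Continuity into a pullback topology is continuity of the composite with
  \<open>lambda_circ\<close>, which is \<open>lambda_bar\<close> on \<open>PMH\<close>; in the
  product topology this is checked for each \<open>k\<close> separately.\<close>
proof (rule continuous_map_pullback')
  have top: "topspace (PMH_topology :: ('v \<Rightarrow> 'v) set list topology) \<subseteq> PMH"
    by (simp add: PMH_topology_def)
  show "topspace (PMH_topology :: ('v \<Rightarrow> 'v) set list topology) \<subseteq> Pphi -` Hinge_star"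
  proof
    fix p :: "('v \<Rightarrow> 'v) set list" assume "p \<in> topspace PMH_topology"
    with top obtain A where A: "A \<in> MH_set" "p = proj_seq A" by (auto simp: PMH_def)
    show "p \<in> Pphi -` Hinge_star"
      using phi_in_Hinge[OF assms(1) A(1)]
      by (simp add: A(2) Pphi_proj_seq[OF assms(1) A(1)] Hinge_star_def quotientI)
  qed
  have "continuous_map (PMH_topology :: ('v \<Rightarrow> 'v) set list topology) proj_End_prod_topology lambda_bar"
    unfolding proj_End_prod_topology_def continuous_map_componentwise
  proof (intro conjI ballI)
    show "lambda_bar ` topspace (PMH_topology :: ('v \<Rightarrow> 'v) set list topology)
      \<subseteq> extensional {1..<cdim (UNIV :: 'v set)}"
    proof (rule image_subsetI)
      fix p :: "('v \<Rightarrow> 'v) set list" assume "p \<in> topspace PMH_topology"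
      with top obtain A where A: "A \<in> MH_set" "p = proj_seq A" by (auto simp: PMH_def)
      then show "lambda_bar p \<in> extensional {1..<cdim (UNIV :: 'v set)}"
        by (simp add: lambda_bar_proj_seq[OF assms(1)])
    qed
  next
    fix k assume "k \<in> {1..<cdim (UNIV :: 'v set)}"
    then show "continuous_map (PMH_topology :: ('v \<Rightarrow> 'v) set list topology)
        (proj_topology (End_ext k)) (\<lambda>p. lambda_bar p k)"
      by (intro continuous_map_ext_seq[OF assms(1)]) auto
  qed
  then show "continuous_map (PMH_topology :: ('v \<Rightarrow> 'v) set list topology) proj_End_prod_topology
      (lambda_circ \<circ> Pphi)"
    by (rule continuous_map_eq) (use top lambda_circ_Pphi[OF assms(1)] in auto)
qed

end
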